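(* Let $\mathfrak{s}=\mathfrak{s}_1\dots\mathfrak{s}_{m+n}$ be a parity sequence with $m$ zeros and $n$ ones, let $p$ be a nonnegative integer, and let $L(\lambda(u))$ be the irreducible highest weight representation of $\mathrm{Y}_p(\mathfrak{gl}^{\mathfrak{s}}_{m|n})$ whose highest weight $\lambda(u)=(\lambda_1(u),\dots,\lambda_{m+n}(u))$ has components $$\lambda_j(u)=(u+\lambda_j^{(1)})\cdots(u+\lambda_j^{(p)}),\qquad \lambda_j^{(r)}\in\mathbb{C},\quad j=1,\dots,m+n.$$ Let $i\in\{1,\dots,m+n-1\}$ and suppose that the roots of $\lambda_i(u)$ and $\lambda_{i+1}(u)$ are numbered in such a way that, for a certain $k\in\{0,1,\dots,p\}$, $\lambda_i^{(r)}=\lambda_{i+1}^{(r)}$ for all $r=k+1,\dots,p$, while $\lambda_i^{(r)}\neq\lambda_{i+1}^{(s)}$ for all $1\leqslant r,s\leqslant k$. Define $$\lambda_i^{\pm}(u)=(u+\lambda_{i+1}^{(1)}\pm1)\cdots(u+\lambda_{i+1}^{(k)}\pm1)(u+\lambda_{i+1}^{(k+1)})\cdots(u+\lambda_{i+1}^{(p)}),$$ $$\lambda_{i+1}^{\pm}(u)=(u+\lambda_i^{(1)}\pm1)\cdots(u+\lambda_i^{(k)}\pm1)(u+\lambda_i^{(k+1)})\cdots(u+\lambda_i^{(p)}),$$ and $\lambda_j^{\pm}(u)=\lambda_j(u)$ for $j\neq i,i+1$, and let $\lambda^{\pm}(u)=(\lambda_1^{\pm}(u),\dots,\lambda_{m+n}^{\pm}(u))$.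 Then: 1. If $\mathfrak{s}_i\mathfrak{s}_{i+1}=01$, then the $\mathrm{Y}_p(\mathfrak{gl}_{m|n})$-module $L(\lambda(u))$ associated with $\mathfrak{s}$ is isomorphic to the $\mathrm{Y}_p(\mathfrak{gl}_{m|n})$-module $L(\lambda^-(u))$ associated with $\mathfrak{s}^-$, where $\mathfrak{s}^-$ is obtained from $\mathfrak{s}$ by replacing $\mathfrak{s}_i\mathfrak{s}_{i+1}=01$ with $10$ and leaving the other terms unchanged. 2. If $\mathfrak{s}_i\mathfrak{s}_{i+1}=10$, then the $\mathrm{Y}_p(\mathfrak{gl}_{m|n})$-module $L(\lambda(u))$ associated with $\mathfrak{s}$ is isomorphic to the $\mathrm{Y}_p(\mathfrak{gl}_{m|n})$-module $L(\lambda^+(u))$ associated with $\mathfrak{s}^+$, where $\mathfrak{s}^+$ is obtained from $\mathfrak{s}$ by replacing $\mathfrak{s}_i\mathfrak{s}_{i+1}=10$ with $01$ and leaving the other terms unchanged.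
   Context: A parity sequence is a sequence $\mathfrak{s}=\mathfrak{s}_1\dots\mathfrak{s}_{m+n}$ of $0$'s and $1$'s with exactly $m$ zeros ($m,n\geqslant 0$ integers). For a fixed $\mathfrak{s}$ write $\bar\imath=\mathfrak{s}_i$. The Yangian $\mathrm{Y}(\mathfrak{gl}^{\mathfrak{s}}_{m|n})$ is the unital associative $\mathbb{Z}_2$-graded algebra over $\mathbb{C}$ with generators $t_{ij}^{(r)}$ of parity $\bar\imath+\bar\jmath \bmod 2$, $1\leqslant i,j\leqslant m+n$, $r=1,2,\dots$. With $t_{ij}(u)=\delta_{ij}+\sum_{r\geqslant1}t_{ij}^{(r)}u^{-r}$, the defining relations are $$[t_{ij}(u),t_{kl}(v)]=\frac{1}{u-v}\big(t_{kj}(u)t_{il}(v)-t_{kj}(v)t_{il}(u)\big)(-1)^{\bar\imath\bar\jmath+\bar\imath\bar k+\bar\jmath\bar k},$$ where $[a,b]=ab-(-1)^{|a||b|}ba$ is the super-commutator on homogeneous elements, $|a|$ being the parity of $a$. The Yangian of level $p$, $\mathrm{Y}_p(\mathfrak{gl}^{\mathfrak{s}}_{m|n})$, is the quotient of $\mathrm{Y}(\mathfrak{gl}^{\mathfrak{s}}_{m|n})$ by the two-sided ideal generated by all $t_{ij}^{(r)}$ with $r>p$. In it set $T_{ij}(u)=u^pt_{ij}(u)=\delta_{ij}u^p+t_{ij}^{(1)}u^{p-1}+\dots+t_{ij}^{(p)}$. A highest weight representation of $\mathrm{Y}_p(\mathfrak{gl}^{\mathfrak{s}}_{m|n})$ with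 highest weight $\lambda(u)=(\lambda_1(u),\dots,\lambda_{m+n}(u))$, a tuple of monic polynomials in $u$ of degree $p$, is a representation generated by a nonzero vector $\xi$ (highest vector) such that $T_{ab}(u)\xi=0$ for $a<b$ and $T_{jj}(u)\xi=\lambda_j(u)\xi$ for all $j$. The Verma module $M(\lambda(u))$ is the quotient of the algebra by the left ideal generated by all coefficients of $T_{ab}(u)$, $a<b$, and $T_{jj}(u)-\lambda_j(u)$; $L(\lambda(u))$ is its irreducible quotient, said to be associated with $\mathfrak{s}$. Identification of algebras: for the transposition $\sigma_i=(i,i+1)$ and $\mathfrak{s}'$ the sequence obtained from $\mathfrak{s}$ by interchanging the entries $\mathfrak{s}_i$ and $\mathfrak{s}_{i+1}$, the re-labelling map $T_{ab}(u)\mapsto T_{\sigma_i(a)\,\sigma_i(b)}(u)$ is an algebra isomorphism $\mathrm{Y}_p(\mathfrak{gl}^{\mathfrak{s}'}_{m|n})\to\mathrm{Y}_p(\mathfrak{gl}^{\mathfrak{s}}_{m|n})$. A module over the second algebra is regarded as a module over the first via this map; the statement that a module associated with $\mathfrak{s}$ is isomorphic to a module associated with $\mathfrak{s}'$ means that there is an invertible linear map intertwining the actions under this identification. *)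

theory Defs
  imports
    Complex_Main
    "HOL-Library.Poly_Mapping"
    "HOL-Computational_Algebra.Polynomial"
    "HOL-Combinatorics.Transposition"
    "HOL-Algebra.QuotRing"
    "HOL-Algebra.Module"
begin

section \<open>Free associative algebras over the complex numbers\<close>

text \<open>
  The free monoid on a type, written additively (0 is the empty word, + is concatenation), so that
  the monoid algebra is the type of finitely supported functions from words to complex numbers
  with the convolution product of \<^theory>\<open>HOL-Library.Poly_Mapping\<close>.
\<close>

datatype 'x word = Word (letters: "'x list")

instantiation word :: (type) monoid_add
begin

definition zero_word :: "'a word" where "zero_word = Word []"

definition plus_word :: "'a word \<Rightarrow> 'a word \<Rightarrow> 'a word"
  where "plus_word v w = Word (letters v @ letters w)"

instance by standard (simp_all add: zero_word_def plus_word_def)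

end

type_synonym 'x free_alg = "'x word \<Rightarrow>\<^sub>0 complex"

text \<open>
  A \<open>\<complex>\<close>-algebra is represented by its underlying ring; the scalars act through
  the constant elements below (and their images in quotients).  Thus ring ideals
  are algebra ideals, and modules over the ring carry a complex vector space structure for which
  every homomorphism of modules is linear.
\<close>

definition scalar :: "complex \<Rightarrow> 'x free_alg"
  where "scalar c = Poly_Mapping.single 0 c"

definition free_algebra :: "'x set \<Rightarrow> 'x free_alg ring"
  where "free_algebra X =
    \<lparr>carrier = {f. \<forall>w \<in> Poly_Mapping.keys f. set (letters w) \<subseteq> X},
     mult = (*), one = 1, zero = 0, add = (+)\<rparr>"

text \<open>The homomorphism of free algebras induced by a map of generators.\<close>

definition relabel :: "('x \<Rightarrow> 'y) \<Rightarrow> 'x free_alg \<Rightarrow> 'y free_alg"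
  where "relabel g f =
    (\<Sum>w \<in> Poly_Mapping.keys f. Poly_Mapping.single (map_word g w) (Poly_Mapping.lookup f w))"


section \<open>Left modules over a not necessarily commutative ring\<close>

text \<open>
  The locale \<^locale>\<open>module\<close> requires a commutative ring, but the record
  of modules and the locale \<^locale>\<open>submodule\<close> do not.  The fields \<open>mult\<close> and \<open>one\<close>, which
  the record inherits from rings, play no role.
\<close>

definition regular_module :: "'a ring \<Rightarrow> ('a, 'a) module"
  where "regular_module R =
    \<lparr>carrier = carrier R, mult = mult R, one = one R, zero = zero R, add = add R,
     smult = mult R\<rparr>"

definition gen_submodule :: "'r ring \<Rightarrow> ('r, 'a) module \<Rightarrow> 'a set \<Rightarrow> 'a set"
  where "gen_submodule R M S = \<Inter>{H. submodule H R M \<and> S \<subseteq> H}"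

definition quot_module :: "('r, 'a) module \<Rightarrow> 'a set \<Rightarrow> ('r, 'a set) module"
  where "quot_module M H =
    \<lparr>carrier = a_rcosets\<^bsub>M\<^esub> H, mult = undefined, one = undefined, zero = H, add = set_add M,
     smult = (\<lambda>a X. \<Union>x\<in>X. H +>\<^bsub>M\<^esub> (a \<odot>\<^bsub>M\<^esub> x))\<rparr>"

text \<open>
  The quotient by the sum of all proper submodules.  For a nonzero highest weight module this sum
  is itself proper (it does not contain the highest vector), hence it is the
  unique maximal proper submodule and the quotient is the unique irreducible quotient.
\<close>

definition irreducible_quotient :: "'r ring \<Rightarrow> ('r, 'a) module \<Rightarrow> ('r, 'a set) module"
  where "irreducible_quotient R M =
    quot_module M (gen_submodule R M (\<Union>{H. submodule H R M \<and> H \<noteq> carrier M}))"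

text \<open>The pull-back of a module along a map \<open>\<rho>\<close> into its ring of operators.\<close>

definition pullback_module :: "('q \<Rightarrow> 'r) \<Rightarrow> ('r, 'a) module \<Rightarrow> ('q, 'a) module"
  where "pullback_module \<rho> M =
    \<lparr>carrier = carrier M, mult = mult M, one = one M, zero = zero M, add = add M,
     smult = (\<lambda>a x. \<rho> a \<odot>\<^bsub>M\<^esub> x)\<rparr>"

definition modules_isomorphic :: "'r ring \<Rightarrow> ('r, 'a) module \<Rightarrow> ('r, 'b) module \<Rightarrow> bool"
  where "modules_isomorphic R M M' \<longleftrightarrow>
    (\<exists>\<phi>. bij_betw \<phi> (carrier M) (carrier M') \<and>
      (\<forall>x \<in> carrier M. \<forall>y \<in> carrier M. \<phi> (x \<oplus>\<^bsub>M\<^esub> y) = \<phi> x \<oplus>\<^bsub>M'\<^esub> \<phi> y) \<and>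
      (\<forall>a \<in> carrier R. \<forall>x \<in> carrier M. \<phi> (a \<odot>\<^bsub>M\<^esub> x) = a \<odot>\<^bsub>M'\<^esub> \<phi> x))"


section \<open>The Yangian of a parity sequence and its quotient of level p\<close>

text \<open>Parity sequences are indexed from 1; values outside \<open>{1..m + n}\<close> are irrelevant.\<close>

definition parity_sequence :: "nat \<Rightarrow> nat \<Rightarrow> (nat \<Rightarrow> nat) \<Rightarrow> bool"
  where "parity_sequence m n s \<longleftrightarrow>
    (\<forall>j \<in> {1..m + n}. s j \<in> {0, 1}) \<and> card {j \<in> {1..m + n}. s j = 0} = m"

text \<open>The triple \<open>(i, j, r)\<close> stands for the generator \<open>t\<^sub>i\<^sub>j\<^sup>(\<^sup>r\<^sup>)\<close>.\<close>

type_synonym gen = "nat \<times> nat \<times> nat"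

definition gens :: "nat \<Rightarrow> gen set"
  where "gens N = {1..N} \<times> {1..N} \<times> {1..}"

definition tgen :: "nat \<Rightarrow> nat \<Rightarrow> nat \<Rightarrow> gen free_alg"
  where "tgen i j r =
    (if r = 0 then (if i = j then 1 else 0) else Poly_Mapping.single (Word [(i, j, r)]) 1)"

text \<open>The super-commutator of \<open>t\<^sub>i\<^sub>j\<^sup>(\<^sup>r\<^sup>)\<close> and \<open>t\<^sub>k\<^sub>l\<^sup>(\<^sup>q\<^sup>)\<close>.\<close>

definition scomm :: "(nat \<Rightarrow> nat) \<Rightarrow> gen \<Rightarrow> gen \<Rightarrow> gen free_alg"
  where "scomm s x y = (case x of (i, j, r) \<Rightarrow> case y of (k, l, q) \<Rightarrow>
    tgen i j r * tgen k l q - (-1) ^ ((s i + s j) * (s k + s l)) * (tgen k l q * tgen i j r))"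

text \<open>
  The defining relations, multiplied by \<open>u - v\<close> (which is not a zero divisor on formal
  series in \<open>u\<^sup>-\<^sup>1\<close>, \<open>v\<^sup>-\<^sup>1\<close>): the element below is the difference of the coefficients of
  \<open>u\<^sup>-\<^sup>r v\<^sup>-\<^sup>q\<close> of the two sides.
  The coefficients at \<open>u v\<^sup>-\<^sup>q\<close> and \<open>u\<^sup>-\<^sup>r v\<close> vanish identically, since the series
  \<open>t\<^sub>i\<^sub>j(u)\<close> have constant terms 0 or 1.
\<close>

definition yangian_rels :: "nat \<Rightarrow> (nat \<Rightarrow> nat) \<Rightarrow> gen free_alg set"
  where "yangian_rels N s =
    {scomm s (i, j, r + 1) (k, l, q) - scomm s (i, j, r) (k, l, q + 1)
       - (-1) ^ (s i * s j + s i * s k + s j * s k) * (tgen k j r * tgen i l q - tgen k j q * tgen i l r)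
     | i j k l r q. {i, j, k, l} \<subseteq> {1..N}}"

definition yangian_ideal :: "nat \<Rightarrow> (nat \<Rightarrow> nat) \<Rightarrow> gen free_alg set"
  where "yangian_ideal N s = Idl\<^bsub>free_algebra (gens N)\<^esub> (yangian_rels N s)"

definition yangian :: "nat \<Rightarrow> (nat \<Rightarrow> nat) \<Rightarrow> gen free_alg set ring"
  where "yangian N s = free_algebra (gens N) Quot yangian_ideal N s"

definition yangian_class :: "nat \<Rightarrow> (nat \<Rightarrow> nat) \<Rightarrow> gen free_alg \<Rightarrow> gen free_alg set"
  where "yangian_class N s x = yangian_ideal N s +>\<^bsub>free_algebra (gens N)\<^esub> x"

definition level_ideal :: "nat \<Rightarrow> (nat \<Rightarrow> nat) \<Rightarrow> nat \<Rightarrow> gen free_alg set set"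
  where "level_ideal N s p =
    Idl\<^bsub>yangian N s\<^esub> {yangian_class N s (tgen i j r) | i j r. {i, j} \<subseteq> {1..N} \<and> r > p}"

type_synonym level_elem = "gen free_alg set set"

definition yangian_level :: "nat \<Rightarrow> (nat \<Rightarrow> nat) \<Rightarrow> nat \<Rightarrow> level_elem ring"
  where "yangian_level N s p = yangian N s Quot level_ideal N s p"

definition level_class :: "nat \<Rightarrow> (nat \<Rightarrow> nat) \<Rightarrow> nat \<Rightarrow> gen free_alg \<Rightarrow> level_elem"
  where "level_class N s p x = level_ideal N s p +>\<^bsub>yangian N s\<^esub> yangian_class N s x"

text \<open>The coefficient of \<open>u\<^sup>d\<close> in \<open>T\<^sub>i\<^sub>j(u) = u\<^sup>p t\<^sub>i\<^sub>j(u)\<close>.\<close>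

definition T_coeff ::
    "nat \<Rightarrow> (nat \<Rightarrow> nat) \<Rightarrow> nat \<Rightarrow> nat \<Rightarrow> nat \<Rightarrow> nat \<Rightarrow> level_elem"
  where "T_coeff N s p i j d =
    (if d \<le> p then level_class N s p (tgen i j (p - d)) else \<zero>\<^bsub>yangian_level N s p\<^esub>)"

text \<open>
  The re-labelling \<open>T\<^sub>a\<^sub>b(u) \<mapsto> T\<^sub>\<sigma>\<^sub>(\<^sub>a\<^sub>)\<^sub>\<sigma>\<^sub>(\<^sub>b\<^sub>)(u)\<close>.  On the free algebras it is \<open>relabel\<close>; as elements of the
  algebra of level p are cosets of cosets, the induced map is obtained by taking images twice
  (see \<open>relabel_level_iso\<close> and \<open>relabel_level_T_coeff\<close> below).
\<close>

abbreviation relabel_gen :: "(nat \<Rightarrow> nat) \<Rightarrow> gen \<Rightarrow> gen"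
  where "relabel_gen \<sigma> \<equiv> (\<lambda>(a, b, r). (\<sigma> a, \<sigma> b, r))"

definition relabel_level :: "(nat \<Rightarrow> nat) \<Rightarrow> level_elem \<Rightarrow> level_elem"
  where "relabel_level \<sigma> = (`) ((`) (relabel (relabel_gen \<sigma>)))"


section \<open>Highest weight modules\<close>

definition verma_left_ideal ::
    "nat \<Rightarrow> (nat \<Rightarrow> nat) \<Rightarrow> nat \<Rightarrow> (nat \<Rightarrow> complex poly) \<Rightarrow> level_elem set"
  where "verma_left_ideal N s p \<Lambda> =
    gen_submodule (yangian_level N s p) (regular_module (yangian_level N s p))
      ({T_coeff N s p a b d | a b d. {a, b} \<subseteq> {1..N} \<and> a < b} \<union>
       {T_coeff N s p j j d \<ominus>\<^bsub>yangian_level N s p\<^esub> level_class N s p (scalar (coeff (\<Lambda> j) d))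
        | j d. j \<in> {1..N}})"

definition verma_module ::
    "nat \<Rightarrow> (nat \<Rightarrow> nat) \<Rightarrow> nat \<Rightarrow> (nat \<Rightarrow> complex poly) \<Rightarrow> (level_elem, level_elem set) module"
  where "verma_module N s p \<Lambda> =
    quot_module (regular_module (yangian_level N s p)) (verma_left_ideal N s p \<Lambda>)"

definition L_module ::
    "nat \<Rightarrow> (nat \<Rightarrow> nat) \<Rightarrow> nat \<Rightarrow> (nat \<Rightarrow> complex poly) \<Rightarrow> (level_elem, level_elem set set) module"
  where "L_module N s p \<Lambda> = irreducible_quotient (yangian_level N s p) (verma_module N s p \<Lambda>)"

definition highest_weight :: "nat \<Rightarrow> (nat \<Rightarrow> nat \<Rightarrow> complex) \<Rightarrow> nat \<Rightarrow> complex poly"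
  where "highest_weight p l j = (\<Prod>r = 1..p. [:l j r, 1:])"

text \<open>The weights \<open>\<lambda>\<^sup>+(u)\<close> and \<open>\<lambda>\<^sup>-(u)\<close> are obtained for \<open>c = 1\<close> and \<open>c = -1\<close>.\<close>

definition reflected_weight ::
    "complex \<Rightarrow> nat \<Rightarrow> nat \<Rightarrow> nat \<Rightarrow> (nat \<Rightarrow> nat \<Rightarrow> complex) \<Rightarrow> nat \<Rightarrow> complex poly"
  where "reflected_weight c p i k l j =
    (if j = i then (\<Prod>r = 1..k. [:l (i + 1) r + c, 1:]) * (\<Prod>r = k + 1..p. [:l (i + 1) r, 1:])
     else if j = i + 1 then (\<Prod>r = 1..k. [:l i r + c, 1:]) * (\<Prod>r = k + 1..p. [:l i r, 1:])
     else highest_weight p l j)"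


section \<open>The algebras are rings and the re-labelling is an isomorphism\<close>

lemma free_algebra_ring: "ring (free_algebra X)"
proof -
  have keys_uminus: "Poly_Mapping.keys (- f) = Poly_Mapping.keys f" for f :: "'a free_alg"
    by (simp add: Poly_Mapping.keys.rep_eq)
  have add: "set (letters w) \<subseteq> X" if "w \<in> Poly_Mapping.keys (f + g)" 
     "\<forall>w\<in>Poly_Mapping.keys f. set (letters w) \<subseteq> X" "\<forall>w\<in>Poly_Mapping.keys g. set (letters w) \<subseteq> X" for f g :: "'a free_alg" and w
    using that keys_add[of f g] by blast
  have mult: "set (letters w) \<subseteq> X" if "w \<in> Poly_Mapping.keys (f * g)" 
     "\<forall>w\<in>Poly_Mapping.keys f. set (letters w) \<subseteq> X" "\<forall>w\<in>Poly_Mapping.keys g. set (letters w) \<subseteq> X" for f g :: "'a free_alg" and w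
  proof -
    have "w \<in> {a + b |a b. a \<in> Poly_Mapping.keys f \<and> b \<in> Poly_Mapping.keys g}"
      using keys_mult that(1) by (rule subsetD)
    then obtain a b where "w = a + b" "a \<in> Poly_Mapping.keys f" "b \<in> Poly_Mapping.keys g"
      by blast
    then show ?thesis using that by (auto simp: plus_word_def)
  qed
  show ?thesis
    apply (rule ringI)
    subgoal
      apply (rule abelian_groupI)
           apply (simp_all add: free_algebra_def add ac_simps)
      subgoal for f by (rule exI[of _ "- f"]) (simp add: keys_uminus)
      done
    subgoal
      apply (rule monoidI)
           apply (simp_all add: free_algebra_def mult ac_simps)
      apply (simp add: zero_word_def)
      done
    by (simp_all add: free_algebra_def algebra_simps)
qed


lemma iso_coset:
  assumes "h \<in> ring_iso R S" "ring R" "I \<subseteq> carrier R" "x \<in> carrier R"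
  shows "h ` (I +>\<^bsub>R\<^esub> x) = (h ` I) +>\<^bsub>S\<^esub> h x"
  using assms unfolding a_r_coset_def' ring_iso_def by (force simp: ring_hom_add image_iff dest: ring_hom_add)


lemma ring_iso_Quot:
  assumes h: "h \<in> ring_iso R S" and S: "ring S" and I: "ideal I R" and J: "ideal (h ` I) S"
  shows "(`) h \<in> ring_iso (R Quot I) (S Quot (h ` I))"
proof -
  interpret I: ideal I R by fact
  interpret J: ideal "h ` I" S by fact
  have bij: "bij_betw h (carrier R) (carrier S)" and hom: "h \<in> ring_hom R S"
    using h by (auto simp: ring_iso_def)
  have sub: "I \<subseteq> carrier R" by (simp add: I.a_subset)
  have cos: "h ` (I +>\<^bsub>R\<^esub> x) = (h ` I) +>\<^bsub>S\<^esub> h x" if "x \<in> carrier R" for x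
    using iso_coset[OF h I.ring_axioms sub that] .
  have hc: "h x \<in> carrier S" if "x \<in> carrier R" for x using ring_hom_closed[OF hom that] .
  have carr: "A_RCOSETS R I = (\<lambda>x. I +>\<^bsub>R\<^esub> x) ` carrier R" "A_RCOSETS S (h`I) = (\<lambda>x. h`I +>\<^bsub>S\<^esub> x) ` carrier S"
    by (auto simp: A_RCOSETS_def')
  have cimg: "A_RCOSETS S (h`I) = (`) h ` A_RCOSETS R I"
    unfolding carr image_image bij_betw_imp_surj_on[OF bij, symmetric] using cos by (auto simp: image_iff)
  have inj: "inj_on ((`) h) (A_RCOSETS R I)"
  proof (rule inj_onI)
    fix A B assume "A \<in> A_RCOSETS R I" "B \<in> A_RCOSETS R I" "h ` A = h ` B"
    moreover from this have "A \<subseteq> carrier R" "B \<subseteq> carrier R"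
      unfolding carr using I.a_r_coset_subset_G[OF sub] by auto
    ultimately show "A = B" using inj_on_image_eq_iff[OF bij_betw_imp_inj_on[OF bij]] by blast
  qed
  have m1: "h \<one>\<^bsub>R\<^esub> = \<one>\<^bsub>S\<^esub>" using ring_hom_one[OF hom] .
  have "(`) h \<in> ring_hom (R Quot I) (S Quot (h ` I))"
  proof (rule ring_hom_memI)
    fix A assume "A \<in> carrier (R Quot I)"
    then show "h ` A \<in> carrier (S Quot h ` I)" using cimg by (auto simp: FactRing_def)
  next
    fix A B assume "A \<in> carrier (R Quot I)" "B \<in> carrier (R Quot I)"
    then obtain a b where ab: "a \<in> carrier R" "b \<in> carrier R" "A = I +>\<^bsub>R\<^esub> a" "B = I +>\<^bsub>R\<^esub> b"
      by (auto simp: FactRing_def carr)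
    show "h ` (A \<otimes>\<^bsub>R Quot I\<^esub> B) = h ` A \<otimes>\<^bsub>S Quot h ` I\<^esub> h ` B"
      using ab by (simp add: FactRing_def I.rcoset_mult_add J.rcoset_mult_add cos hc ring_hom_mult[OF hom])
    show "h ` (A \<oplus>\<^bsub>R Quot I\<^esub> B) = h ` A \<oplus>\<^bsub>S Quot h ` I\<^esub> h ` B"
      using ab by (simp add: FactRing_def I.a_rcos_sum J.a_rcos_sum cos hc ring_hom_add[OF hom])
  next
    show "h ` \<one>\<^bsub>R Quot I\<^esub> = \<one>\<^bsub>S Quot h ` I\<^esub>" by (simp add: FactRing_def cos m1)
  qed
  then show ?thesis using inj cimg by (auto simp: ring_iso_def bij_betw_def FactRing_def)
qed

lemma relabel_single [simp]: "relabel g (Poly_Mapping.single w c) = Poly_Mapping.single (map_word g w) c"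
  by (cases "c = 0") (simp_all add: relabel_def)

lemma relabel_superset:
  assumes "finite A" "Poly_Mapping.keys f \<subseteq> A"
  shows "relabel g f = (\<Sum>w\<in>A. Poly_Mapping.single (map_word g w) (Poly_Mapping.lookup f w))"
  unfolding relabel_def using assms
  by (intro sum.mono_neutral_left) (auto simp: in_keys_iff)

lemma relabel_0 [simp]: "relabel g 0 = 0" by (simp add: relabel_def)

lemma relabel_add: "relabel g (f + h) = relabel g f + relabel g h"
proof -
  let ?A = "Poly_Mapping.keys f \<union> Poly_Mapping.keys h"
  have "Poly_Mapping.keys (f + h) \<subseteq> ?A" by (rule keys_add)
  then show ?thesis
    by (simp add: relabel_superset[of ?A] lookup_add single_add sum.distrib)
qed

lemma relabel_uminus: "relabel g (- f) = - relabel g f"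
  using relabel_add[of g "- f" f] by (simp add: eq_neg_iff_add_eq_0)

lemma relabel_diff: "relabel g (f - h) = relabel g f - relabel g h"
  using relabel_add[of g f "- h"] by (simp add: relabel_uminus)

lemma sum_keys_single:
  "(\<Sum>w\<in>Poly_Mapping.keys f. Poly_Mapping.single w (Poly_Mapping.lookup f w)) = f"
  by (rule poly_mapping_eqI)
    (auto simp: lookup_sum lookup_single when_def in_keys_iff sum.delta)

lemma relabel_sum: "relabel g (sum F A) = (\<Sum>x\<in>A. relabel g (F x))"
  by (induction A rule: infinite_finite_induct) (simp_all add: relabel_add)

lemma map_word_plus: "map_word g (v + w) = map_word g v + map_word g w"
  by (cases v; cases w) (simp add: plus_word_def)

lemma relabel_mult: "relabel g (f * h) = relabel g f * relabel g h"
proof -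
  have "relabel g (f * h) = relabel g ((\<Sum>v\<in>Poly_Mapping.keys f. Poly_Mapping.single v (Poly_Mapping.lookup f v)) *
      (\<Sum>w\<in>Poly_Mapping.keys h. Poly_Mapping.single w (Poly_Mapping.lookup h w)))"
    by (simp add: sum_keys_single)
  also have "\<dots> = relabel g f * relabel g h"
    by (simp add: sum_product relabel_sum mult_single map_word_plus relabel_def[of g f] relabel_def[of g h])
  finally show ?thesis .
qed

lemma relabel_scalar: "relabel g (scalar c) = scalar c"
  by (simp add: scalar_def zero_word_def)

lemma relabel_1 [simp]: "relabel g 1 = 1"
  using relabel_scalar[of g 1] by (simp add: scalar_def)

lemma relabel_power: "relabel g (f ^ n) = relabel g f ^ n"
  by (induction n) (simp_all add: relabel_mult)

lemma relabel_relabel: "relabel g (relabel g' f) = relabel (g \<circ> g') f"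
  by (subst (2) relabel_def) (simp add: relabel_sum relabel_def[of "g \<circ> g'"] word.map_comp)

lemma relabel_id: "relabel id f = f"
  by (simp add: relabel_def word.map_id sum_keys_single)

lemma keys_relabel: "Poly_Mapping.keys (relabel g f) \<subseteq> map_word g ` Poly_Mapping.keys f"
  unfolding relabel_def by (rule order_trans[OF keys_sum]) (auto split: if_splits)

lemma relabel_closed:
  assumes "g ` X \<subseteq> Y" "f \<in> carrier (free_algebra X)"
  shows "relabel g f \<in> carrier (free_algebra Y)"
proof -
  have "set (letters (map_word g w)) \<subseteq> Y" if "w \<in> Poly_Mapping.keys f" for w
    using assms that by (cases w) (fastforce simp: free_algebra_def)
  then show ?thesis using keys_relabel[of g f] by (fastforce simp: free_algebra_def)
qed

lemma relabel_ring_iso: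
  assumes "g ` X \<subseteq> X" "g \<circ> g = id"
  shows "relabel g \<in> ring_iso (free_algebra X) (free_algebra X)"
proof -
  have inv: "relabel g (relabel g f) = f" for f
    by (simp add: relabel_relabel assms relabel_id)
  have "bij_betw (relabel g) (carrier (free_algebra X)) (carrier (free_algebra X))"
    using inv relabel_closed[OF assms(1)] by (intro bij_betwI[of _ _ _ "relabel g"]) auto
  moreover have "relabel g \<in> ring_hom (free_algebra X) (free_algebra X)"
    by (rule ring_hom_memI) (auto simp: relabel_closed[OF assms(1)], auto simp: free_algebra_def relabel_add relabel_mult)
  ultimately show ?thesis by (simp add: ring_iso_def)
qed


lemma ring_iso_ideal:
  assumes h: "h \<in> ring_iso R S" and R: "ring R" and S: "ring S" and I: "ideal I R"
  shows "ideal (h ` I) S"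
proof -
  interpret I: ideal I R by fact
  interpret S: ring S by fact
  have hom: "h \<in> ring_hom R S" and surj: "h ` carrier R = carrier S"
    using h by (auto simp: ring_iso_def bij_betw_def)
  interpret H: ring_hom_ring R S h using hom by (intro ring_hom_ringI2 R S)
  show ?thesis
  proof (rule idealI[OF S])
    show "subgroup (h ` I) (add_monoid S)"
      by (rule H.img_is_add_subgroup) (simp add: I.a_subgroup)
  next
    fix a x assume "a \<in> h ` I" "x \<in> carrier S"
    then obtain b y where "b \<in> I" "a = h b" "y \<in> carrier R" "x = h y"
      unfolding surj[symmetric] by blast
    then show "x \<otimes>\<^bsub>S\<^esub> a \<in> h ` I" "a \<otimes>\<^bsub>S\<^esub> x \<in> h ` I"
      using I.I_l_closed I.I_r_closed I.Icarr by (auto simp flip: H.hom_mult)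
  qed
qed

lemma ring_iso_genideal:
  assumes h: "h \<in> ring_iso R S" and R: "ring R" and S: "ring S" and X: "X \<subseteq> carrier R"
  shows "h ` (Idl\<^bsub>R\<^esub> X) = Idl\<^bsub>S\<^esub> (h ` X)"
proof
  interpret R: ring R by fact
  interpret S: ring S by fact
  let ?g = "inv_into (carrier R) h"
  have g: "?g \<in> ring_iso S R" 
  proof -
    have hom: "h \<in> ring_hom R S" and bij: "bij_betw h (carrier R) (carrier S)"
      using h by (auto simp: ring_iso_def)
    have hg: "h (?g y) = y" "?g y \<in> carrier R" if "y \<in> carrier S" for y
      using bij that by (auto simp: bij_betw_inv_into_right bij_betw_def inv_into_into)
    have gh: "?g (h x) = x" if "x \<in> carrier R" for x
      using bij that by (simp add: bij_betw_def)
    have "?g \<in> ring_hom S R"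
    proof (rule ring_hom_memI)
      fix x y assume "x \<in> carrier S" "y \<in> carrier S"
      then show "?g (x \<otimes>\<^bsub>S\<^esub> y) = ?g x \<otimes>\<^bsub>R\<^esub> ?g y" "?g (x \<oplus>\<^bsub>S\<^esub> y) = ?g x \<oplus>\<^bsub>R\<^esub> ?g y"
        using gh[of "?g x \<otimes>\<^bsub>R\<^esub> ?g y"] gh[of "?g x \<oplus>\<^bsub>R\<^esub> ?g y"]
        by (simp_all add: hg ring_hom_mult[OF hom] ring_hom_add[OF hom])
    next
      show "?g \<one>\<^bsub>S\<^esub> = \<one>\<^bsub>R\<^esub>"
        using gh[of "\<one>\<^bsub>R\<^esub>"] by (simp add: ring_hom_one[OF hom])
    qed (simp add: hg)
    then show ?thesis using bij_betw_inv_into[OF bij] by (simp add: ring_iso_def)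
  qed
  have bij: "bij_betw h (carrier R) (carrier S)" using h by (simp add: ring_iso_def)
  have hX: "h ` X \<subseteq> carrier S" using X bij by (auto simp: bij_betw_def)
  have gh: "?g (h x) = x" if "x \<in> carrier R" for x
    using bij that by (simp add: bij_betw_def)
  show "Idl\<^bsub>S\<^esub> (h ` X) \<subseteq> h ` (Idl\<^bsub>R\<^esub> X)"
    by (rule S.genideal_minimal) (use ring_iso_ideal[OF h R S R.genideal_ideal[OF X]] R.genideal_self[OF X] in auto)
  have "Idl\<^bsub>R\<^esub> X \<subseteq> ?g ` (Idl\<^bsub>S\<^esub> (h ` X))"
  proof (rule R.genideal_minimal)
    show "ideal (?g ` (Idl\<^bsub>S\<^esub> (h ` X))) R" by (rule ring_iso_ideal[OF g S R S.genideal_ideal[OF hX]])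
    show "X \<subseteq> ?g ` (Idl\<^bsub>S\<^esub> (h ` X))"
    proof
      fix x assume "x \<in> X"
      then show "x \<in> ?g ` (Idl\<^bsub>S\<^esub> (h ` X))"
        using gh[of x] X S.genideal_self[OF hX] by (intro image_eqI[of _ _ "h x"]) auto
    qed
  qed
  then have "h ` (Idl\<^bsub>R\<^esub> X) \<subseteq> h ` ?g ` (Idl\<^bsub>S\<^esub> (h ` X))" by (rule image_mono)
  also have "\<dots> = Idl\<^bsub>S\<^esub> (h ` X)"
  proof -
    have "Idl\<^bsub>S\<^esub> (h ` X) \<subseteq> h ` carrier R"
      using ideal.axioms(1)[OF S.genideal_ideal[OF hX]] bij
      by (metis additive_subgroup.a_subset bij_betw_def)
    then show ?thesis by (rule image_inv_into_cancel[OF refl])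
  qed
  finally show "h ` (Idl\<^bsub>R\<^esub> X) \<subseteq> Idl\<^bsub>S\<^esub> (h ` X)" .
qed

lemma ring_iso_Quot_gen:
  assumes h: "h \<in> ring_iso R S" and R: "ring R" and S: "ring S" and X: "X \<subseteq> carrier R"
  shows "(`) h \<in> ring_iso (R Quot (Idl\<^bsub>R\<^esub> X)) (S Quot (Idl\<^bsub>S\<^esub> (h ` X)))"
  using ring_iso_Quot[OF h S ring.genideal_ideal[OF R X]]
    ring_iso_ideal[OF h R S ring.genideal_ideal[OF R X]] ring_iso_genideal[OF assms] by simp

lemma tgen_closed: "{i, j} \<subseteq> {1..N} \<Longrightarrow> tgen i j r \<in> carrier (free_algebra (gens N))"
  by (auto simp: tgen_def free_algebra_def gens_def zero_word_def split: if_splits)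

lemma free_algebra_one_closed: "1 \<in> carrier (free_algebra X)"
  by (simp add: free_algebra_def zero_word_def)

lemma free_algebra_uminus_closed:
  "x \<in> carrier (free_algebra X) \<Longrightarrow> - x \<in> carrier (free_algebra X)"
  by (simp add: free_algebra_def Poly_Mapping.keys.rep_eq)

lemma free_algebra_mult_closed:
  assumes "x \<in> carrier (free_algebra X)" "y \<in> carrier (free_algebra X)"
  shows "x * y \<in> carrier (free_algebra X)"
proof -
  interpret ring "free_algebra X" by (rule free_algebra_ring)
  show ?thesis using m_closed[OF assms] by (simp add: free_algebra_def)
qed

lemma free_algebra_diff_closed:
  assumes "x \<in> carrier (free_algebra X)" "y \<in> carrier (free_algebra X)"
  shows "x - y \<in> carrier (free_algebra X)"
proof -
  interpret ring "free_algebra X" by (rule free_algebra_ring)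
  show ?thesis
    using add.m_closed[OF assms(1) free_algebra_uminus_closed[OF assms(2)]]
    by (simp add: free_algebra_def)
qed

lemma free_algebra_power_closed:
  "x \<in> carrier (free_algebra X) \<Longrightarrow> x ^ n \<in> carrier (free_algebra X)"
  by (induction n) (simp_all add: free_algebra_one_closed free_algebra_mult_closed)

lemmas free_algebra_closed = free_algebra_one_closed free_algebra_uminus_closed
  free_algebra_mult_closed free_algebra_diff_closed free_algebra_power_closed

lemma scomm_closed: "{i, j, k, l} \<subseteq> {1..N} \<Longrightarrow> scomm s (i, j, r) (k, l, q) \<in> carrier (free_algebra (gens N))"
  by (auto simp: scomm_def intro!: free_algebra_closed tgen_closed)

lemma yangian_rels_closed: "yangian_rels N s \<subseteq> carrier (free_algebra (gens N))"
  unfolding yangian_rels_def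
  by clarify (intro free_algebra_closed scomm_closed tgen_closed; simp)

lemma yangian_ideal: "ideal (yangian_ideal N s) (free_algebra (gens N))"
  unfolding yangian_ideal_def by (rule ring.genideal_ideal[OF free_algebra_ring yangian_rels_closed])

lemma yangian_ring: "ring (yangian N s)"
  unfolding yangian_def by (rule ideal.quotient_is_ring[OF yangian_ideal])

lemma yangian_class_closed: "x \<in> carrier (free_algebra (gens N)) \<Longrightarrow> yangian_class N s x \<in> carrier (yangian N s)"
  by (auto simp: yangian_class_def yangian_def FactRing_def A_RCOSETS_def')

lemma level_ideal: "ideal (level_ideal N s p) (yangian N s)"
  unfolding level_ideal_def by (rule ring.genideal_ideal[OF yangian_ring]) (auto intro!: yangian_class_closed tgen_closed)

lemma yangian_level_ring: "ring (yangian_level N s p)"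
  unfolding yangian_level_def by (rule ideal.quotient_is_ring[OF level_ideal])

context
  fixes N :: nat and \<sigma> :: "nat \<Rightarrow> nat"
  assumes \<sigma>: "\<sigma> \<circ> \<sigma> = id" "\<sigma> ` {1..N} \<subseteq> {1..N}"
begin

lemma invol: "\<sigma> (\<sigma> a) = a" using \<sigma> by (metis comp_apply id_apply)

lemma relabel_tgen: "relabel (relabel_gen \<sigma>) (tgen i j r) = tgen (\<sigma> i) (\<sigma> j) r"
  using invol by (auto simp: tgen_def) (metis invol)

lemma relabel_scomm: "relabel (relabel_gen \<sigma>) (scomm (s \<circ> \<sigma>) (i, j, r) (k, l, q)) = scomm s (\<sigma> i, \<sigma> j, r) (\<sigma> k, \<sigma> l, q)"
  by (simp add: scomm_def relabel_diff relabel_mult relabel_power relabel_uminus relabel_tgen)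

lemma relabel_rels: "relabel (relabel_gen \<sigma>) ` yangian_rels N (s \<circ> \<sigma>) = yangian_rels N s" (is "?A = ?B")
proof -
  have 1: "relabel (relabel_gen \<sigma>) ` yangian_rels N (s \<circ> \<sigma>) \<subseteq> yangian_rels N s" for s
  proof
    fix x assume "x \<in> relabel (relabel_gen \<sigma>) ` yangian_rels N (s \<circ> \<sigma>)"
    then obtain i j k l r q where *: "{i, j, k, l} \<subseteq> {1..N}"
      "x = scomm s (\<sigma> i, \<sigma> j, r + 1) (\<sigma> k, \<sigma> l, q) - scomm s (\<sigma> i, \<sigma> j, r) (\<sigma> k, \<sigma> l, q + 1)
       - (-1) ^ (s (\<sigma> i) * s (\<sigma> j) + s (\<sigma> i) * s (\<sigma> k) + s (\<sigma> j) * s (\<sigma> k)) * (tgen (\<sigma> k) (\<sigma> j) r * tgen (\<sigma> i) (\<sigma> l) q - tgen (\<sigma> k) (\<sigma> j) q * tgen (\<sigma> i) (\<sigma> l) r)"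
      unfolding yangian_rels_def image_iff
      by (auto simp: relabel_scomm relabel_diff relabel_mult relabel_power relabel_uminus relabel_tgen)
    moreover have "{\<sigma> i, \<sigma> j, \<sigma> k, \<sigma> l} \<subseteq> {1..N}" using * \<sigma>(2) by blast
    ultimately show "x \<in> yangian_rels N s" unfolding yangian_rels_def by blast
  qed
  have "s \<circ> \<sigma> \<circ> \<sigma> = s" by (simp add: comp_assoc \<sigma>)
  then have "relabel (relabel_gen \<sigma>) ` yangian_rels N s \<subseteq> yangian_rels N (s \<circ> \<sigma>)" using 1[of "s \<circ> \<sigma>"] by simp
  then have "relabel (relabel_gen \<sigma>) ` relabel (relabel_gen \<sigma>) ` yangian_rels N s \<subseteq> relabel (relabel_gen \<sigma>) ` yangian_rels N (s \<circ> \<sigma>)" by (rule image_mono)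
  moreover have "relabel (relabel_gen \<sigma>) (relabel (relabel_gen \<sigma>) x) = x" for x
  proof -
    have "relabel_gen \<sigma> \<circ> relabel_gen \<sigma> = id" by (auto simp: invol)
    then show ?thesis by (simp add: relabel_relabel relabel_id)
  qed
  ultimately have "yangian_rels N s \<subseteq> relabel (relabel_gen \<sigma>) ` yangian_rels N (s \<circ> \<sigma>)" by (simp add: image_image)
  then show ?thesis using 1 by blast
qed

lemma iso0: "relabel (relabel_gen \<sigma>) \<in> ring_iso (free_algebra (gens N)) (free_algebra (gens N))"
  by (rule relabel_ring_iso) (use \<sigma> invol in \<open>auto simp: gens_def fun_eq_iff\<close>)

lemma iso1: "(`) (relabel (relabel_gen \<sigma>)) \<in> ring_iso (yangian N (s \<circ> \<sigma>)) (yangian N s)"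
  using ring_iso_Quot_gen[OF iso0 free_algebra_ring free_algebra_ring yangian_rels_closed[of N "s \<circ> \<sigma>"]]
  by (simp add: relabel_rels yangian_def yangian_ideal_def)

lemma relabel_yangian_class:
  assumes "x \<in> carrier (free_algebra (gens N))"
  shows "relabel (relabel_gen \<sigma>) ` yangian_class N (s \<circ> \<sigma>) x = yangian_class N s (relabel (relabel_gen \<sigma>) x)"
  unfolding yangian_class_def
  using iso_coset[OF iso0 free_algebra_ring _ assms, of "yangian_ideal N (s \<circ> \<sigma>)"]
    ring_iso_genideal[OF iso0 free_algebra_ring free_algebra_ring yangian_rels_closed[of N "s \<circ> \<sigma>"]]
    additive_subgroup.a_subset[OF ideal.axioms(1)[OF yangian_ideal]]
  by (simp add: yangian_ideal_def relabel_rels)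

lemma relabel_level_gens:
  "(`) (relabel (relabel_gen \<sigma>)) ` {yangian_class N (s \<circ> \<sigma>) (tgen i j r) | i j r. {i, j} \<subseteq> {1..N} \<and> r > p}
    = {yangian_class N s (tgen i j r) | i j r. {i, j} \<subseteq> {1..N} \<and> r > p}" (is "_ ` ?A = ?B")
proof
  show "(`) (relabel (relabel_gen \<sigma>)) ` ?A \<subseteq> ?B"
  proof clarify
    fix i j r assume "{i, j} \<subseteq> {1..N}" "p < r"
    moreover from this have "{\<sigma> i, \<sigma> j} \<subseteq> {1..N}" using \<sigma>(2) by blast
    ultimately show "\<exists>i' j' r'. relabel (relabel_gen \<sigma>) ` yangian_class N (s \<circ> \<sigma>) (tgen i j r) = yangian_class N s (tgen i' j' r') \<and> {i', j'} \<subseteq> {1..N} \<and> p < r'"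
      using relabel_yangian_class[OF tgen_closed] relabel_tgen by metis
  qed
  show "?B \<subseteq> (`) (relabel (relabel_gen \<sigma>)) ` ?A"
  proof clarify
    fix i j r assume ij: "{i, j} \<subseteq> {1..N}" "p < r"
    moreover from this have "{\<sigma> i, \<sigma> j} \<subseteq> {1..N}" using \<sigma>(2) by blast
    ultimately show "yangian_class N s (tgen i j r) \<in> (`) (relabel (relabel_gen \<sigma>)) ` ?A"
      by (intro image_eqI[of _ _ "yangian_class N (s \<circ> \<sigma>) (tgen (\<sigma> i) (\<sigma> j) r)"])
         (subst relabel_yangian_class[OF tgen_closed], simp, simp add: relabel_tgen invol, blast)
  qed
qed

lemma level_gens_closed: "{yangian_class N s' (tgen i j r) | i j r. {i, j} \<subseteq> {1..N} \<and> r > p} \<subseteq> carrier (yangian N s')"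
  by (auto intro!: yangian_class_closed tgen_closed)

lemma relabel_level_iso:
  "relabel_level \<sigma> \<in> ring_iso (yangian_level N (s \<circ> \<sigma>) p) (yangian_level N s p)"
  using ring_iso_Quot_gen[OF iso1 yangian_ring yangian_ring level_gens_closed[of "s \<circ> \<sigma>" p]]
  unfolding relabel_level_gens by (simp add: relabel_level_def yangian_level_def level_ideal_def)

lemma relabel_level_class:
  assumes "x \<in> carrier (free_algebra (gens N))"
  shows "relabel_level \<sigma> (level_class N (s \<circ> \<sigma>) p x) = level_class N s p (relabel (relabel_gen \<sigma>) x)"
proof -
  let ?h = "(`) (relabel (relabel_gen \<sigma>))"
  have "?h ` level_ideal N (s \<circ> \<sigma>) p = level_ideal N s p"
    using ring_iso_genideal[OF iso1 yangian_ring yangian_ring level_gens_closed[of "s \<circ> \<sigma>" p]]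
    by (simp only: relabel_level_gens level_ideal_def)
  moreover have "level_ideal N (s \<circ> \<sigma>) p \<subseteq> carrier (yangian N (s \<circ> \<sigma>))"
    by (rule additive_subgroup.a_subset[OF ideal.axioms(1)[OF level_ideal]])
  ultimately show ?thesis
    using iso_coset[OF iso1 yangian_ring _ yangian_class_closed[OF assms], of "level_ideal N (s \<circ> \<sigma>) p"]
    by (simp add: level_class_def relabel_level_def relabel_yangian_class[OF assms])
qed

lemma relabel_level_T_coeff:
  assumes "{a, b} \<subseteq> {1..N}"
  shows "relabel_level \<sigma> (T_coeff N (s \<circ> \<sigma>) p a b d) = T_coeff N s p (\<sigma> a) (\<sigma> b) d"
proof (cases "d \<le> p")
  case True
  then show ?thesis by (simp add: T_coeff_def relabel_level_class[OF tgen_closed[OF assms]] relabel_tgen)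
next
  case False
  have "relabel_level \<sigma> \<in> ring_hom (yangian_level N (s \<circ> \<sigma>) p) (yangian_level N s p)"
    using relabel_level_iso by (simp add: ring_iso_def)
  with False show ?thesis
    by (simp add: T_coeff_def ring_hom_zero[OF _ yangian_level_ring yangian_level_ring])
qed

end

end

theory Submission
  imports Defs
begin

text \<open>
  Let \<open>A(u)\<close>, \<open>B(u)\<close>, \<open>C(u)\<close>, \<open>D(u)\<close> be the values at a complex number \<open>u\<close> of \<open>T\<^sub>i\<^sub>i\<close>, \<open>T\<^sub>i\<^sub>+\<^sub>1\<^sub>,\<^sub>i\<close>,
  \<open>T\<^sub>i\<^sub>,\<^sub>i\<^sub>+\<^sub>1\<close>, \<open>T\<^sub>i\<^sub>+\<^sub>1\<^sub>,\<^sub>i\<^sub>+\<^sub>1\<close>, acting on \<open>L(\<lambda>(u))\<close> with highest vector \<open>\<xi>\<close>.  Put \<open>e = 1\<close> if the parities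
  at \<open>i, i + 1\<close> are \<open>01\<close> and \<open>e = - 1\<close> if they are \<open>10\<close>.  Write \<open>\<lambda>\<^sub>i = f h\<close> and \<open>\<lambda>\<^sub>i\<^sub>+\<^sub>1 = g h\<close>, where the
  roots of \<open>f\<close> and \<open>g\<close> are those numbered up to \<open>k\<close>; then \<open>f\<close> and \<open>g\<close> are coprime.  A highest vector
  for the reflected sequence is a nonzero vector \<open>\<eta>\<close> that is annihilated by \<open>B(u)\<close> and by all \<open>T\<^sub>a\<^sub>b(u)\<close>
  with \<open>a < b\<close> except \<open>C(u)\<close>, and on which \<open>A(u)\<close>, \<open>D(u)\<close> act by \<open>f(u - e) h(u)\<close>, \<open>g(u - e) h(u)\<close>.

  Suppose first that \<open>h = 1\<close>.  If \<open>A(v)\<close> annihilates an eigenvector \<open>x\<close> of all \<open>A(u)\<close>, then \<open>B(v) x\<close> is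
  again an eigenvector, and the factor \<open>u - v\<close> of the eigenvalue is replaced by \<open>u - v - e\<close>.  So \<open>\<eta>\<close> is
  obtained from \<open>\<xi>\<close> by applying \<open>B(v)\<close> for all roots \<open>v\<close> of \<open>f\<close>.  The operator
  \<open>Q(u) = D(u) A(u + e) - B(u) C(u + e) = C(u + e) B(u) + D(u + e) A(u)\<close>, a multiple of \<open>A(u) A(u + e)\<close>
  by a central series, is carried along (\<open>qdet_lowering\<close>).  Since \<open>C(v + e) B(v) x = Q(v) x\<close>, its eigenvalue
  shows that no step gives zero, provided that the roots are used in the order of decreasing
  \<open>Re (v / e)\<close>; here the coprimality of \<open>f\<close> and \<open>g\<close> enters.  In the same order \<open>B(u) x\<close> acquires a zero at
  each step (\<open>chain_step\<close>).  After \<open>k\<close> steps it has more zeros than its degree permits, so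
  \<open>B(u) \<eta> = 0\<close>, and then \<open>Q(u) \<eta> = D(u + e) A(u) \<eta>\<close> yields the eigenvalue of \<open>D(u)\<close>
  (\<open>gl11_lowest_vector\<close>).

  A common factor \<open>h\<close> is removed as follows.  The remainder of \<open>B(u) \<xi>\<close> modulo \<open>h(u)\<close> is annihilated by
  all raising operators and has a weight below that of \<open>\<xi>\<close>, so it vanishes because \<open>L(\<lambda>(u))\<close> is
  irreducible.  Divisibility by \<open>h(u)\<close> spreads from \<open>B(u) \<xi>\<close> to all four operators on the span of the
  lowered vectors, and the quotients satisfy the same relations
  (\<open>gl11_lowest_vector_common_factor\<close>, \<open>reflected_vector_exists\<close>).

  It remains to recognize \<open>L(\<lambda>(u))\<close>, with the re-labelled action, as the irreducible quotient of the
  Verma module of \<open>\<eta>\<close>.  All modules in question are cyclic, hence quotients of the free algebra by left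
  ideals.  The weight of the highest vector has multiplicity one in a Verma module, so there is a unique
  maximal submodule (\<open>L_kernel_proper\<close>), and the re-labelled annihilator of \<open>\<eta>\<close> must be the
  corresponding left ideal (\<open>reflection_isomorphism\<close>).  Finally, the Verma module of \<open>\<lambda>(u)\<close> might be
  zero.  The reflection of the reflected data leads back to the original ones, so in this case a
  nonzero \<open>L(\<lambda>\<^sup>\<plusminus>(u))\<close> would produce a nonzero \<open>L(\<lambda>(u))\<close>; thus both modules are zero
  (\<open>odd_reflection\<close>).
\<close>

section \<open>Vector-valued polynomial functions\<close>

text \<open>
  Monic polynomials are given by the lists of their roots: a list records multiplicities, and its order
  is the order in which the roots are used in the chain of lowerings below.
\<close>

definition root_poly :: "complex list \<Rightarrow> complex \<Rightarrow> complex"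
  where "root_poly vs u = (\<Prod>v\<leftarrow>vs. u - v)"

lemma root_poly_Nil [simp]: "root_poly [] u = 1"
  by (simp add: root_poly_def)

lemma root_poly_Cons [simp]: "root_poly (v # vs) u = (u - v) * root_poly vs u"
  by (simp add: root_poly_def)

lemma root_poly_eq_0_iff: "root_poly vs u = 0 \<longleftrightarrow> u \<in> set vs"
  by (induction vs) auto

lemma root_poly_mset: "mset vs = mset ws \<Longrightarrow> root_poly vs u = root_poly ws u"
  unfolding root_poly_def by (metis mset_map prod_mset_prod_list)

lemma root_poly_shift: "root_poly (map (\<lambda>v. v + e) vs) u = root_poly vs (u - e)"
  by (induction vs) (auto simp: algebra_simps)

lemma infinite_Compl_finite: "finite S \<Longrightarrow> infinite (- S :: complex set)"
  by (simp add: infinite_UNIV_char_0)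

locale complex_vector_space = vector_space scale
  for scale :: "complex \<Rightarrow> 'v::ab_group_add \<Rightarrow> 'v" (infixr \<open>*s\<close> 75)
begin

abbreviation lin :: "('v \<Rightarrow> 'v) \<Rightarrow> bool"
  where "lin \<equiv> Vector_Spaces.linear scale scale"

lemma linI: "(\<And>x y. f (x + y) = f x + f y) \<Longrightarrow> (\<And>c x. f (c *s x) = c *s f x) \<Longrightarrow> lin f"
  by (simp add: Vector_Spaces.linear_iff vector_space_axioms)

lemma lin_add: "lin f \<Longrightarrow> f (x + y) = f x + f y"
  and lin_scale: "lin f \<Longrightarrow> f (c *s x) = c *s f x"
  by (simp_all add: Vector_Spaces.linear_iff)

lemma lin_0: "lin f \<Longrightarrow> f 0 = 0"
  using lin_scale[of f 0 0] by simp

lemma lin_minus: "lin f \<Longrightarrow> f (- x) = - f x"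
  using lin_scale[of f "-1" x] by simp

lemma lin_diff: "lin f \<Longrightarrow> f (x - y) = f x - f y"
  using lin_add[of f x "- y"] lin_minus[of f y] by simp

lemma lin_sum: "lin f \<Longrightarrow> f (\<Sum>i\<in>I. g i) = (\<Sum>i\<in>I. f (g i))"
  by (induction I rule: infinite_finite_induct) (simp_all add: lin_0 lin_add)

text \<open>
  Such projections turn operators that make sense only on a subspace, or only modulo a subspace, into
  linear operators on the whole type.
\<close>

lemma linear_projection_exists:
  assumes "subspace U"
  shows "\<exists>g. lin g \<and> (\<forall>x. g x \<in> U) \<and> (\<forall>x\<in>U. g x = x)"
proof -
  interpret vector_space_pair scale scale by unfold_locales
  have "\<exists>g. g ` UNIV \<subseteq> U \<and> Vector_Spaces.linear scale scale g \<and> (\<forall>v\<in>U. g (id v) = v)"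
    by (rule linear_exists_left_inverse_on) (use assms in \<open>auto simp: linI\<close>)
  then show ?thesis by auto
qed


text \<open>
  The function \<open>P\<close> is polynomial of degree less than \<open>n\<close>, with vectors as coefficients.  The recursion is
  Horner's scheme, which suits the divided differences below better than a list of coefficients.
\<close>

fun vpoly :: "nat \<Rightarrow> (complex \<Rightarrow> 'v) \<Rightarrow> bool" where
  "vpoly 0 P \<longleftrightarrow> (\<forall>u. P u = 0)"
| "vpoly (Suc n) P \<longleftrightarrow> (\<exists>c Q. vpoly n Q \<and> (\<forall>u. P u = c + u *s Q u))"

definition polyfun :: "(complex \<Rightarrow> 'v) \<Rightarrow> bool"
  where "polyfun P \<longleftrightarrow> (\<exists>n. vpoly n P)"

lemma vpoly_Suc: "vpoly n P \<Longrightarrow> vpoly (Suc n) P"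
proof (induction n arbitrary: P)
  case 0
  then show ?case by (auto intro!: exI[of _ 0] exI[of _ "\<lambda>u. 0"])
next
  case (Suc n)
  then obtain c Q where "vpoly n Q" "\<forall>u. P u = c + u *s Q u" by auto
  with Suc.IH[of Q] show ?case by (subst vpoly.simps) blast
qed

lemma vpoly_mono: "vpoly n P \<Longrightarrow> n \<le> m \<Longrightarrow> vpoly m P"
  by (induction m) (use vpoly_Suc le_Suc_eq in auto)

lemma vpoly_add: "vpoly n P \<Longrightarrow> vpoly n Q \<Longrightarrow> vpoly n (\<lambda>u. P u + Q u)"
proof (induction n arbitrary: P Q)
  case 0
  then show ?case by simp
next
  case (Suc n)
  then obtain c P' d Q' where *: "vpoly n P'" "\<forall>u. P u = c + u *s P' u" "vpoly n Q'" "\<forall>u. Q u = d + u *s Q' u"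
    by auto
  then have "\<forall>u. P u + Q u = (c + d) + u *s (P' u + Q' u)"
    by (simp add: algebra_simps)
  with Suc.IH[OF *(1,3)] show ?case by (subst vpoly.simps) blast
qed

lemma vpoly_const: "vpoly (Suc 0) (\<lambda>u. c)"
  by (auto intro!: exI[of _ c] exI[of _ "\<lambda>u. 0"])

lemma vpoly_id_mult: "vpoly n P \<Longrightarrow> vpoly (Suc n) (\<lambda>u. u *s P u)"
  by (auto intro!: exI[of _ 0] exI[of _ P])

lemma vpoly_lin: "vpoly n P \<Longrightarrow> lin f \<Longrightarrow> vpoly n (\<lambda>u. f (P u))"
proof (induction n arbitrary: P)
  case 0
  then show ?case by (simp add: lin_0)
next
  case (Suc n)
  then obtain c Q where *: "vpoly n Q" "\<forall>u. P u = c + u *s Q u" by auto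
  then have "\<forall>u. f (P u) = f c + u *s f (Q u)" using Suc.prems(2) by (simp add: lin_add lin_scale)
  with Suc.IH[OF *(1) Suc.prems(2)] show ?case by (subst vpoly.simps) blast
qed

lemma lin_scaling: "lin (\<lambda>x. c *s x)"
  by (rule linI) (simp_all add: algebra_simps)

lemma vpoly_scale: "vpoly n P \<Longrightarrow> vpoly n (\<lambda>u. c *s P u)"
  by (rule vpoly_lin[OF _ lin_scaling])

lemma vpoly_linear_factor: "vpoly n P \<Longrightarrow> vpoly (Suc n) (\<lambda>u. (u - a) *s P u)"
  using vpoly_add[OF vpoly_id_mult vpoly_Suc[OF vpoly_scale[of n P "- a"]], of P]
  by (simp add: algebra_simps)

lemma vpoly_root_poly: "vpoly n P \<Longrightarrow> vpoly (n + length vs) (\<lambda>u. root_poly vs u *s P u)"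
  by (induction vs) (use vpoly_linear_factor in \<open>fastforce simp flip: scale_scale\<close>)+

lemma vpoly_sum_powers: "vpoly n (\<lambda>u. \<Sum>d<n. u ^ d *s c d)"
proof (induction n arbitrary: c)
  case (Suc n)
  have "\<forall>u. (\<Sum>d<Suc n. u ^ d *s c d) = c 0 + u *s (\<Sum>d<n. u ^ d *s c (Suc d))"
    by (simp only: sum.lessThan_Suc_shift) (simp add: scale_sum_right)
  with Suc[of "\<lambda>d. c (Suc d)"] show ?case by (subst vpoly.simps) blast
qed simp

lemma polyfunI: "vpoly n P \<Longrightarrow> polyfun P"
  by (auto simp: polyfun_def)

lemma polyfun_add: "polyfun P \<Longrightarrow> polyfun Q \<Longrightarrow> polyfun (\<lambda>u. P u + Q u)"
  unfolding polyfun_def by (metis vpoly_add vpoly_mono max.cobounded1 max.cobounded2)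

lemma polyfun_lin: "polyfun P \<Longrightarrow> lin f \<Longrightarrow> polyfun (\<lambda>u. f (P u))"
  unfolding polyfun_def by (elim exE) (rule exI, erule (1) vpoly_lin)

lemma polyfun_scale: "polyfun P \<Longrightarrow> polyfun (\<lambda>u. c *s P u)"
  by (rule polyfun_lin[OF _ lin_scaling])

lemma polyfun_minus: "polyfun P \<Longrightarrow> polyfun (\<lambda>u. - P u)"
  using polyfun_scale[of P "-1"] by simp

lemma polyfun_diff: "polyfun P \<Longrightarrow> polyfun Q \<Longrightarrow> polyfun (\<lambda>u. P u - Q u)"
  unfolding diff_conv_add_uminus by (intro polyfun_add polyfun_minus)

lemma polyfun_const: "polyfun (\<lambda>u. c)"
  using vpoly_const by (rule polyfunI)

lemma polyfun_linear_factor: "polyfun P \<Longrightarrow> polyfun (\<lambda>u. (u - a) *s P u)"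
  unfolding polyfun_def by (elim exE) (rule exI, erule vpoly_linear_factor)

lemma polyfun_root_poly: "polyfun P \<Longrightarrow> polyfun (\<lambda>u. root_poly vs u *s P u)"
  unfolding polyfun_def by (elim exE) (rule exI, erule vpoly_root_poly)

lemma polyfun_compose:
  assumes "polyfun P" and B: "\<And>u. lin (B u)" "\<And>x. polyfun (\<lambda>u. B u x)"
  shows "polyfun (\<lambda>u. B u (P u))"
proof -
  have "vpoly n P \<Longrightarrow> polyfun (\<lambda>u. B u (P u))" for n
  proof (induction n arbitrary: P)
    case 0
    then show ?case by (simp add: lin_0[OF B(1)] polyfun_const)
  next
    case (Suc n)
    then obtain c Q where *: "vpoly n Q" "\<forall>u. P u = c + u *s Q u" by auto
    then have "B u (P u) = B u c + (u - 0) *s B u (Q u)" for u by (simp add: lin_add[OF B(1)] lin_scale[OF B(1)])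
    with B(2)[of c] polyfun_linear_factor[OF Suc.IH[OF *(1)], of 0] show ?case
      by (simp add: polyfun_add)
  qed
  with assms(1) show ?thesis by (auto simp: polyfun_def)
qed

lemma polyfun_shift: "polyfun P \<Longrightarrow> polyfun (\<lambda>u. P (u + a))"
proof -
  have "vpoly n P \<Longrightarrow> polyfun (\<lambda>u. P (u + a))" for n
  proof (induction n arbitrary: P)
    case 0
    then show ?case by (simp add: polyfun_const)
  next
    case (Suc n)
    then obtain c Q where *: "vpoly n Q" "\<forall>u. P u = c + u *s Q u" by auto
    with polyfun_add[OF polyfun_const[of c] polyfun_linear_factor[OF Suc.IH[OF *(1)], of "- a"]] show ?case
      by simp
  qed
  then show "polyfun P \<Longrightarrow> polyfun (\<lambda>u. P (u + a))" by (auto simp: polyfun_def)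
qed

text \<open>
  If \<open>P u = c + u *s P1 u\<close>, then \<open>P u - P a\<close> is \<open>(u - a) *s P1 u + a *s (P1 u - P1 a)\<close>, and induction applies
  to the last difference.
\<close>

lemma vpoly_divided_difference:
  assumes "vpoly (Suc n) P"
  shows "\<exists>Q. vpoly n Q \<and> (\<forall>u. P u = P a + (u - a) *s Q u)"
  using assms
proof (induction n arbitrary: P)
  case 0
  then show ?case by (auto intro!: exI[of _ "\<lambda>u. 0"])
next
  case (Suc n)
  then obtain c P1 where P: "vpoly (Suc n) P1" "\<forall>u. P u = c + u *s P1 u" by auto
  from Suc.IH[OF P(1)] obtain Q where Q: "vpoly n Q" "\<forall>u. P1 u = P1 a + (u - a) *s Q u" by blast
  have "P u = P a + (u - a) *s (P1 u + a *s Q u)" for u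
  proof -
    have "P u = c + (u - a) *s P1 u + a *s P1 u" using P(2) by (simp add: algebra_simps)
    also have "a *s P1 u = a *s P1 a + (a * (u - a)) *s Q u"
      using Q(2)[rule_format, of u] by (metis scale_right_distrib scale_scale)
    finally show ?thesis using P(2) by (simp add: algebra_simps)
  qed
  with vpoly_add[OF P(1) vpoly_Suc[OF vpoly_scale[OF Q(1)]], of a] show ?case by blast
qed

text \<open>
  Divided differences at points of \<open>A\<close> again have values in \<open>U\<close>, and they have smaller degree.  The case of
  the zero subspace is the identity theorem for polynomial functions.
\<close>

lemma polyfun_in_subspace:
  assumes "polyfun P" "subspace U" "infinite A" "\<And>a. a \<in> A \<Longrightarrow> P a \<in> U"
  shows "P u \<in> U"
proof -
  have "vpoly n P \<Longrightarrow> infinite A \<Longrightarrow> (\<forall>a\<in>A. P a \<in> U) \<Longrightarrow> P u \<in> U" for n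
  proof (induction n arbitrary: P A)
    case 0
    then show ?case using subspace_0[OF assms(2)] by simp
  next
    case (Suc n)
    then obtain a where a: "a \<in> A" by (metis finite.emptyI ex_in_conv)
    from vpoly_divided_difference[OF Suc.prems(1), of a]
    obtain Q where Q: "vpoly n Q" "\<forall>u. P u = P a + (u - a) *s Q u" by blast
    have "Q b \<in> U" if b: "b \<in> A - {a}" for b
    proof -
      have "Q b = inverse (b - a) *s (P b - P a)" using Q(2)[rule_format, of b] b by simp
      then show ?thesis using b a Suc.prems(3) assms(2) by (simp add: subspace_scale subspace_diff)
    qed
    then have "Q u \<in> U" using Suc.IH[OF Q(1), of "A - {a}"] Suc.prems(2) by simp
    then show ?case using Q(2)[rule_format, of u] a Suc.prems(3) assms(2)
      by (simp add: subspace_scale subspace_add)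
  qed
  with assms show ?thesis by (auto simp: polyfun_def)
qed

lemma polyfun_eq_0:
  assumes "polyfun P" "infinite A" "\<And>a. a \<in> A \<Longrightarrow> P a = 0"
  shows "P u = 0"
  using polyfun_in_subspace[OF assms(1) subspace_single_0 assms(2), of u] assms(3) by simp

lemma polyfun_eq:
  assumes "polyfun P" "polyfun Q" "finite S" "\<And>a. a \<notin> S \<Longrightarrow> P a = Q a"
  shows "P u = Q u"
  using polyfun_eq_0[OF polyfun_diff[OF assms(1,2)] infinite_Compl_finite[OF assms(3)]] assms(4) by auto

lemma polyfun_cancel:
  assumes "polyfun P" "polyfun Q" "\<And>u. root_poly vs u *s P u = root_poly vs u *s Q u"
  shows "P u = Q u"
proof (rule polyfun_eq[OF assms(1,2), of "set vs"])
  show "P a = Q a" if "a \<notin> set vs" for a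
    using assms(3)[of a] that by (simp add: root_poly_eq_0_iff)
qed simp

text \<open>
  Each root of the factor splits off a linear polynomial and lowers the degree by one.
\<close>

lemma root_poly_factor_degree:
  assumes "vpoly n P" "polyfun R" "\<And>u. P u = root_poly vs u *s R u"
  shows "vpoly (n - length vs) R"
  using assms
proof (induction vs arbitrary: n P)
  case Nil
  moreover from this have "P = R" by auto
  ultimately show ?case by simp
next
  case (Cons v vs)
  let ?P = "\<lambda>u. root_poly vs u *s R u"
  have "vpoly (n - 1) ?P"
  proof (cases n)
    case 0
    have "?P u = 0" for u
      by (rule polyfun_cancel[of _ _ "[v]"])
        (use Cons.prems 0 in \<open>auto intro: polyfun_root_poly polyfun_const\<close>)
    with 0 show ?thesis by simp
  next
    case (Suc m)
    then obtain Q where Q: "vpoly m Q" "\<forall>u. P u = P v + (u - v) *s Q u"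
      using vpoly_divided_difference[of m P v] Cons.prems(1) by blast
    have "P v = 0" using Cons.prems(3)[of v] by simp
    have "?P u = Q u" for u
    proof (rule polyfun_cancel[of _ _ "[v]"])
      show "root_poly [v] u *s ?P u = root_poly [v] u *s Q u" for u
        using Q(2)[rule_format, of u] Cons.prems(3)[of u] \<open>P v = 0\<close> by simp
    qed (intro polyfun_root_poly polyfunI[OF Q(1)] Cons.prems(2))+
    then have "?P = Q" by (rule ext)
    with Q(1) Suc show ?thesis by simp
  qed
  from Cons.IH[OF this Cons.prems(2)] show ?case by simp
qed

lemma root_poly_factor_eq_0:
  assumes "vpoly n P" "polyfun R" "\<And>u. P u = root_poly vs u *s R u" "n \<le> length vs"
  shows "P u = 0"
  using root_poly_factor_degree[OF assms(1-3)] assms(3,4) by simp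

text \<open>
  Evaluation at \<open>c\<close> gives \<open>R c = 0\<close>, so that \<open>u - c\<close> can be cancelled on both sides.
\<close>

lemma root_poly_factor_coprime:
  assumes "polyfun P" "polyfun R" "\<And>u. (u - c) *s P u = root_poly vs u *s R u" "root_poly vs c \<noteq> 0"
  shows "\<exists>R'. polyfun R' \<and> (\<forall>u. P u = root_poly vs u *s R' u)"
proof -
  obtain n where "vpoly (Suc n) R" using assms(2) vpoly_Suc unfolding polyfun_def by blast
  from vpoly_divided_difference[OF this, of c]
  obtain R' where R': "vpoly n R'" "\<forall>u. R u = R c + (u - c) *s R' u" by blast
  have "R c = 0" using assms(3)[of c] assms(4) by simp
  have "P u = root_poly vs u *s R' u" for u
  proof (rule polyfun_cancel[of _ _ "[c]"])
    show "root_poly [c] u *s P u = root_poly [c] u *s root_poly vs u *s R' u" for u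
      using assms(3)[of u] R'(2)[rule_format, of u] \<open>R c = 0\<close> by (simp add: mult.commute)
  qed (intro polyfun_root_poly polyfunI[OF R'(1)] assms(1))+
  with polyfunI[OF R'(1)] show ?thesis by blast
qed

text \<open>
  Newton interpolation at the roots.  The divided differences of \<open>P\<close> stay in every subspace that
  contains the values of \<open>P\<close>, hence so does the remainder.
\<close>

lemma division_with_remainder:
  assumes "polyfun P" "subspace U" "\<And>u. P u \<in> U"
  shows "\<exists>Q R. polyfun Q \<and> vpoly (length vs) R \<and> (\<forall>u. R u \<in> U) \<and> (\<forall>u. P u = root_poly vs u *s Q u + R u)"
  using assms(1,3)
proof (induction vs arbitrary: P)
  case Nil
  then show ?case by (intro exI[of _ P] exI[of _ "\<lambda>u. 0"]) (simp add: subspace_0[OF assms(2)])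
next
  case (Cons v vs)
  obtain n where "vpoly (Suc n) P" using Cons.prems(1) vpoly_Suc unfolding polyfun_def by blast
  from vpoly_divided_difference[OF this, of v]
  obtain P' where P': "vpoly n P'" "\<forall>u. P u = P v + (u - v) *s P' u" by blast
  have "P' u \<in> U" for u
  proof (rule polyfun_in_subspace[OF polyfunI[OF P'(1)] assms(2)])
    show "infinite (- {v})" by (rule infinite_Compl_finite) simp
    fix a assume "a \<in> - {v}"
    then have "P' a = inverse (a - v) *s (P a - P v)" using P'(2)[rule_format, of a] by simp
    then show "P' a \<in> U" using Cons.prems(2) assms(2) by (simp add: subspace_scale subspace_diff)
  qed
  from Cons.IH[OF polyfunI[OF P'(1)] this] obtain Q R
    where QR: "polyfun Q" "vpoly (length vs) R" "\<forall>u. R u \<in> U" "\<forall>u. P' u = root_poly vs u *s Q u + R u" by blast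
  have "P u = root_poly (v # vs) u *s Q u + (P v + (u - v) *s R u)" for u
  proof -
    have "P u = P v + (u - v) *s (root_poly vs u *s Q u + R u)" using P'(2) QR(4) by metis
    then show ?thesis by (simp add: scale_right_distrib algebra_simps)
  qed
  moreover have "vpoly (length (v # vs)) (\<lambda>u. P v + (u - v) *s R u)"
    using vpoly_add[OF vpoly_mono[OF vpoly_const] vpoly_linear_factor[OF QR(2)]] by simp
  moreover have "P v + (u - v) *s R u \<in> U" for u
    using Cons.prems(2) QR(3) assms(2) by (simp add: subspace_add subspace_scale)
  ultimately show ?case using QR(1) by blast
qed

lemma sum_powers_eq_0:
  assumes "\<And>u. (\<Sum>d<n. u ^ d *s c d) = 0" "d < n"
  shows "c d = 0"
  using assms
proof (induction n arbitrary: c d)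
  case (Suc n)
  have sum: "(\<Sum>d<Suc n. u ^ d *s c d) = c 0 + u *s (\<Sum>d<n. u ^ d *s c (Suc d))" for u
    by (simp only: sum.lessThan_Suc_shift) (simp add: scale_sum_right)
  then have c0: "c 0 = 0" using Suc.prems(1)[of 0] by simp
  have "(\<Sum>d<n. u ^ d *s c (Suc d)) = 0" for u
    by (rule polyfun_eq[of _ "\<lambda>u. 0" "{0}"])
      (use sum Suc.prems(1) c0 in \<open>auto intro: polyfunI vpoly_sum_powers polyfun_const\<close>)
  from Suc.IH[of "\<lambda>d. c (Suc d)", OF this] c0 Suc.prems(2) show ?case by (cases d) auto
qed simp

end

section \<open>Odd lowering operators for a pair of coprime weights\<close>

text \<open>
  The defining relations that move the lowering operator \<open>B\<close> to the left, for two indices of opposite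
  parity, evaluated at complex numbers and multiplied by \<open>u - v\<close>.  The sign \<open>e\<close> is 1 for the parities 01 and -1 for 10.
\<close>

locale gl11_operators = complex_vector_space scale
  for scale :: "complex \<Rightarrow> 'v::ab_group_add \<Rightarrow> 'v" (infixr \<open>*s\<close> 75) +
  fixes e :: complex and A B C D :: "complex \<Rightarrow> 'v \<Rightarrow> 'v"
  assumes e_nonzero: "e \<noteq> 0"
    and A_lin: "lin (A u)" and B_lin: "lin (B u)" and C_lin: "lin (C u)" and D_lin: "lin (D u)"
    and A_polyfun: "polyfun (\<lambda>u. A u x)" and B_polyfun: "polyfun (\<lambda>u. B u x)"
    and C_polyfun: "polyfun (\<lambda>u. C u x)" and D_polyfun: "polyfun (\<lambda>u. D u x)"
    and BB: "(u - v + e) *s B u (B v x) = - ((u - v - e) *s B v (B u x))"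
    and AB: "(u - v) *s A u (B v x) = (u - v - e) *s B v (A u x) + e *s B u (A v x)"
    and DB: "(u - v) *s D u (B v x) = (u - v - e) *s B v (D u x) + e *s B u (D v x)"
    and CB: "(u - v) *s C u (B v x) = - ((u - v) *s B v (C u x)) + e *s (D v (A u x) - D u (A v x))"
begin

text \<open>
  Where \<open>A u\<close> is invertible, \<open>A(u)\<^sup>-\<^sup>1 (D(u) - B(u) A(u)\<^sup>-\<^sup>1 C(u))\<close> is central; the operator below is the
  product of this central series with \<open>A(u) A(u + e)\<close>, which is polynomial in \<open>u\<close>.
\<close>

definition qdet :: "complex \<Rightarrow> 'v \<Rightarrow> 'v"
  where "qdet u x = D u (A (u + e) x) - B u (C (u + e) x)"

lemma qdet_alt: "qdet u x = C (u + e) (B u x) + D (u + e) (A u x)"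
proof -
  have "e *s C (u + e) (B u x) = e *s (- B u (C (u + e) x) + D u (A (u + e) x) - D (u + e) (A u x))"
    using CB[of "u + e" u x] by (simp add: algebra_simps)
  then have "C (u + e) (B u x) = - B u (C (u + e) x) + D u (A (u + e) x) - D (u + e) (A u x)"
    using e_nonzero by (simp only: scale_cancel_left) blast
  then show ?thesis by (simp add: qdet_def)
qed

lemma qdet_polyfun: "polyfun (\<lambda>u. qdet u x)"
  unfolding qdet_def
  by (intro polyfun_diff polyfun_compose[OF _ D_lin D_polyfun] polyfun_compose[OF _ B_lin B_polyfun]
      polyfun_shift[OF A_polyfun] polyfun_shift[OF C_polyfun])

lemma A_lowering:
  assumes "A v x = 0" "A u x = a *s x"
  shows "(u - v) *s A u (B v x) = ((u - v - e) * a) *s B v x"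
  using AB[of u v x] assms by (simp add: lin_0[OF B_lin] lin_scale[OF B_lin])

text \<open>
  Expanding \<open>qdet u (B v x)\<close> by \<open>DB\<close> and \<open>CB\<close> produces two multiples of \<open>B u (D v x)\<close>, which cancel; \<open>BB\<close>
  moves \<open>B v\<close> to the front of what is left.
\<close>

lemma qdet_lowering:
  assumes "A v x = 0" "A (u + e) x = a *s x"
  shows "(u - v + e) *s qdet u (B v x) = (u - v - e) *s B v (qdet u x)"
proof -
  have "(u - v + e) *s A (u + e) (B v x) = (a * (u - v)) *s B v x"
    using A_lowering[OF assms] by (simp add: algebra_simps)
  then have "(u - v + e) *s D u (A (u + e) (B v x)) = a *s (u - v) *s D u (B v x)"
    by (metis lin_scale[OF D_lin] scale_scale)
  also have "\<dots> = a *s ((u - v - e) *s B v (D u x) + e *s B u (D v x))"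
    by (simp only: DB)
  finally have D: "(u - v + e) *s D u (A (u + e) (B v x)) = \<dots>" .
  have "(u - v + e) *s C (u + e) (B v x) = - ((u - v + e) *s B v (C (u + e) x)) + (e * a) *s D v x"
    using CB[of "u + e" v x] assms by (simp add: lin_0[OF D_lin] lin_scale[OF D_lin] algebra_simps)
  then have "(u - v + e) *s B u (C (u + e) (B v x))
      = - ((u - v + e) *s B u (B v (C (u + e) x))) + (e * a) *s B u (D v x)"
    by (metis lin_scale[OF B_lin] lin_add[OF B_lin] lin_minus[OF B_lin])
  also have "\<dots> = (u - v - e) *s B v (B u (C (u + e) x)) + (e * a) *s B u (D v x)"
    by (simp only: BB minus_minus)
  finally have "(u - v + e) *s qdet u (B v x) = a *s ((u - v - e) *s B v (D u x) + e *s B u (D v x))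
     - ((u - v - e) *s B v (B u (C (u + e) x)) + (e * a) *s B u (D v x))"
    unfolding qdet_def scale_right_diff_distrib D by simp
  also have "\<dots> = (u - v - e) *s (a *s B v (D u x) - B v (B u (C (u + e) x)))"
    by (simp add: scale_right_distrib scale_right_diff_distrib mult.commute)
  also have "a *s B v (D u x) - B v (B u (C (u + e) x)) = B v (qdet u x)"
    by (simp add: qdet_def assms lin_diff[OF B_lin] lin_scale[OF B_lin] lin_scale[OF D_lin])
  finally show ?thesis .
qed

text \<open>
  The roots in \<open>ds\<close> have been used, so that they are shifted by \<open>e\<close> in the eigenvalue of \<open>A\<close>; those in \<open>ts\<close>
  are still to be used.  The last clause records the zeros that \<open>B u x\<close> has acquired so far.
\<close>

definition chain_state :: "complex list \<Rightarrow> complex list \<Rightarrow> complex list \<Rightarrow> 'v \<Rightarrow> bool"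
  where "chain_state gs ds ts x \<longleftrightarrow> x \<noteq> 0
    \<and> (\<forall>u. A u x = (root_poly ds (u - e) * root_poly ts u) *s x)
    \<and> (\<forall>u. qdet u x = (root_poly gs u * root_poly ds (u - e) * root_poly ts (u + e)) *s x)
    \<and> (\<exists>R. polyfun R \<and> (\<forall>u. B u x = root_poly ds (u - e) *s R u))"

lemma polyfun_root_poly_shift: "polyfun P \<Longrightarrow> polyfun (\<lambda>u. root_poly vs (u + a) *s P u)"
  using polyfun_root_poly[of P "map (\<lambda>v. v + - a) vs"] unfolding root_poly_shift by simp

lemma polyfun_root_poly_shift': "polyfun P \<Longrightarrow> polyfun (\<lambda>u. root_poly vs (u - a) *s P u)"
  using polyfun_root_poly_shift[of P vs "- a"] by simp

text \<open>
  Because \<open>A v x = 0\<close>, the vector \<open>C (v + e) (B v x)\<close> equals \<open>qdet v x\<close>, a multiple of \<open>x\<close>.  The order of the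
  roots keeps \<open>v - e\<close> and \<open>v - 2 e\<close> out of \<open>ds\<close> and \<open>v + e\<close> out of \<open>ts\<close>.  With \<open>v - e\<close>, \<open>v + e\<close> and the
  assumption on \<open>gs\<close> the multiple is seen to be nonzero; with \<open>v - 2 e\<close> the factor \<open>u - v + e\<close> of \<open>BB\<close>
  can be cancelled, which gives the new zero of \<open>B\<close>.
\<close>

lemma chain_step:
  assumes x: "chain_state gs ds (v # ts) x"
    and gs: "v \<notin> set gs"
    and ds: "\<And>d. d \<in> set ds \<Longrightarrow> Re (v / e) \<le> Re (d / e)"
    and ts: "\<And>d. d \<in> set ts \<Longrightarrow> Re (d / e) \<le> Re (v / e)"
  shows "chain_state gs (v # ds) ts (B v x)"
proof -
  let ?y = "B v x"
  \<comment> \<open>Adding a positive multiple of \<open>e\<close> to \<open>d\<close> increases \<open>Re (d / e)\<close>.\<close>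
  have shift: "c \<noteq> d + e" "c \<noteq> d + 2 * e" if "Re (c / e) \<le> Re (d / e)" for c d
    using that e_nonzero by (auto simp: add_divide_distrib)
  have "x \<noteq> 0" and Ax: "A u x = (root_poly ds (u - e) * root_poly (v # ts) u) *s x"
    and Qx: "qdet u x = (root_poly gs u * root_poly ds (u - e) * root_poly (v # ts) (u + e)) *s x" for u
    using x by (auto simp: chain_state_def)
  have Avx: "A v x = 0" by (simp add: Ax)
  have "root_poly gs v \<noteq> 0" using gs by (simp add: root_poly_eq_0_iff)
  moreover have "root_poly ds (v - e) \<noteq> 0"
    using shift(1)[OF ds] by (fastforce simp: root_poly_eq_0_iff)
  moreover have "root_poly (v # ts) (v + e) \<noteq> 0"
    using shift(1)[OF ts] e_nonzero by (fastforce simp: root_poly_eq_0_iff)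
  ultimately have "qdet v x \<noteq> 0" using \<open>x \<noteq> 0\<close> by (simp add: Qx)
  then have "C (v + e) ?y \<noteq> 0" using qdet_alt[of v x] Avx by (auto simp: lin_0[OF D_lin])
  then have "?y \<noteq> 0" using lin_0[OF C_lin] by auto
  moreover have "A u ?y = (root_poly (v # ds) (u - e) * root_poly ts u) *s ?y" for u
  proof (rule polyfun_cancel[of "\<lambda>u. A u ?y" "\<lambda>u. (root_poly (v # ds) (u - e) * root_poly ts u) *s ?y" "[v]"])
    show "root_poly [v] u *s A u ?y = root_poly [v] u *s (root_poly (v # ds) (u - e) * root_poly ts u) *s ?y" for u
    proof -
      have "(u - v - e) * (root_poly ds (u - e) * root_poly (v # ts) u)
          = (u - v) * (root_poly (v # ds) (u - e) * root_poly ts u)"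
        by (simp add: algebra_simps)
      then show ?thesis using A_lowering[OF Avx Ax, of u] by simp
    qed
  qed (rule A_polyfun, unfold scale_scale[symmetric],
      rule polyfun_root_poly_shift'[OF polyfun_root_poly[OF polyfun_const]])
  moreover have "qdet u ?y = (root_poly gs u * root_poly (v # ds) (u - e) * root_poly ts (u + e)) *s ?y" for u
  proof (rule polyfun_cancel[of "\<lambda>u. qdet u ?y" "\<lambda>u. (root_poly gs u * root_poly (v # ds) (u - e) * root_poly ts (u + e)) *s ?y" "[v - e]"])
    show "root_poly [v - e] u *s qdet u ?y
      = root_poly [v - e] u *s (root_poly gs u * root_poly (v # ds) (u - e) * root_poly ts (u + e)) *s ?y" for u
    proof -
      have "(u - v - e) * (root_poly gs u * root_poly ds (u - e) * root_poly (v # ts) (u + e))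
          = (u - (v - e)) * (root_poly gs u * root_poly (v # ds) (u - e) * root_poly ts (u + e))"
        by (simp add: algebra_simps)
      moreover have "(u - (v - e)) *s qdet u ?y = (u - v - e) *s B v (qdet u x)"
        using qdet_lowering[OF Avx Ax, of u] by (simp add: algebra_simps)
      ultimately show ?thesis by (simp only: Qx lin_scale[OF B_lin] scale_scale root_poly_Nil root_poly_Cons mult_1_right)
    qed
  qed (rule qdet_polyfun, unfold scale_scale[symmetric], rule polyfun_root_poly,
      rule polyfun_root_poly_shift', rule polyfun_root_poly_shift, rule polyfun_const)
  moreover have "\<exists>R. polyfun R \<and> (\<forall>u. B u ?y = root_poly (v # ds) (u - e) *s R u)"
  proof -
    obtain R where R: "polyfun R" "\<And>u. B u x = root_poly ds (u - e) *s R u"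
      using x by (auto simp: chain_state_def)
    let ?S = "\<lambda>u. - B v (R u)"
    have S: "polyfun ?S" by (intro polyfun_minus polyfun_lin[OF _ B_lin] R)
    have eq: "(u - (v - e)) *s B u ?y = root_poly (map (\<lambda>v. v + e) (v # ds)) u *s ?S u" for u
      using BB[of u v x] R(2)[of u]
      by (simp add: root_poly_shift lin_scale[OF B_lin] algebra_simps)
    have "root_poly (map (\<lambda>v. v + e) (v # ds)) (v - e) \<noteq> 0"
    proof -
      have "v - e \<noteq> d + e" if "d = v \<or> d \<in> set ds" for d
        using shift(2)[of v d] ds that by (auto simp: algebra_simps)
      then show ?thesis using e_nonzero by (auto simp: root_poly_eq_0_iff)
    qed
    from root_poly_factor_coprime[OF B_polyfun S eq this] show ?thesis
      by (simp only: root_poly_shift)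
  qed
  ultimately show ?thesis by (simp add: chain_state_def)
qed

lemma chain_end:
  assumes "chain_state gs ds ts x" "\<forall>v\<in>set ts. v \<notin> set gs"
    "\<forall>d\<in>set ds. \<forall>v\<in>set ts. Re (v / e) \<le> Re (d / e)"
    "sorted_wrt (\<lambda>v w. Re (w / e) \<le> Re (v / e)) ts"
    "x \<in> W" "\<And>u y. y \<in> W \<Longrightarrow> B u y \<in> W"
  shows "\<exists>y\<in>W. chain_state gs (rev ts @ ds) [] y"
  using assms(1-5)
proof (induction ts arbitrary: ds x)
  case Nil
  then show ?case by auto
next
  case (Cons v ts)
  have "chain_state gs (v # ds) ts (B v x)"
    by (rule chain_step) (use Cons.prems in auto)
  moreover have "B v x \<in> W" using Cons.prems(5) assms(6) by blast
  ultimately show ?case using Cons.IH[of "v # ds" "B v x"] Cons.prems by auto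
qed

text \<open>
  When all roots have been used, \<open>B u \<eta>\<close> is divisible by a polynomial of degree \<open>length fs\<close> and has smaller
  degree, so it vanishes.  Then \<open>qdet u \<eta>\<close> is \<open>D (u + e) (A u \<eta>)\<close>, from which \<open>D\<close> can be read off.
\<close>

theorem gl11_lowest_vector:
  assumes "\<xi> \<noteq> 0" "\<xi> \<in> W" "\<And>u y. y \<in> W \<Longrightarrow> B u y \<in> W"
    and A: "\<And>u. A u \<xi> = root_poly fs u *s \<xi>"
    and D: "\<And>u. D u \<xi> = root_poly gs u *s \<xi>"
    and C: "\<And>u. C u \<xi> = 0"
    and deg: "\<And>x. vpoly (length fs) (\<lambda>u. B u x)"
    and coprime: "set fs \<inter> set gs = {}"
  shows "\<exists>\<eta>\<in>W. \<eta> \<noteq> 0 \<and> (\<forall>u. A u \<eta> = root_poly fs (u - e) *s \<eta>)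
    \<and> (\<forall>u. D u \<eta> = root_poly gs (u - e) *s \<eta>) \<and> (\<forall>u. B u \<eta> = 0)"
proof -
  define ts where "ts = rev (sort_key (\<lambda>v. Re (v / e)) fs)"
  have ms: "mset ts = mset fs" by (simp add: ts_def)
  then have set: "set ts = set fs" by (metis set_mset_mset)
  have rp: "root_poly ts u = root_poly fs u" for u by (rule root_poly_mset[OF ms])
  have srt: "sorted_wrt (\<lambda>v w. Re (w / e) \<le> Re (v / e)) ts"
    using sorted_sort_key[of "\<lambda>v. Re (v / e)" fs] by (simp add: ts_def sorted_wrt_rev sorted_map)
  have "chain_state gs [] ts \<xi>"
    using assms(1) B_polyfun A C by (auto simp: chain_state_def rp D qdet_def lin_0[OF B_lin] lin_scale[OF D_lin] mult.commute)
  from chain_end[OF this, of W] srt set coprime assms(2,3)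
  obtain \<eta> where \<eta>: "\<eta> \<in> W" "chain_state gs (rev ts) [] \<eta>" by auto
  have rp': "root_poly (rev ts) u = root_poly fs u" for u by (rule root_poly_mset) (simp add: ms)
  obtain R where R: "polyfun R" "\<And>u. B u \<eta> = root_poly (map (\<lambda>v. v + e) fs) u *s R u"
    using \<eta>(2) unfolding chain_state_def rp' root_poly_shift by blast
  have B0: "B u \<eta> = 0" for u
    by (rule root_poly_factor_eq_0[OF deg R]) simp
  have "A u \<eta> = root_poly fs (u - e) *s \<eta>" for u
    using \<eta>(2) by (simp add: chain_state_def rp')
  moreover have "D u \<eta> = root_poly gs (u - e) *s \<eta>" for u
  proof -
    have D': "D (u + e) \<eta> = root_poly gs u *s \<eta>" for u
    proof (rule polyfun_cancel[of "\<lambda>u. D (u + e) \<eta>" "\<lambda>u. root_poly gs u *s \<eta>" "map (\<lambda>v. v + e) fs"])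
      have "root_poly fs (u - e) *s D (u + e) \<eta> = qdet u \<eta>" for u
        using qdet_alt[of u \<eta>] \<eta>(2)
        by (simp add: B0 lin_0[OF C_lin] chain_state_def rp' lin_scale[OF D_lin])
      then show "root_poly (map (\<lambda>v. v + e) fs) u *s D (u + e) \<eta>
          = root_poly (map (\<lambda>v. v + e) fs) u *s root_poly gs u *s \<eta>" for u
        using \<eta>(2) by (simp add: chain_state_def rp' root_poly_shift mult.commute)
    qed (intro polyfun_shift[OF D_polyfun] polyfun_root_poly polyfun_const)+
    show ?thesis using D'[of "u - e"] by simp
  qed
  ultimately show ?thesis using \<eta> B0 by (auto simp: chain_state_def)
qed

end

section \<open>Division by the common factor of the two weights\<close>

context complex_vector_space
begin

definition divisible :: "complex list \<Rightarrow> (complex \<Rightarrow> 'v) \<Rightarrow> bool"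
  where "divisible hs P \<longleftrightarrow> (\<exists>R. polyfun R \<and> (\<forall>u. P u = root_poly hs u *s R u))"

lemma divisibleI: "polyfun R \<Longrightarrow> (\<And>u. P u = root_poly hs u *s R u) \<Longrightarrow> divisible hs P"
  by (auto simp: divisible_def)

lemma divisible_0: "divisible hs (\<lambda>u. 0)"
  by (rule divisibleI[OF polyfun_const[of 0]]) simp

lemma divisible_add: "divisible hs P \<Longrightarrow> divisible hs Q \<Longrightarrow> divisible hs (\<lambda>u. P u + Q u)"
proof -
  assume "divisible hs P" "divisible hs Q"
  then obtain R S where "polyfun R" "\<forall>u. P u = root_poly hs u *s R u" "polyfun S" "\<forall>u. Q u = root_poly hs u *s S u"
    by (auto simp: divisible_def)
  then show ?thesis by (intro divisibleI[OF polyfun_add[of R S]]) (simp_all add: scale_right_distrib)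
qed

lemma divisible_lin: "divisible hs P \<Longrightarrow> lin f \<Longrightarrow> divisible hs (\<lambda>u. f (P u))"
proof -
  assume "divisible hs P" and f: "lin f"
  then obtain R where "polyfun R" "\<forall>u. P u = root_poly hs u *s R u" by (auto simp: divisible_def)
  then show ?thesis by (intro divisibleI[OF polyfun_lin[of R f]]) (simp_all add: f lin_scale)
qed

lemma divisible_scale: "divisible hs P \<Longrightarrow> divisible hs (\<lambda>u. c *s P u)"
  by (rule divisible_lin[OF _ lin_scaling])

lemma divisible_minus: "divisible hs P \<Longrightarrow> divisible hs (\<lambda>u. - P u)"
  using divisible_scale[of hs P "-1"] by simp

lemma divisible_diff: "divisible hs P \<Longrightarrow> divisible hs Q \<Longrightarrow> divisible hs (\<lambda>u. P u - Q u)"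
  unfolding diff_conv_add_uminus by (intro divisible_add divisible_minus)

lemma divisible_linear_factor:
  assumes "divisible hs P"
  shows "divisible hs (\<lambda>u. (u - a) *s P u)"
proof -
  obtain R where R: "polyfun R" "\<And>u. P u = root_poly hs u *s R u"
    using assms by (auto simp: divisible_def)
  show ?thesis
    by (rule divisibleI[OF polyfun_linear_factor[OF R(1), of a]]) (simp add: R(2) mult.commute)
qed

lemma divisible_cancel_linear:
  assumes "polyfun P" "divisible hs (\<lambda>u. (u - c) *s P u)" "c \<notin> set hs"
  shows "divisible hs P"
proof -
  obtain R where R: "polyfun R" "\<And>u. (u - c) *s P u = root_poly hs u *s R u"
    using assms by (auto simp: divisible_def)
  from root_poly_factor_coprime[OF assms(1) R] assms(3) show ?thesis
    by (simp add: root_poly_eq_0_iff divisible_def)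
qed

lemma polyfun_linear_factors:
  assumes "polyfun P"
  shows "polyfun (\<lambda>u. (u - a) *s P u)" "polyfun (\<lambda>u. (a - u) *s P u)"
    "polyfun (\<lambda>u. (u - a + b) *s P u)" "polyfun (\<lambda>u. (a - u + b) *s P u)"
    "polyfun (\<lambda>u. (u - a - b) *s P u)" "polyfun (\<lambda>u. (a - u - b) *s P u)"
proof -
  have 1: "polyfun (\<lambda>u. (u - a) *s P u)" for a by (rule polyfun_linear_factor[OF assms])
  have 2: "polyfun (\<lambda>u. (a - u) *s P u)" for a
    using polyfun_minus[OF 1[of a]] by (simp add: scale_minus_left[symmetric])
  show "polyfun (\<lambda>u. (u - a) *s P u)" "polyfun (\<lambda>u. (a - u) *s P u)" by (fact 1 2)+
  show "polyfun (\<lambda>u. (u - a + b) *s P u)" "polyfun (\<lambda>u. (u - a - b) *s P u)"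
    using 1[of "a - b"] 1[of "a + b"] by (simp_all add: algebra_simps)
  show "polyfun (\<lambda>u. (a - u + b) *s P u)" "polyfun (\<lambda>u. (a - u - b) *s P u)"
    using 2[of "a + b"] 2[of "a - b"] by (simp_all add: algebra_simps)
qed

text \<open>
  The identity theorem, first in \<open>u\<close> for generic \<open>v\<close>, then in \<open>v\<close>.
\<close>

lemma polyfun_eq_0_two_variables:
  assumes "\<And>v. polyfun (\<lambda>u. F u v)" "\<And>u. polyfun (\<lambda>v. F u v)" "finite S"
    "\<And>u v. u \<notin> S \<Longrightarrow> v \<notin> S \<Longrightarrow> F u v = 0"
  shows "F u v = 0"
proof -
  have "F u v = 0" if "v \<notin> S" for u v
    by (rule polyfun_eq_0[OF assms(1) infinite_Compl_finite[OF assms(3)]]) (use assms(4) that in auto)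
  then show ?thesis
    using polyfun_eq_0[OF assms(2) infinite_Compl_finite[OF assms(3)]] by auto
qed

end

text \<open>
  On a subspace \<open>U\<close> all values of some polynomial families of operators may be divisible by the
  polynomial with roots \<open>hs\<close>.  The projection onto \<open>U\<close> makes the quotients linear operators on the whole
  type; they have values in \<open>U\<close>, so quadratic relations between them need no restriction to \<open>U\<close>.
\<close>

locale polynomial_quotient = complex_vector_space scale
  for scale :: "complex \<Rightarrow> 'v::ab_group_add \<Rightarrow> 'v" (infixr \<open>*s\<close> 75) +
  fixes hs :: "complex list" and \<pi> :: "'v \<Rightarrow> 'v" and U :: "'v set"
  assumes proj_lin: "lin \<pi>" and subspace_U: "subspace U"
    and proj_in: "\<pi> x \<in> U" and proj_id: "x \<in> U \<Longrightarrow> \<pi> x = x"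
begin

definition reducible :: "(complex \<Rightarrow> 'v \<Rightarrow> 'v) \<Rightarrow> bool"
  where "reducible T \<longleftrightarrow> (\<forall>u. lin (T u)) \<and> (\<forall>x\<in>U. divisible hs (\<lambda>u. T u x) \<and> (\<forall>u. T u x \<in> U))"

text \<open>
  The quotient is unique by \<open>polyfun_cancel\<close>, so its choice for each \<open>x\<close> is linear in \<open>x\<close>.
\<close>

definition quot :: "(complex \<Rightarrow> 'v \<Rightarrow> 'v) \<Rightarrow> complex \<Rightarrow> 'v \<Rightarrow> 'v"
  where "quot T u x = (SOME R. polyfun R \<and> (\<forall>u. T u (\<pi> x) = root_poly hs u *s R u)) u"

lemma reducible_lin: "reducible T \<Longrightarrow> lin (T u)"
  by (simp add: reducible_def)

lemma quot:
  assumes "reducible T"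
  shows quot_polyfun: "polyfun (\<lambda>u. quot T u x)"
    and quot_mult: "root_poly hs u *s quot T u x = T u (\<pi> x)"
proof -
  define R where "R = (SOME R. polyfun R \<and> (\<forall>u. T u (\<pi> x) = root_poly hs u *s R u))"
  have "divisible hs (\<lambda>u. T u (\<pi> x))" using assms proj_in by (simp add: reducible_def)
  then have "\<exists>R. polyfun R \<and> (\<forall>u. T u (\<pi> x) = root_poly hs u *s R u)" by (simp add: divisible_def)
  from someI_ex[OF this] have "polyfun R \<and> (\<forall>u. T u (\<pi> x) = root_poly hs u *s R u)"
    unfolding R_def .
  moreover have "quot T u x = R u" for u by (simp add: quot_def R_def)
  ultimately show "polyfun (\<lambda>u. quot T u x)" "root_poly hs u *s quot T u x = T u (\<pi> x)"
    by simp_all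
qed

lemma quot_eqI:
  assumes "reducible T" "polyfun R" "\<And>u. T u (\<pi> x) = root_poly hs u *s R u"
  shows "quot T u x = R u"
  by (rule polyfun_cancel[of "\<lambda>u. quot T u x" R hs, OF quot_polyfun[OF assms(1)] assms(2)])
    (simp add: quot_mult[OF assms(1)] assms(3))

lemma quot_lin:
  assumes T: "reducible T"
  shows "lin (quot T u)"
proof (rule linI)
  note T_lin = reducible_lin[OF T]
  show "quot T u (x + y) = quot T u x + quot T u y" for x y
    by (rule quot_eqI[OF T polyfun_add[OF quot_polyfun[OF T, of x] quot_polyfun[OF T, of y]]])
      (simp add: lin_add[OF T_lin] lin_add[OF proj_lin] quot_mult[OF T] scale_right_distrib)
  show "quot T u (c *s x) = c *s quot T u x" for c x
    by (rule quot_eqI[OF T polyfun_scale[OF quot_polyfun[OF T, of x]]])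
      (simp add: lin_scale[OF T_lin] lin_scale[OF proj_lin] quot_mult[OF T, symmetric] mult.commute)
qed

lemma quot_in:
  assumes T: "reducible T"
  shows "quot T u x \<in> U"
proof (rule polyfun_in_subspace[OF quot_polyfun[OF T] subspace_U])
  show "infinite (- set hs)" by (rule infinite_Compl_finite) simp
  fix a assume "a \<in> - set hs"
  then have "quot T a x = inverse (root_poly hs a) *s T a (\<pi> x)"
    by (simp add: quot_mult[OF T, symmetric] root_poly_eq_0_iff)
  then show "quot T a x \<in> U"
    using T proj_in subspace_U by (simp add: subspace_scale reducible_def)
qed

lemma quot_compose:
  assumes T: "reducible T" and S: "reducible S"
  shows "(root_poly hs u * root_poly hs v) *s quot T u (quot S v x) = T u (S v (\<pi> x))"
    and "(root_poly hs v * root_poly hs u) *s quot T u (quot S v x) = T u (S v (\<pi> x))"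
proof -
  let ?y = "quot S v x"
  have "root_poly hs u *s quot T u ?y = T u ?y"
    using proj_id[OF quot_in[OF S]] quot_mult[OF T, of u ?y] by simp
  then have "(root_poly hs v * root_poly hs u) *s quot T u ?y = T u (root_poly hs v *s ?y)"
    by (simp add: lin_scale[OF reducible_lin[OF T]] flip: scale_scale)
  then show "(root_poly hs v * root_poly hs u) *s quot T u ?y = T u (S v (\<pi> x))"
    by (simp add: quot_mult[OF S])
  then show "(root_poly hs u * root_poly hs v) *s quot T u ?y = T u (S v (\<pi> x))"
    by (simp add: mult.commute)
qed

text \<open>
  Away from the roots of \<open>hs\<close> a quadratic relation for the quotients follows from that for the original
  operators by division; the identity theorem extends it to the roots.
\<close>

lemma quot_relation:
  assumes "\<And>v. polyfun (\<lambda>u. F u v)" "\<And>u. polyfun (\<lambda>v. F u v)"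
    "\<And>u v. (root_poly hs u * root_poly hs v) *s F u v = 0"
  shows "F u v = 0"
proof (rule polyfun_eq_0_two_variables[of F "set hs", OF assms(1,2)])
  show "F u v = 0" if "u \<notin> set hs" "v \<notin> set hs" for u v
    using assms(3)[of u v] that by (simp add: root_poly_eq_0_iff)
qed simp

end

context gl11_operators
begin

text \<open>
  Only those \<open>v\<close> are used for which the linear polynomials \<open>u - v\<close> and \<open>u - v + e\<close> are prime to the
  divisor, because these two are the factors that have to be cancelled.  As finitely many \<open>v\<close> are excluded, the
  span is nevertheless closed under every \<open>B v\<close> (\<open>generic_span_B\<close>).
\<close>

inductive_set generic_span :: "complex list \<Rightarrow> 'v \<Rightarrow> 'v set" for hs \<xi> where
  base: "\<xi> \<in> generic_span hs \<xi>"
| zero: "0 \<in> generic_span hs \<xi>"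
| add: "x \<in> generic_span hs \<xi> \<Longrightarrow> y \<in> generic_span hs \<xi> \<Longrightarrow> x + y \<in> generic_span hs \<xi>"
| scale: "x \<in> generic_span hs \<xi> \<Longrightarrow> c *s x \<in> generic_span hs \<xi>"
| lower: "x \<in> generic_span hs \<xi> \<Longrightarrow> v \<notin> set hs \<Longrightarrow> v - e \<notin> set hs \<Longrightarrow> B v x \<in> generic_span hs \<xi>"

lemma subspace_generic_span: "subspace (generic_span hs \<xi>)"
  by (rule subspaceI) (auto intro: generic_span.intros)

lemma infinite_generic: "infinite {v. v \<notin> set hs \<and> v - e \<notin> set hs}"
proof -
  have "- (set hs \<union> (\<lambda>h. h + e) ` set hs) \<subseteq> {v. v \<notin> set hs \<and> v - e \<notin> set hs}"
    by (auto simp: image_iff) (metis diff_add_cancel)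
  then show ?thesis using infinite_Compl_finite[of "set hs \<union> (\<lambda>h. h + e) ` set hs"]
    by (meson finite_Un finite_imageI finite_set infinite_super)
qed

lemma generic_span_B:
  assumes "x \<in> generic_span hs \<xi>"
  shows "B v x \<in> generic_span hs \<xi>"
  by (rule polyfun_in_subspace[OF B_polyfun subspace_generic_span infinite_generic[of hs]])
    (use assms in \<open>auto intro: generic_span.lower\<close>)

lemma generic_span_minimal:
  assumes "x \<in> generic_span hs \<xi>" "subspace W" "\<xi> \<in> W" "\<And>v y. y \<in> W \<Longrightarrow> B v y \<in> W"
  shows "x \<in> W"
  using assms(1) by induction (use assms(2-) in \<open>auto intro: subspace_0 subspace_add subspace_scale\<close>)

lemma divisible_B:
  assumes "x \<in> generic_span hs \<xi>" "divisible hs (\<lambda>u. B u \<xi>)"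
  shows "divisible hs (\<lambda>u. B u x)"
  using assms(1)
proof induction
  case (lower x v)
  have "divisible hs (\<lambda>u. - ((u - (v + e)) *s B v (B u x)))"
    by (intro divisible_minus divisible_linear_factor divisible_lin[OF _ B_lin] lower.IH)
  moreover have "(\<lambda>u. - ((u - (v + e)) *s B v (B u x))) = (\<lambda>u. (u - (v - e)) *s B u (B v x))"
    by (rule ext) (use BB[of _ v x] in \<open>simp add: diff_diff_eq diff_diff_eq2 diff_add_eq\<close>)
  ultimately have "divisible hs (\<lambda>u. (u - (v - e)) *s B u (B v x))" by simp
  then show ?case using lower.hyps(3) by (rule divisible_cancel_linear[OF B_polyfun])
qed (use assms(2) in \<open>simp_all add: lin_0[OF B_lin] lin_add[OF B_lin] lin_scale[OF B_lin]
    divisible_0 divisible_add divisible_scale\<close>)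

text \<open>
  Stated for an operator \<open>T\<close> because \<open>A\<close> and \<open>D\<close> satisfy the same relation with \<open>B\<close>.  That \<open>T v x\<close> lies in the
  span is part of the induction, since \<open>B u (T v x)\<close> has to be divisible as well.
\<close>

lemma diagonal_generic_span:
  assumes T: "\<And>u. lin (T u)" "\<And>x. polyfun (\<lambda>u. T u x)"
    and TB: "\<And>u v x. (u - v) *s T u (B v x) = (u - v - e) *s B v (T u x) + e *s B u (T v x)"
    and \<xi>: "\<And>u. T u \<xi> = (f u * root_poly hs u) *s \<xi>" "polyfun (\<lambda>u. f u *s \<xi>)"
    and B: "divisible hs (\<lambda>u. B u \<xi>)"
    and x: "x \<in> generic_span hs \<xi>"
  shows "divisible hs (\<lambda>u. T u x)" "T u x \<in> generic_span hs \<xi>"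
proof -
  have "(\<forall>u. T u x \<in> generic_span hs \<xi>) \<and> divisible hs (\<lambda>u. T u x)"
    using x
  proof induction
    case base
    have "divisible hs (\<lambda>u. T u \<xi>)"
      by (rule divisibleI[OF \<xi>(2)]) (simp add: \<xi>(1) mult.commute)
    then show ?case by (auto simp: \<xi>(1) intro: generic_span.intros)
  next
    case (lower x v)
    have 1: "T u (B v x) \<in> generic_span hs \<xi>" for u
    proof (rule polyfun_in_subspace[OF T(2) subspace_generic_span])
      show "infinite (- {v})" by (rule infinite_Compl_finite) simp
      fix a assume "a \<in> - {v}"
      then have "T a (B v x) = inverse (a - v) *s ((a - v - e) *s B v (T a x) + e *s B a (T v x))"
        by (simp add: TB[symmetric])
      then show "T a (B v x) \<in> generic_span hs \<xi>"
        using lower.IH by (auto intro!: generic_span_B generic_span.add generic_span.scale)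
    qed
    have "divisible hs (\<lambda>u. (u - (v + e)) *s B v (T u x) + e *s B u (T v x))"
      using lower.IH by (intro divisible_add divisible_linear_factor divisible_scale divisible_lin[OF _ B_lin]
          divisible_B[OF _ B]) auto
    then have "divisible hs (\<lambda>u. (u - v) *s T u (B v x))"
      unfolding TB by (simp add: diff_diff_eq)
    with 1 T(2) lower.hyps(2) show ?case by (auto intro: divisible_cancel_linear)
  qed (simp_all add: lin_0[OF T(1)] lin_add[OF T(1)] lin_scale[OF T(1)]
    divisible_0 divisible_add divisible_scale generic_span.intros)
  then show "divisible hs (\<lambda>u. T u x)" "T u x \<in> generic_span hs \<xi>" by auto
qed

text \<open>
  Divisibility of \<open>B u \<xi>\<close> implies that of all four operators on the span of the lowered vectors; their
  quotients have the coprime weights \<open>fs\<close>, \<open>gs\<close>, and \<open>gl11_lowest_vector\<close> applies to them.  The set \<open>W\<close>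
  serves to transport further properties from \<open>\<xi>\<close> to the vector found.
\<close>

theorem gl11_lowest_vector_common_factor:
  assumes "\<xi> \<noteq> 0" 
    and W: "subspace W" "\<xi> \<in> W" "\<And>u y. y \<in> W \<Longrightarrow> B u y \<in> W"
    and A: "\<And>u. A u \<xi> = (root_poly fs u * root_poly hs u) *s \<xi>"
    and D: "\<And>u. D u \<xi> = (root_poly gs u * root_poly hs u) *s \<xi>"
    and C: "\<And>u. C u \<xi> = 0"
    and B: "divisible hs (\<lambda>u. B u \<xi>)"
    and deg: "\<And>x. vpoly (length fs + length hs) (\<lambda>u. B u x)"
    and coprime: "set fs \<inter> set gs = {}"
  shows "\<exists>\<eta>\<in>W. \<eta> \<noteq> 0 \<and> (\<forall>u. A u \<eta> = (root_poly fs (u - e) * root_poly hs u) *s \<eta>)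
    \<and> (\<forall>u. D u \<eta> = (root_poly gs (u - e) * root_poly hs u) *s \<eta>) \<and> (\<forall>u. B u \<eta> = 0)"
proof -
  let ?U = "generic_span hs \<xi>"
  obtain \<pi> where \<pi>: "lin \<pi>" "\<And>x. \<pi> x \<in> ?U" "\<And>x. x \<in> ?U \<Longrightarrow> \<pi> x = x"
    using linear_projection_exists[OF subspace_generic_span] by blast
  note sub = subspace_generic_span[of hs \<xi>]
  note fA = polyfun_root_poly[OF polyfun_const[of \<xi>], of fs]
  note fD = polyfun_root_poly[OF polyfun_const[of \<xi>], of gs]
  note A_U = diagonal_generic_span[OF A_lin A_polyfun AB A fA B]
  note D_U = diagonal_generic_span[OF D_lin D_polyfun DB D fD B]
  have C_U: "(\<forall>u. C u x \<in> ?U) \<and> divisible hs (\<lambda>u. C u x)" if "x \<in> ?U" for x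
    using that
  proof induction
    case (lower x v)
    have 1: "C u (B v x) \<in> ?U" for u
    proof (rule polyfun_in_subspace[OF C_polyfun sub])
      show "infinite (- {v})" by (rule infinite_Compl_finite) simp
      fix a assume "a \<in> - {v}"
      then have "C a (B v x) = inverse (a - v) *s (a - v) *s C a (B v x)" by simp
      also have "\<dots> \<in> ?U"
        unfolding CB using lower.IH lower.hyps(1) sub
        by (intro subspace_scale subspace_add subspace_diff subspace_neg generic_span_B A_U(2) D_U(2)) auto
      finally show "C a (B v x) \<in> ?U" .
    qed
    have "divisible hs (\<lambda>u. - ((u - v) *s B v (C u x)) + e *s (D v (A u x) - D u (A v x)))"
      using lower.IH lower.hyps(1)
      by (intro divisible_add divisible_diff divisible_minus divisible_linear_factor divisible_scale
          divisible_lin[OF _ B_lin] divisible_lin[OF _ D_lin] D_U(1) A_U) auto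
    then have "divisible hs (\<lambda>u. (u - v) *s C u (B v x))" by (simp only: CB)
    with 1 C_polyfun lower.hyps(2) show ?case by (auto intro: divisible_cancel_linear)
  qed (simp_all add: C lin_0[OF C_lin] lin_add[OF C_lin] lin_scale[OF C_lin]
    divisible_0 divisible_add divisible_scale generic_span.intros)
  interpret Q: polynomial_quotient scale hs \<pi> ?U
    by (intro polynomial_quotient.intro polynomial_quotient_axioms.intro complex_vector_space_axioms \<pi> sub)
  have red: "Q.reducible A" "Q.reducible B" "Q.reducible C" "Q.reducible D"
    using A_U generic_span_B divisible_B[OF _ B] C_U D_U
    by (auto simp: Q.reducible_def A_lin B_lin C_lin D_lin)
  note lins = red[THEN Q.quot_lin]
  note polys = red[THEN Q.quot_polyfun]
  note polyfuns = polyfun_diff polyfun_add polyfun_minus polyfun_linear_factors polyfun_scale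
    polyfun_lin[OF _ lins(1)] polyfun_lin[OF _ lins(2)] polyfun_lin[OF _ lins(3)] polyfun_lin[OF _ lins(4)] polys
  note comp = red[THEN Q.quot_compose(1)] red[THEN Q.quot_compose(2)]
  note scales = scale_right_distrib scale_right_diff_distrib scale_minus_right
    scale_left_commute[of "root_poly hs _ * root_poly hs _"]
  interpret R: gl11_operators scale e "Q.quot A" "Q.quot B" "Q.quot C" "Q.quot D"
  proof (intro gl11_operators.intro gl11_operators_axioms.intro complex_vector_space_axioms)
    show "e \<noteq> 0" by (rule e_nonzero)
    fix u v x
    have "(u - v + e) *s Q.quot B u (Q.quot B v x) - - ((u - v - e) *s Q.quot B v (Q.quot B u x)) = 0"
      by (rule Q.quot_relation, (rule polyfuns)+) (simp only: scales comp red, simp only: BB, simp)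
    then show "(u - v + e) *s Q.quot B u (Q.quot B v x) = - ((u - v - e) *s Q.quot B v (Q.quot B u x))"
      by (simp only: right_minus_eq)
    have "(u - v) *s Q.quot A u (Q.quot B v x)
       - ((u - v - e) *s Q.quot B v (Q.quot A u x) + e *s Q.quot B u (Q.quot A v x)) = 0"
      by (rule Q.quot_relation, (rule polyfuns)+) (simp only: scales comp red, simp only: AB, simp)
    then show "(u - v) *s Q.quot A u (Q.quot B v x)
       = (u - v - e) *s Q.quot B v (Q.quot A u x) + e *s Q.quot B u (Q.quot A v x)"
      by (simp only: right_minus_eq)
    have "(u - v) *s Q.quot D u (Q.quot B v x)
       - ((u - v - e) *s Q.quot B v (Q.quot D u x) + e *s Q.quot B u (Q.quot D v x)) = 0"
      by (rule Q.quot_relation, (rule polyfuns)+) (simp only: scales comp red, simp only: DB, simp)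
    then show "(u - v) *s Q.quot D u (Q.quot B v x)
       = (u - v - e) *s Q.quot B v (Q.quot D u x) + e *s Q.quot B u (Q.quot D v x)"
      by (simp only: right_minus_eq)
    have "(u - v) *s Q.quot C u (Q.quot B v x)
       - (- ((u - v) *s Q.quot B v (Q.quot C u x)) + e *s (Q.quot D v (Q.quot A u x) - Q.quot D u (Q.quot A v x))) = 0"
      by (rule Q.quot_relation, (rule polyfuns)+) (simp only: scales comp red, simp only: CB, simp add: scales)
    then show "(u - v) *s Q.quot C u (Q.quot B v x)
       = - ((u - v) *s Q.quot B v (Q.quot C u x)) + e *s (Q.quot D v (Q.quot A u x) - Q.quot D u (Q.quot A v x))"
      by (simp only: right_minus_eq)
  qed (fact lins polys)+
  have piW: "\<pi> \<xi> = \<xi>" by (rule \<pi>(3)[OF generic_span.base])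
  have "\<exists>\<eta>\<in>?U. \<eta> \<noteq> 0 \<and> (\<forall>u. Q.quot A u \<eta> = root_poly fs (u - e) *s \<eta>)
    \<and> (\<forall>u. Q.quot D u \<eta> = root_poly gs (u - e) *s \<eta>) \<and> (\<forall>u. Q.quot B u \<eta> = 0)"
  proof (rule R.gl11_lowest_vector)
    show "\<xi> \<noteq> 0" "\<xi> \<in> ?U" "set fs \<inter> set gs = {}" by (fact assms generic_span.base)+
    show "Q.quot B u y \<in> ?U" for u y by (rule Q.quot_in[OF red(2)])
    show "Q.quot A u \<xi> = root_poly fs u *s \<xi>" for u
      by (rule Q.quot_eqI[OF red(1) fA]) (simp add: A piW mult.commute)
    show "Q.quot D u \<xi> = root_poly gs u *s \<xi>" for u
      by (rule Q.quot_eqI[OF red(4) fD]) (simp add: D piW mult.commute)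
    show "Q.quot C u \<xi> = 0" for u
      by (rule Q.quot_eqI[OF red(3) polyfun_const]) (simp add: C piW)
    show "vpoly (length fs) (\<lambda>u. Q.quot B u x)" for x
      using root_poly_factor_degree[OF deg polys(2) Q.quot_mult[OF red(2), symmetric]] by simp
  qed
  then obtain \<eta> where \<eta>: "\<eta> \<in> ?U" "\<eta> \<noteq> 0" "\<And>u. Q.quot A u \<eta> = root_poly fs (u - e) *s \<eta>"
    "\<And>u. Q.quot D u \<eta> = root_poly gs (u - e) *s \<eta>" "\<And>u. Q.quot B u \<eta> = 0" by blast
  have "A u \<eta> = (root_poly fs (u - e) * root_poly hs u) *s \<eta>" "B u \<eta> = 0"
    "D u \<eta> = (root_poly gs (u - e) * root_poly hs u) *s \<eta>" for u
    using red(1,2,4)[THEN Q.quot_mult, of u \<eta>] by (simp_all add: \<pi>(3)[OF \<eta>(1)] \<eta>(3-5) mult.commute)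
  moreover have "\<eta> \<in> W" by (rule generic_span_minimal[OF \<eta>(1) W])
  ultimately show ?thesis using \<eta>(2) by blast
qed

end

section \<open>Words in the generators and the height operator\<close>

context complex_vector_space
begin

fun shifted_powers :: "('v \<Rightarrow> 'v) \<Rightarrow> complex \<Rightarrow> nat \<Rightarrow> 'v \<Rightarrow> 'v" where
  "shifted_powers E e 0 y = y"
| "shifted_powers E e (Suc m) y = E (shifted_powers E e m y) - (e + of_nat (Suc m)) *s shifted_powers E e m y"

text \<open>
  If \<open>E\<close> is diagonalizable with eigenvalues \<open>e\<close>, \<open>e + 1\<close>, \<open>e + 2\<close> and so on, this is the sum of the
  eigenspaces for \<open>e + n\<close> with \<open>n \<ge> 1\<close>.  Annihilation by a product of the \<open>E - (e + n)\<close> describes it without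
  a choice of components.
\<close>

definition higher_part :: "('v \<Rightarrow> 'v) \<Rightarrow> complex \<Rightarrow> 'v set"
  where "higher_part E e = {y. \<exists>m. shifted_powers E e m y = 0}"

lemma shifted_powers_lin: "lin E \<Longrightarrow> lin (shifted_powers E e m)"
proof (induction m)
  case 0
  then show ?case by (auto intro: linI)
next
  case (Suc m)
  then have IH: "lin (shifted_powers E e m)" by simp
  show ?case
    by (rule linI)
      (simp_all add: lin_add[OF IH] lin_scale[OF IH] lin_add[OF Suc.prems] lin_scale[OF Suc.prems]
        scale_right_distrib scale_right_diff_distrib mult.commute)
qed

lemma shifted_powers_eigenvector:
  assumes "lin E" "E y = \<mu> *s y"
  shows "shifted_powers E e m y = (\<Prod>n=1..m. \<mu> - e - of_nat n) *s y"
proof (induction m)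
  case (Suc m)
  have "E (shifted_powers E e m y) = (\<mu> * (\<Prod>n=1..m. \<mu> - e - of_nat n)) *s y"
    by (simp add: Suc lin_scale[OF assms(1)] assms(2) mult.commute)
  then show ?case by (simp add: Suc scale_left_diff_distrib[symmetric] algebra_simps)
qed simp

lemma shifted_powers_mono:
  assumes "lin E" "shifted_powers E e m y = 0" "m \<le> n"
  shows "shifted_powers E e n y = 0"
  using assms(3) by (induction rule: dec_induct) (simp_all add: assms(2) lin_0[OF assms(1)])

lemma subspace_higher_part:
  assumes "lin E"
  shows "subspace (higher_part E e)"
proof (rule subspaceI)
  note l = shifted_powers_lin[OF assms]
  show "0 \<in> higher_part E e" by (auto simp: higher_part_def lin_0[OF l])
  show "x + y \<in> higher_part E e" if xy: "x \<in> higher_part E e" "y \<in> higher_part E e" for x y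
  proof -
    obtain m n where "shifted_powers E e m x = 0" "shifted_powers E e n y = 0"
      using xy by (auto simp: higher_part_def)
    then have "shifted_powers E e (max m n) (x + y) = 0"
      using shifted_powers_mono[OF assms] by (simp add: lin_add[OF l])
    then show ?thesis by (auto simp: higher_part_def)
  qed
  show "c *s x \<in> higher_part E e" if "x \<in> higher_part E e" for c x
    using that by (auto simp: higher_part_def lin_scale[OF l])
qed

lemma eigenvector_in_higher_part:
  assumes "lin E" "E y = (e + of_nat n) *s y" "n \<ge> 1"
  shows "y \<in> higher_part E e"
proof -
  have "(\<Prod>k=1..n. e + of_nat n - e - of_nat k) = (0::complex)"
    by (rule prod_zero) (use assms(3) in auto)
  then have "shifted_powers E e n y = 0" by (simp add: shifted_powers_eigenvector[OF assms(1,2)])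
  then show ?thesis by (auto simp: higher_part_def)
qed

text \<open>
  A product of operators \<open>E - (e + n)\<close> that annihilates \<open>y\<close> multiplies \<open>\<xi>\<close> by a nonzero number.
\<close>

lemma subspace_contains_lowest_eigenvector:
  assumes E: "lin E" and W: "subspace W" "\<And>y. y \<in> W \<Longrightarrow> E y \<in> W"
    and \<xi>: "E \<xi> = e *s \<xi>" and y: "y \<in> higher_part E e" and "c *s \<xi> + y \<in> W" "c \<noteq> 0"
  shows "\<xi> \<in> W"
proof -
  obtain m where "shifted_powers E e m y = 0" using y by (auto simp: higher_part_def)
  define d :: complex where "d = (\<Prod>n=1..m. e - e - of_nat n)"
  have "d \<noteq> 0" by (simp add: d_def)
  have "shifted_powers E e m x \<in> W" if "x \<in> W" for x
    by (induction m) (use that W in \<open>auto intro: subspace_diff subspace_scale\<close>)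
  then have "shifted_powers E e m (c *s \<xi> + y) \<in> W" using assms(6) .
  then have "c *s d *s \<xi> \<in> W"
    using \<open>shifted_powers E e m y = 0\<close>
    by (simp only: lin_add[OF shifted_powers_lin[OF E]] lin_scale[OF shifted_powers_lin[OF E]]
        shifted_powers_eigenvector[OF E \<xi>] add_0_right d_def)
  from subspace_scale[OF W(1) this, of "inverse (c * d)"] show ?thesis
    using assms(7) \<open>d \<noteq> 0\<close> by (simp add: mult.commute mult.left_commute)
qed

lemma lowest_eigenvector_notin_higher_part:
  assumes "lin E" "E \<xi> = e *s \<xi>" "\<xi> \<noteq> 0"
  shows "\<xi> \<notin> higher_part E e"
  using assms by (auto simp: higher_part_def shifted_powers_eigenvector)

end

definition word_degree :: "gen list \<Rightarrow> nat"
  where "word_degree w = (\<Sum>(a, b, r)\<leftarrow>w. r)"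

lemma word_degree_simps [simp]:
  "word_degree [] = 0" "word_degree ((a, b, r) # w) = r + word_degree w"
  "word_degree (v @ w) = word_degree v + word_degree w"
  by (simp_all add: word_degree_def)

text \<open>
  Representations of the algebra of level \<open>p\<close>.  The operators \<open>t a b 0\<close> are constants, as in the expansion
  of \<open>t\<^sub>a\<^sub>b(u)\<close>, and \<open>t_rel\<close> is a coefficient of the defining relation multiplied by \<open>u - v\<close>.
\<close>

locale level_representation = complex_vector_space scale
  for scale :: "complex \<Rightarrow> 'v::ab_group_add \<Rightarrow> 'v" (infixr \<open>*s\<close> 75) +
  fixes N :: nat and s :: "nat \<Rightarrow> nat" and p :: nat and t :: "nat \<Rightarrow> nat \<Rightarrow> nat \<Rightarrow> 'v \<Rightarrow> 'v"
  assumes t_lin: "lin (t a b r)"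
    and t_0: "t a b 0 x = (if a = b then x else 0)"
    and t_level: "a \<in> {1..N} \<Longrightarrow> b \<in> {1..N} \<Longrightarrow> p < r \<Longrightarrow> t a b r x = 0"
    and t_rel: "i \<in> {1..N} \<Longrightarrow> j \<in> {1..N} \<Longrightarrow> k \<in> {1..N} \<Longrightarrow> l \<in> {1..N} \<Longrightarrow>
      (t i j (r + 1) (t k l q x) - (- 1) ^ ((s i + s j) * (s k + s l)) *s t k l q (t i j (r + 1) x))
      - (t i j r (t k l (q + 1) x) - (- 1) ^ ((s i + s j) * (s k + s l)) *s t k l (q + 1) (t i j r x))
      = (- 1) ^ (s i * s j + s i * s k + s j * s k) *s (t k j r (t i l q x) - t k j q (t i l r x))"
begin

lemmas t_add = lin_add[OF t_lin] and t_scale = lin_scale[OF t_lin] and t_zero = lin_0[OF t_lin]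
  and t_diff = lin_diff[OF t_lin] and t_sum = lin_sum[OF t_lin]

definition bracket :: "nat \<Rightarrow> nat \<Rightarrow> nat \<Rightarrow> nat \<Rightarrow> nat \<Rightarrow> nat \<Rightarrow> 'v \<Rightarrow> 'v"
  where "bracket i j r k l q x
    = t i j r (t k l q x) - (- 1) ^ ((s i + s j) * (s k + s l)) *s t k l q (t i j r x)"

lemma bracket_0: "bracket i j 0 k l q x = 0" "bracket i j r k l 0 x = 0"
  by (auto simp: bracket_def t_0 t_zero)

lemma bracket_rel:
  assumes "i \<in> {1..N}" "j \<in> {1..N}" "k \<in> {1..N}" "l \<in> {1..N}"
  shows "bracket i j (r + 1) k l q x - bracket i j r k l (q + 1) x
    = (- 1) ^ (s i * s j + s i * s k + s j * s k) *s (t k j r (t i l q x) - t k j q (t i l r x))"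
  unfolding bracket_def by (rule t_rel[OF assms])

text \<open>
  The commutator with \<open>t\<^sub>j\<^sub>j\<^sup>(\<^sup>1\<^sup>)\<close> multiplies \<open>t\<^sub>k\<^sub>l\<^sup>(\<^sup>q\<^sup>)\<close> by \<open>\<plusminus>(\<delta>\<^sub>j\<^sub>k - \<delta>\<^sub>j\<^sub>l)\<close>.  With the coefficients \<open>\<plusminus>j\<close> the sum
  adds \<open>k - l\<close>, so \<open>E\<close> grades a highest weight module by height, with the highest vector at the bottom.
\<close>

definition E :: "'v \<Rightarrow> 'v"
  where "E x = (\<Sum>j = 1..N. (of_nat j * (- 1) ^ s j) *s t j j 1 x)"

lemma E_lin: "lin E"
  by (rule linI)
    (simp_all add: E_def t_add t_scale scale_right_distrib sum.distrib scale_sum_right mult.commute)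

lemma bracket_diagonal:
  assumes "j \<in> {1..N}" "k \<in> {1..N}" "l \<in> {1..N}"
  shows "(- 1) ^ s j *s t j j 1 (t k l q x) - (- 1) ^ s j *s t k l q (t j j 1 x)
    = (if j = k then t k l q x else 0) - (if j = l then t k l q x else 0)"
proof -
  have "even ((s j + s j) * (s k + s l))" by simp
  then have b: "bracket j j 1 k l q x = t j j 1 (t k l q x) - t k l q (t j j 1 x)"
    unfolding bracket_def by (simp only: neg_one_even_power scale_one)
  have "s j * s j + s j * s k + s j * s k = s j * s j + 2 * (s j * s k)" by simp
  then have sign: "(- 1 :: complex) ^ (s j * s j + s j * s k + s j * s k) = (- 1) ^ s j"
    by (simp add: power_add power_mult) (simp add: minus_one_power_iff)
  have *: "t j j 1 (t k l q x) - t k l q (t j j 1 x) = (- 1) ^ s j *s (t k j 0 (t j l q x) - t k j q (t j l 0 x))"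
    using bracket_rel[OF assms(1,1,2,3), of 0 q x, unfolded sign] b by (simp add: bracket_0)
  have "(- 1) ^ s j *s t j j 1 (t k l q x) - (- 1) ^ s j *s t k l q (t j j 1 x)
      = ((- 1) ^ s j * (- 1) ^ s j) *s (t k j 0 (t j l q x) - t k j q (t j l 0 x))"
    unfolding scale_right_diff_distrib[symmetric] * by simp
  also have "(- 1) ^ s j * (- 1) ^ s j = (1::complex)"
    by (simp flip: power_mult_distrib)
  finally show ?thesis by (simp add: t_0 t_zero)
qed

lemma E_t:
  assumes "k \<in> {1..N}" "l \<in> {1..N}"
  shows "E (t k l q x) = t k l q (E x) + (of_nat k - of_nat l) *s t k l q x"
proof -
  have "E (t k l q x) - t k l q (E x)
      = (\<Sum>j = 1..N. of_nat j *s ((- 1) ^ s j *s t j j 1 (t k l q x) - (- 1) ^ s j *s t k l q (t j j 1 x)))"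
    by (simp add: E_def t_sum t_scale sum_subtractf scale_right_diff_distrib)
  also have "\<dots> = (\<Sum>j = 1..N. (if j = k then of_nat k *s t k l q x else 0) - (if j = l then of_nat l *s t k l q x else 0))"
    by (rule sum.cong[OF refl], subst bracket_diagonal[OF _ assms]) auto
  also have "\<dots> = (of_nat k - of_nat l) *s t k l q x"
    using assms by (simp add: sum_subtractf scale_left_diff_distrib)
  finally show ?thesis by (simp add: algebra_simps)
qed

definition act :: "gen list \<Rightarrow> 'v \<Rightarrow> 'v"
  where "act w x = foldr (\<lambda>(a, b, r). t a b r) w x"

lemma act_simps [simp]: "act [] x = x" "act ((a, b, r) # w) x = t a b r (act w x)"
  "act (v @ w) x = act v (act w x)"
  by (simp_all add: act_def)

lemma act_lin: "lin (act w)"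
  by (induction w) (auto intro!: linI simp: t_add t_scale lin_add lin_scale)

definition cyc :: "'v \<Rightarrow> 'v set"
  where "cyc x = span {act w x | w. set w \<subseteq> gens N}"

text \<open>
  The filtration by the sum of the upper indices.  Its use is that brackets lower the degree by one.
\<close>

definition bounded_span :: "nat \<Rightarrow> 'v \<Rightarrow> 'v set"
  where "bounded_span d x = span {act w x | w. set w \<subseteq> gens N \<and> word_degree w \<le> d}"

lemma act_in_bounded_span: "set w \<subseteq> gens N \<Longrightarrow> word_degree w \<le> d \<Longrightarrow> act w x \<in> bounded_span d x"
  unfolding bounded_span_def by (rule span_base) auto

lemma subspace_bounded_span: "subspace (bounded_span d x)"
  by (simp add: bounded_span_def)

lemma bounded_span_mono: "d \<le> d' \<Longrightarrow> bounded_span d x \<subseteq> bounded_span d' x"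
  unfolding bounded_span_def by (rule span_mono) auto

lemma span_induct_lin:
  assumes "y \<in> span S" "lin f" "subspace U" "\<And>z. z \<in> S \<Longrightarrow> f z \<in> U"
  shows "f y \<in> U"
  using assms(1)
  by (induction rule: span_induct_alt)
    (use assms(2-) in \<open>auto simp: lin_0 lin_add lin_scale subspace_0 subspace_add subspace_scale\<close>)

lemma act_bounded_span:
  assumes "y \<in> bounded_span d x" "set v \<subseteq> gens N" "word_degree v + d \<le> d'"
  shows "act v y \<in> bounded_span d' x"
  by (rule span_induct_lin[OF assms(1)[unfolded bounded_span_def] act_lin subspace_bounded_span])
    (use assms(2,3) act_in_bounded_span[of "v @ _"] in force)

lemma t_bounded_span:
  assumes "y \<in> bounded_span d x" "a \<in> {1..N}" "b \<in> {1..N}" "r + d \<le> d'"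
  shows "t a b r y \<in> bounded_span d' x"
proof (cases "r = 0")
  case True
  then show ?thesis using assms bounded_span_mono[of d d' x] subspace_bounded_span[of d' x]
    by (auto simp: t_0 subspace_0)
next
  case False
  then show ?thesis using act_bounded_span[OF assms(1), of "[(a, b, r)]" d'] assms
    by (auto simp: gens_def)
qed

text \<open>
  The relation moves one unit from \<open>r\<close> to \<open>q\<close> at the price of products of total degree \<open>r + q\<close>, and the bracket
  vanishes once the first index is 0.
\<close>

lemma bracket_bounded_span:
  assumes ijkl: "i \<in> {1..N}" "j \<in> {1..N}" "k \<in> {1..N}" "l \<in> {1..N}" and w: "set w \<subseteq> gens N"
  shows "bracket i j r k l q (act w x) \<in> bounded_span (r + q - 1 + word_degree w) x"
proof (induction r arbitrary: q)
  case 0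
  then show ?case by (simp add: bracket_0 subspace_0 subspace_bounded_span)
next
  case (Suc r)
  let ?W = "bounded_span (r + q + word_degree w) x"
  have tt: "t k j a (t i l b (act w x)) \<in> ?W" if "a + b = r + q" for a b
    by (rule t_bounded_span[OF t_bounded_span[OF act_in_bounded_span[OF w order_refl] ijkl(1,4) order_refl] ijkl(3,2)])
      (use that in simp)
  have "bracket i j (Suc r) k l q (act w x) = bracket i j r k l (q + 1) (act w x)
    + (- 1) ^ (s i * s j + s i * s k + s j * s k) *s (t k j r (t i l q (act w x)) - t k j q (t i l r (act w x)))"
    using bracket_rel[OF ijkl, of r q "act w x"] by (simp add: algebra_simps)
  also have "\<dots> \<in> ?W"
    using Suc[of "q + 1"] tt subspace_bounded_span by (auto intro!: subspace_add subspace_scale subspace_diff)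
  finally show ?case by simp
qed

text \<open>
  These vectors need not be eigenvectors of the diagonal generators; the remainders that occur in
  \<open>reflected_vector_exists\<close> are of this kind.
\<close>

definition singular :: "'v \<Rightarrow> bool"
  where "singular x \<longleftrightarrow> (\<forall>a b r. a \<in> {1..N} \<longrightarrow> b \<in> {1..N} \<longrightarrow> a < b \<longrightarrow> t a b r x = 0)"

text \<open>
  The raising generator is moved to the right until it meets \<open>x\<close>; only brackets remain.
\<close>

lemma raising_lowers_degree:
  assumes x: "singular x" and ab: "a \<in> {1..N}" "b \<in> {1..N}" "a < b" "r \<ge> 1" and w: "set w \<subseteq> gens N"
  shows "t a b r (act w x) \<in> bounded_span (r + word_degree w - 1) x"
  using w
proof (induction w)
  case Nil
  then show ?case using x ab by (simp add: singular_def subspace_0 subspace_bounded_span)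
next
  case (Cons g w)
  obtain k l q where g: "g = (k, l, q)" by (cases g)
  then have kl: "k \<in> {1..N}" "l \<in> {1..N}" "q \<ge> 1" and w: "set w \<subseteq> gens N"
    using Cons.prems by (auto simp: gens_def)
  have "t a b r (act (g # w) x) = bracket a b r k l q (act w x)
     + (- 1) ^ ((s a + s b) * (s k + s l)) *s t k l q (t a b r (act w x))"
    by (simp add: g bracket_def)
  moreover have "bracket a b r k l q (act w x) \<in> bounded_span (r + word_degree (g # w) - 1) x"
    using bracket_bounded_span[OF ab(1,2) kl(1,2) w, of r q] ab(4) kl(3) g by (simp add: algebra_simps)
  moreover have "t k l q (t a b r (act w x)) \<in> bounded_span (r + word_degree (g # w) - 1) x"
    by (rule t_bounded_span[OF Cons.IH[OF w] kl(1,2)]) (use ab(4) g in simp)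
  ultimately show ?case by (simp add: subspace_bounded_span subspace_add subspace_scale)
qed

text \<open>
  A word with a raising letter acts on \<open>x\<close> like a combination of words of smaller degree, so induction
  on the degree removes all raising letters.
\<close>

lemma bounded_span_nonraising:
  assumes x: "singular x"
  shows "bounded_span d x \<subseteq> span {act w x | w. set w \<subseteq> gens N \<and> (\<forall>(a, b, r) \<in> set w. b \<le> a)}" (is "_ \<subseteq> ?S")
proof (induction d rule: less_induct)
  case (less d)
  have "act w x \<in> ?S" if w: "set w \<subseteq> gens N" "word_degree w \<le> d" for w
  proof (cases "\<forall>(a, b, r) \<in> set w. b \<le> a")
    case True
    with w show ?thesis by (intro span_base) auto
  next
    case False
    then obtain a b r where abr: "(a, b, r) \<in> set w" "a < b" by auto
    then obtain w1 w2 where w12: "w = w1 @ (a, b, r) # w2" by (meson split_list)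
    have ab: "a \<in> {1..N}" "b \<in> {1..N}" "r \<ge> 1" using abr w by (auto simp: gens_def)
    have "act w x = act w1 (t a b r (act w2 x))" by (simp add: w12)
    also have "\<dots> \<in> bounded_span (d - 1) x"
      by (rule act_bounded_span[OF raising_lowers_degree[OF x ab(1,2) abr(2) ab(3)]])
        (use w w12 ab(3) in auto)
    also have "\<dots> \<subseteq> ?S" using less[of "d - 1"] w(2) w12 ab(3) by simp
    finally show ?thesis .
  qed
  then show ?case unfolding bounded_span_def by (intro span_minimal) auto
qed

lemma cyc_nonraising:
  assumes x: "singular x"
  shows "cyc x \<subseteq> span {act w x | w. set w \<subseteq> gens N \<and> (\<forall>(a, b, r) \<in> set w. b \<le> a)}" (is "_ \<subseteq> ?S")
  unfolding cyc_def
proof (rule span_minimal)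
  show "{act w x |w. set w \<subseteq> gens N} \<subseteq> ?S"
    using bounded_span_nonraising[OF x] act_in_bounded_span[OF _ order_refl, of _ x] by blast
qed simp

lemma E_act_nonraising:
  assumes "E x = e *s x" "set w \<subseteq> gens N" "\<forall>(a, b, r) \<in> set w. b \<le> a"
  shows "\<exists>n. E (act w x) = (e + of_nat n) *s act w x \<and> (n = 0 \<longrightarrow> (\<forall>(a, b, r) \<in> set w. a = b))"
  using assms(2,3)
proof (induction w)
  case Nil
  show ?case using assms(1) by (intro exI[of _ 0]) simp
next
  case (Cons g w)
  then obtain n where n: "E (act w x) = (e + of_nat n) *s act w x" "n = 0 \<longrightarrow> (\<forall>(a, b, r) \<in> set w. a = b)"
    by auto
  obtain k l q where g: "g = (k, l, q)" by (cases g)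
  then have kl: "k \<in> {1..N}" "l \<in> {1..N}" "l \<le> k"
    using Cons.prems by (auto simp: gens_def)
  have "E (act (g # w) x) = (e + of_nat (n + (k - l))) *s act (g # w) x"
    using kl(3) by (simp add: g E_t[OF kl(1,2)] n t_scale scale_left_distrib[symmetric] of_nat_diff)
  then show ?case using n(2) g kl(3) by (intro exI[of _ "n + (k - l)"]) auto
qed

text \<open>
  Words without raising letters do not decrease the eigenvalue of \<open>E\<close>.  Hence such an \<open>x\<close> cannot generate a
  vector of eigenvalue \<open>e\<close>.
\<close>

lemma cyc_singular_in_higher_part:
  assumes "singular x" "E x = (e + 1) *s x"
  shows "cyc x \<subseteq> higher_part E e"
proof -
  have "act w x \<in> higher_part E e" if w: "set w \<subseteq> gens N" "\<forall>(a, b, r) \<in> set w. b \<le> a" for w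
  proof -
    obtain n where "E (act w x) = (e + 1 + of_nat n) *s act w x"
      using E_act_nonraising[OF assms(2) w] by blast
    then show ?thesis by (intro eigenvector_in_higher_part[OF E_lin, of _ _ "Suc n"]) (simp_all add: add.assoc)
  qed
  then have "span {act w x | w. set w \<subseteq> gens N \<and> (\<forall>(a, b, r) \<in> set w. b \<le> a)} \<subseteq> higher_part E e"
    by (intro span_minimal subspace_higher_part[OF E_lin]) auto
  with cyc_nonraising[OF assms(1)] show ?thesis by blast
qed

text \<open>
  Among the words without raising letters only those with all letters diagonal preserve the eigenvalue
  of \<open>E\<close>, and they act on \<open>\<xi>\<close> by scalars.
\<close>

lemma cyc_highest_vector:
  assumes "singular \<xi>" "E \<xi> = e *s \<xi>"
    and diag: "\<And>j r. j \<in> {1..N} \<Longrightarrow> \<exists>c. t j j r \<xi> = c *s \<xi>"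
    and "x \<in> cyc \<xi>"
  shows "\<exists>c. \<exists>y\<in>higher_part E e. x = c *s \<xi> + y"
proof -
  let ?H = "{c *s \<xi> + y | c y. y \<in> higher_part E e}"
  note sub = subspace_higher_part[OF E_lin, of e]
  have H: "?H = {a + y | a y. a \<in> span {\<xi>} \<and> y \<in> higher_part E e}"
    by (auto simp: span_singleton)
  have "subspace ?H" unfolding H by (rule subspace_sums[OF subspace_span sub])
  moreover have "act w \<xi> \<in> ?H" if w: "set w \<subseteq> gens N" "\<forall>(a, b, r) \<in> set w. b \<le> a" for w
  proof -
    obtain n where n: "E (act w \<xi>) = (e + of_nat n) *s act w \<xi>" "n = 0 \<longrightarrow> (\<forall>(a, b, r) \<in> set w. a = b)"
      using E_act_nonraising[OF assms(2) w] by blast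
    show ?thesis
    proof (cases "n = 0")
      case True
      with n(2) have "\<forall>(a, b, r) \<in> set w. a = b" by blast
      with w(1) have "\<exists>c. act w \<xi> = c *s \<xi>"
      proof (induction w)
        case Nil
        show ?case by (intro exI[of _ 1]) simp
      next
        case (Cons g w)
        obtain a r where g: "g = (a, a, r)" using Cons.prems by (cases g) auto
        with Cons.prems have "a \<in> {1..N}" by (auto simp: gens_def)
        with diag[of a r] Cons g show ?case by (auto simp: t_scale)
      qed
      then obtain c where "act w \<xi> = c *s \<xi> + 0" by auto
      with subspace_0[OF sub] show ?thesis by blast
    next
      case False
      then have "act w \<xi> \<in> higher_part E e"
        by (intro eigenvector_in_higher_part[OF E_lin n(1)]) simp
      moreover have "act w \<xi> = 0 *s \<xi> + act w \<xi>" by simp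
      ultimately show ?thesis by blast
    qed
  qed
  ultimately have "span {act w \<xi> | w. set w \<subseteq> gens N \<and> (\<forall>(a, b, r) \<in> set w. b \<le> a)} \<subseteq> ?H"
    by (intro span_minimal) auto
  then show ?thesis using cyc_nonraising[OF assms(1)] assms(4) by blast
qed

end

section \<open>The highest vector of the reflected parity sequence\<close>

context level_representation
begin

definition T :: "nat \<Rightarrow> nat \<Rightarrow> complex \<Rightarrow> 'v \<Rightarrow> 'v"
  where "T a b u x = (\<Sum>d\<le>p. u ^ d *s t a b (p - d) x)"

lemma T_lin: "lin (T a b u)"
  by (rule linI) (simp_all add: T_def t_add t_scale scale_right_distrib sum.distrib scale_sum_right mult.commute)

lemma T_vpoly: "vpoly (Suc p) (\<lambda>u. T a b u x)"
  using vpoly_sum_powers[of "Suc p" "\<lambda>d. t a b (p - d) x"] unfolding T_def lessThan_Suc_atMost .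

lemma T_polyfun: "polyfun (\<lambda>u. T a b u x)"
  using T_vpoly by (rule polyfunI)

lemma T_vpoly_offdiagonal: "a \<noteq> b \<Longrightarrow> vpoly p (\<lambda>u. T a b u x)"
  using vpoly_sum_powers[of p "\<lambda>d. t a b (p - d) x"]
  by (simp add: T_def lessThan_Suc_atMost[symmetric] t_0)

lemma T_coefficients:
  assumes "\<And>u. T a b u x = (\<Sum>d\<le>p. u ^ d *s c d)" "r \<le> p"
  shows "t a b r x = c (p - r)"
proof -
  have "(\<Sum>d<Suc p. u ^ d *s (t a b (p - d) x - c d)) = 0" for u
    using assms(1)[of u] by (simp add: T_def lessThan_Suc_atMost scale_right_diff_distrib sum_subtractf)
  from sum_powers_eq_0[OF this, of "p - r"] assms(2) show ?thesis by simp
qed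

lemma T_eq_0_iff:
  assumes "a \<in> {1..N}" "b \<in> {1..N}"
  shows "(\<forall>u. T a b u x = 0) \<longleftrightarrow> (\<forall>r. t a b r x = 0)"
proof
  assume "\<forall>u. T a b u x = 0"
  then have "t a b r x = 0" if "r \<le> p" for r
    using T_coefficients[of a b x "\<lambda>d. 0", OF _ that] by simp
  with t_level[OF assms] show "\<forall>r. t a b r x = 0" by (metis not_le)
qed (simp add: T_def)

text \<open>
  The reason why an index shift in the coefficients becomes multiplication by \<open>u\<close>: nothing is lost at
  either end of the sum.
\<close>

lemma sum_shift:
  assumes "f 0 = 0" "f (Suc p) = 0"
  shows "(\<Sum>d\<le>p. u ^ d *s f (Suc (p - d))) = u *s (\<Sum>d\<le>p. u ^ d *s f (p - d))"
proof -
  have "(\<Sum>d\<le>p. u ^ d *s f (Suc (p - d))) = (\<Sum>d<p. u ^ Suc d *s f (Suc (p - Suc d)))"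
    using assms(2) by (cases p) (simp_all add: sum.atMost_Suc_shift lessThan_Suc_atMost del: sum.atMost_Suc)
  also have "\<dots> = (\<Sum>d<p. u *s u ^ d *s f (p - d))"
    by (rule sum.cong) (simp_all add: Suc_diff_Suc)
  also have "\<dots> = u *s (\<Sum>d\<le>p. u ^ d *s f (p - d))"
    using assms(1) by (simp add: scale_sum_right lessThan_Suc_atMost[symmetric])
  finally show ?thesis .
qed

lemma T_T: "T a b u (T c d v x) = (\<Sum>m\<le>p. \<Sum>n\<le>p. (u ^ m * v ^ n) *s t a b (p - m) (t c d (p - n) x))"
  by (simp add: T_def t_sum t_scale scale_sum_right)

text \<open>
  The coefficients of the relation are summed against \<open>u ^ m * v ^ n\<close>.  The brackets vanish at index 0 and
  above the level, so \<open>sum_shift\<close> turns the shifts of \<open>r\<close> and \<open>q\<close> into factors \<open>u\<close> and \<open>v\<close>.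
\<close>

lemma T_rel:
  assumes ijkl: "i \<in> {1..N}" "j \<in> {1..N}" "k \<in> {1..N}" "l \<in> {1..N}"
  shows "(u - v) *s (T i j u (T k l v x) - (- 1) ^ ((s i + s j) * (s k + s l)) *s T k l v (T i j u x))
    = (- 1) ^ (s i * s j + s i * s k + s j * s k) *s (T k j u (T i l v x) - T k j v (T i l u x))"
proof -
  let ?S = "\<lambda>F. \<Sum>m\<le>p. \<Sum>n\<le>p. (u ^ m * v ^ n) *s F (p - m) (p - n)"
  let ?br = "\<lambda>r q. bracket i j r k l q x"
  have "?br (Suc p) q = 0" "?br r (Suc p) = 0" for r q
    using t_level[OF ijkl(1,2), of "Suc p"] t_level[OF ijkl(3,4), of "Suc p"]
    by (simp_all add: bracket_def t_zero)
  with bracket_0 have b0: "?br r 0 = 0" "?br 0 q = 0" "?br (Suc p) q = 0" "?br r (Suc p) = 0" for r q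
    by blast+
  have swap: "T k l v (T i j u x) = ?S (\<lambda>r q. t k l q (t i j r x))"
    unfolding T_T by (subst sum.swap) (simp add: mult.commute)
  have S: "T i j u (T k l v x) - (- 1) ^ ((s i + s j) * (s k + s l)) *s T k l v (T i j u x) = ?S ?br"
    unfolding swap unfolding T_T bracket_def
    by (simp add: sum_subtractf scale_right_diff_distrib scale_sum_right mult.commute mult.left_commute)
  have "?S (\<lambda>r q. ?br (Suc r) q) = (\<Sum>n\<le>p. v ^ n *s (\<Sum>m\<le>p. u ^ m *s ?br (Suc (p - m)) (p - n)))"
    by (subst sum.swap) (simp add: scale_sum_right mult.commute)
  also have "\<dots> = u *s (\<Sum>n\<le>p. v ^ n *s (\<Sum>m\<le>p. u ^ m *s ?br (p - m) (p - n)))"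
    by (subst sum_shift[of "\<lambda>r. ?br r _"]) (simp_all add: b0 scale_sum_right mult.commute mult.left_commute)
  also have "\<dots> = u *s ?S ?br"
    by (subst sum.swap) (simp add: scale_sum_right mult.commute)
  finally have 1: "?S (\<lambda>r q. ?br (Suc r) q) = u *s ?S ?br" .
  have "?S (\<lambda>r q. ?br r (Suc q)) = (\<Sum>m\<le>p. u ^ m *s (\<Sum>n\<le>p. v ^ n *s ?br (p - m) (Suc (p - n))))"
    by (simp add: scale_sum_right)
  also have "\<dots> = v *s ?S ?br"
    by (subst sum_shift[of "\<lambda>q. ?br _ q"]) (simp_all add: b0 scale_sum_right mult.commute mult.left_commute)
  finally have 2: "?S (\<lambda>r q. ?br r (Suc q)) = v *s ?S ?br" .
  have "(u - v) *s ?S ?br = ?S (\<lambda>r q. ?br (Suc r) q - ?br r (Suc q))"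
    unfolding scale_left_diff_distrib 1[symmetric] 2[symmetric]
    by (simp add: sum_subtractf scale_right_diff_distrib)
  also have "\<dots> = ?S (\<lambda>r q. (- 1) ^ (s i * s j + s i * s k + s j * s k) *s (t k j r (t i l q x) - t k j q (t i l r x)))"
    using bracket_rel[OF ijkl] by simp
  also have "\<dots> = (- 1) ^ (s i * s j + s i * s k + s j * s k) *s (?S (\<lambda>r q. t k j r (t i l q x)) - ?S (\<lambda>r q. t k j q (t i l r x)))"
    by (simp add: sum_subtractf scale_right_diff_distrib scale_sum_right mult.commute mult.left_commute)
  also have "?S (\<lambda>r q. t k j r (t i l q x)) = T k j u (T i l v x)" by (simp add: T_T)
  also have "?S (\<lambda>r q. t k j q (t i l r x)) = T k j v (T i l u x)"
    unfolding T_T by (subst sum.swap) (simp add: mult.commute)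
  finally show ?thesis unfolding S .
qed

lemma subspace_cyc: "subspace (cyc x)"
  by (simp add: cyc_def)

lemma cyc_self: "x \<in> cyc x"
  unfolding cyc_def by (rule span_base) (auto intro: exI[of _ "[]"])

lemma t_cyc:
  assumes "y \<in> cyc x" "a \<in> {1..N}" "b \<in> {1..N}"
  shows "t a b r y \<in> cyc x"
proof (cases "r = 0")
  case True
  then show ?thesis using assms(1) subspace_0[OF subspace_cyc] by (simp add: t_0)
next
  case False
  show ?thesis unfolding cyc_def
  proof (rule span_induct_lin[OF assms(1)[unfolded cyc_def] t_lin subspace_span])
    fix z assume "z \<in> {act w x |w. set w \<subseteq> gens N}"
    then obtain w where "z = act w x" "set w \<subseteq> gens N" by blast
    then have "t a b r z = act ((a, b, r) # w) x" "set ((a, b, r) # w) \<subseteq> gens N"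
      using assms(2,3) False by (auto simp: gens_def)
    then show "t a b r z \<in> span {act w x |w. set w \<subseteq> gens N}" by (intro span_base) blast
  qed
qed

lemma T_cyc:
  assumes "y \<in> cyc x" "a \<in> {1..N}" "b \<in> {1..N}"
  shows "T a b u y \<in> cyc x"
  unfolding T_def by (intro subspace_sum[OF subspace_cyc] subspace_scale[OF subspace_cyc] t_cyc assms)

lemma sign_simps:
  assumes "s i + s j = 1"
  shows "(- 1 :: complex) ^ (s i * s i + s i * s j + s i * s j) = (- 1) ^ s i"
    "(- 1 :: complex) ^ (s j * s i + s j * s j + s i * s j) = - ((- 1) ^ s i)"
    "(- 1 :: complex) ^ (s i * s j + s i * s j + s j * s j) = - ((- 1) ^ s i)"
    "(- 1 :: complex) ^ ((s i + s i) * (s j + s i)) = 1"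
    "(- 1 :: complex) ^ ((s j + s i) * (s j + s i)) = - 1"
    "(- 1 :: complex) ^ ((s j + s i) * (s j + s j)) = 1"
    "(- 1 :: complex) ^ ((s i + s j) * (s j + s i)) = - 1"
proof -
  have "s i = 0 \<and> s j = 1 \<or> s i = 1 \<and> s j = 0" using assms by auto
  then show "(- 1 :: complex) ^ (s i * s i + s i * s j + s i * s j) = (- 1) ^ s i"
    "(- 1 :: complex) ^ (s j * s i + s j * s j + s i * s j) = - ((- 1) ^ s i)"
    "(- 1 :: complex) ^ (s i * s j + s i * s j + s j * s j) = - ((- 1) ^ s i)"
    "(- 1 :: complex) ^ ((s i + s i) * (s j + s i)) = 1"
    "(- 1 :: complex) ^ ((s j + s i) * (s j + s i)) = - 1"
    "(- 1 :: complex) ^ ((s j + s i) * (s j + s j)) = 1"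
    "(- 1 :: complex) ^ ((s i + s j) * (s j + s i)) = - 1"
    by auto
qed

lemma gl11_operators_T:
  assumes i: "i \<in> {1..N}" and j: "j \<in> {1..N}" and par: "s i + s j = 1"
  shows "gl11_operators scale ((- 1) ^ s i) (T i i) (T j i) (T i j) (T j j)"
proof (intro gl11_operators.intro gl11_operators_axioms.intro complex_vector_space_axioms T_lin T_polyfun)
  define e :: complex where "e = (- 1) ^ s i"
  note sg = sign_simps[OF par, folded e_def]
  show "(- 1 :: complex) ^ s i \<noteq> 0" by simp
  fix u v x
  show "(u - v) *s T i i u (T j i v x) = (u - v - (- 1) ^ s i) *s T j i v (T i i u x) + (- 1) ^ s i *s T j i u (T i i v x)"
    using T_rel[OF i i j i, of u v x] unfolding sg e_def[symmetric]
    by (simp add: algebra_simps)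
  show "(u - v + (- 1) ^ s i) *s T j i u (T j i v x) = - ((u - v - (- 1) ^ s i) *s T j i v (T j i u x))"
    using T_rel[OF j i j i, of u v x] unfolding sg e_def[symmetric]
    by (simp add: algebra_simps)
  show "(u - v) *s T j j u (T j i v x) = (u - v - (- 1) ^ s i) *s T j i v (T j j u x) + (- 1) ^ s i *s T j i u (T j j v x)"
    using T_rel[OF j i j j, of v u x] unfolding sg e_def[symmetric]
    by (simp add: algebra_simps)
  show "(u - v) *s T i j u (T j i v x) = - ((u - v) *s T j i v (T i j u x)) + (- 1) ^ s i *s (T j j v (T i i u x) - T j j u (T i i v x))"
    using T_rel[OF i j j i, of u v x] unfolding sg e_def[symmetric]
    by (simp add: algebra_simps)
qed

definition highest_vector :: "(nat \<Rightarrow> complex poly) \<Rightarrow> 'v \<Rightarrow> bool"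
  where "highest_vector \<Lambda> \<xi> \<longleftrightarrow> singular \<xi>
    \<and> (\<forall>j\<in>{1..N}. \<forall>u. T j j u \<xi> = poly (\<Lambda> j) u *s \<xi>)"

lemma T_sum_coefficients:
  assumes "T j j u \<xi> = poly q u *s \<xi>" "degree q \<le> p"
  shows "T j j u \<xi> = (\<Sum>d\<le>p. u ^ d *s coeff q d *s \<xi>)"
proof -
  have "poly q u = (\<Sum>d\<le>p. u ^ d * coeff q d)"
    unfolding poly_altdef
    by (rule sum.mono_neutral_cong_left) (use assms(2) in \<open>auto simp: coeff_eq_0 mult.commute\<close>)
  then show ?thesis using assms(1) by (simp add: scale_sum_left)
qed

lemma highest_vector_t:
  assumes "highest_vector \<Lambda> \<xi>" "j \<in> {1..N}" "degree (\<Lambda> j) \<le> p" "r \<le> p"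
  shows "t j j r \<xi> = coeff (\<Lambda> j) (p - r) *s \<xi>"
  by (rule T_coefficients[OF T_sum_coefficients[OF _ assms(3)] assms(4)])
    (use assms(1,2) in \<open>simp add: highest_vector_def\<close>)

lemma highest_vector_diagonal:
  assumes "highest_vector \<Lambda> \<xi>" "j \<in> {1..N}" "degree (\<Lambda> j) \<le> p"
  shows "\<exists>c. t j j r \<xi> = c *s \<xi>"
proof (cases "r \<le> p")
  case True
  then show ?thesis using highest_vector_t[OF assms] by blast
next
  case False
  then show ?thesis using t_level[OF assms(2,2)] by (intro exI[of _ 0]) simp
qed

lemma highest_vector_E:
  assumes "highest_vector \<Lambda> \<xi>" "\<forall>j\<in>{1..N}. degree (\<Lambda> j) \<le> p"
  shows "\<exists>e. E \<xi> = e *s \<xi>"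
proof -
  have "\<forall>j\<in>{1..N}. \<exists>c. t j j 1 \<xi> = c *s \<xi>"
    using highest_vector_diagonal[OF assms(1)] assms(2) by blast
  from bchoice[OF this] obtain c where "\<forall>j\<in>{1..N}. t j j 1 \<xi> = c j *s \<xi>" by blast
  then have "E \<xi> = (\<Sum>j = 1..N. (of_nat j * (- 1) ^ s j * c j)) *s \<xi>"
    by (simp add: E_def scale_sum_left)
  then show ?thesis by blast
qed

lemma root_poly_polyfun_const: "polyfun (\<lambda>u. root_poly vs u *s x)"
  by (rule polyfun_root_poly[OF polyfun_const])

lemma polyfun_poly_const: "polyfun (\<lambda>u. poly q u *s x)"
proof -
  have "(\<lambda>u. poly q u *s x) = (\<lambda>u. \<Sum>d<Suc (degree q). u ^ d *s coeff q d *s x)"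
    by (simp add: poly_altdef lessThan_Suc_atMost scale_sum_left mult.commute del: sum.lessThan_Suc)
  then show ?thesis using polyfunI[OF vpoly_sum_powers] by metis
qed

text \<open>
  The lowered vectors stay in the space \<open>W\<close> of vectors that all raising operators except
  \<open>T i (i + 1)\<close> annihilate and on which \<open>T j j\<close>, for the other \<open>j\<close>, acts as on \<open>\<xi>\<close>.  So the main point is that
  \<open>T (i + 1) i u \<xi>\<close> is divisible by the common factor \<open>hs\<close>.  Its remainder is singular: applied to
  \<open>T (i + 1) i u \<xi>\<close>, the operator \<open>T i (i + 1) w\<close> gives
  \<open>\<plusminus>(\<lambda>\<^sub>i(u) \<lambda>\<^sub>i\<^sub>+\<^sub>1(w) - \<lambda>\<^sub>i(w) \<lambda>\<^sub>i\<^sub>+\<^sub>1(u)) / (w - u)\<close>, and a remainder of degree below that of \<open>hs\<close> which is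
  divisible by \<open>hs\<close> is 0.  Being singular of height one above the bottom, the remainder generates a
  submodule that does not contain \<open>\<xi>\<close>, so it is 0 by irreducibility.
\<close>

theorem reflected_vector_exists:
  assumes i: "i \<in> {1..N}" "i + 1 \<in> {1..N}" and par: "s i + s (i + 1) = 1"
    and "\<xi> \<noteq> 0" and \<xi>: "highest_vector \<Lambda> \<xi>" and deg: "\<forall>j\<in>{1..N}. degree (\<Lambda> j) \<le> p"
    and irr: "\<And>y. y \<in> cyc \<xi> \<Longrightarrow> y \<noteq> 0 \<Longrightarrow> \<xi> \<in> cyc y"
    and \<Lambda>: "\<And>u. poly (\<Lambda> i) u = root_poly fs u * root_poly hs u"
      "\<And>u. poly (\<Lambda> (i + 1)) u = root_poly gs u * root_poly hs u"
    and len: "length fs + length hs = p" and coprime: "set fs \<inter> set gs = {}"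
  obtains \<eta> where "\<eta> \<in> cyc \<xi>" "\<eta> \<noteq> 0"
    "\<forall>a\<in>{1..N}. \<forall>b\<in>{1..N}. a < b \<and> (a, b) \<noteq> (i, i + 1) \<or> (a, b) = (i + 1, i) \<longrightarrow> (\<forall>u. T a b u \<eta> = 0)"
    "\<forall>u. T i i u \<eta> = (root_poly fs (u - (- 1) ^ s i) * root_poly hs u) *s \<eta>"
    "\<forall>u. T (i + 1) (i + 1) u \<eta> = (root_poly gs (u - (- 1) ^ s i) * root_poly hs u) *s \<eta>"
    "\<forall>j\<in>{1..N}. j \<noteq> i \<longrightarrow> j \<noteq> i + 1 \<longrightarrow> (\<forall>u. T j j u \<eta> = poly (\<Lambda> j) u *s \<eta>)"
proof -
  interpret G: gl11_operators scale "(- 1) ^ s i" "T i i" "T (i + 1) i" "T i (i + 1)" "T (i + 1) (i + 1)"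
    by (rule gl11_operators_T[OF i par])
  \<comment> \<open>The positions of the raising operators that have to annihilate the reflected vector as well.\<close>
  define K where "K = {(a, b). a \<in> {1..N} \<and> b \<in> {1..N} \<and> a < b \<and> (a, b) \<noteq> (i, i + 1)}"
  define J where "J = {1..N} - {i, i + 1}"
  define W where "W = {x \<in> cyc \<xi>. (\<forall>a b u. (a, b) \<in> K \<longrightarrow> T a b u x = 0) \<and> (\<forall>j\<in>J. \<forall>u. T j j u x = poly (\<Lambda> j) u *s x)}"
  have raise: "T a b u \<xi> = 0" if "a \<in> {1..N}" "b \<in> {1..N}" "a < b" for a b u
    using \<xi> that T_eq_0_iff[OF that(1,2), of \<xi>] by (simp add: highest_vector_def singular_def)
  have W: "subspace W"
  proof (rule subspaceI)
    show "0 \<in> W" by (auto simp: W_def subspace_0[OF subspace_cyc] lin_0[OF T_lin])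
    show "x + y \<in> W" if "x \<in> W" "y \<in> W" for x y
      using that by (auto simp: W_def subspace_add[OF subspace_cyc] lin_add[OF T_lin] scale_right_distrib)
    show "c *s x \<in> W" if "x \<in> W" for c x
      using that by (auto simp: W_def subspace_scale[OF subspace_cyc] lin_scale[OF T_lin] mult.commute)
  qed
  have \<xi>W: "\<xi> \<in> W" using \<xi> raise cyc_self by (auto simp: W_def K_def J_def highest_vector_def)
  have BW: "T (i + 1) i v x \<in> W" if x: "x \<in> W" for v x
  proof -
    let ?y = "T (i + 1) i v x"
    have kill: "T a b u x = 0" if "(a, b) \<in> K" for a b u using x that by (auto simp: W_def)
    have y: "T a b u ?y = 0" if ab: "(a, b) \<in> K" for a b u
    proof -
      have ab': "a \<in> {1..N}" "b \<in> {1..N}" "a < b" "a = i \<longrightarrow> b \<noteq> i + 1" using ab by (auto simp: K_def)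
      \<comment> \<open>One of the two orders of the super-commutator with \<open>T (i + 1) i\<close> produces only operators from \<open>K\<close>:
          \<open>T a i\<close> if \<open>a < i\<close>, and \<open>T (i + 1) b\<close> otherwise.\<close>
      have generic: "T a b u ?y = 0" if "u \<noteq> v" for u
      proof (cases "a < i")
        case True
        with i ab' have "(a, i) \<in> K" by (auto simp: K_def)
        then show ?thesis
          using T_rel[OF ab'(1,2) i(2,1), of u v x] that
          by (simp add: kill[OF ab] kill lin_0[OF T_lin])
      next
        case False
        with i ab' have "(i + 1, b) \<in> K" by (auto simp: K_def)
        then show ?thesis
          using T_rel[OF i(2,1) ab'(1,2), of v u x] that
          by (simp add: kill[OF ab] kill lin_0[OF T_lin])
      qed
      show ?thesis
        by (rule polyfun_eq_0[OF T_polyfun infinite_Compl_finite[of "{v}"]]) (use generic in auto)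
    qed
    have d: "T j j u ?y = poly (\<Lambda> j) u *s ?y" if j: "j \<in> J" for j u
    proof -
      have j': "j \<in> {1..N}" "j \<noteq> i" "j \<noteq> i + 1" using j by (auto simp: J_def)
      have Tj: "T j j u x = poly (\<Lambda> j) u *s x" for u using x j by (auto simp: W_def)
      have "even ((s j + s j) * (s (i + 1) + s i))" "even ((s (i + 1) + s i) * (s j + s j))" by simp_all
      then have sg: "(- 1 :: complex) ^ ((s j + s j) * (s (i + 1) + s i)) = 1"
        "(- 1 :: complex) ^ ((s (i + 1) + s i) * (s j + s j)) = 1" by (simp_all only: neg_one_even_power)
      have generic: "T j j u ?y = poly (\<Lambda> j) u *s ?y" if "u \<noteq> v" for u
      proof (cases "j < i")
        case True
        with i j' have "(j, i) \<in> K" by (auto simp: K_def)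
        then show ?thesis
          using T_rel[OF j'(1,1) i(2,1), of u v x] that unfolding sg
          by (simp add: kill lin_0[OF T_lin] Tj lin_scale[OF T_lin])
      next
        case False
        with i j' have "(i + 1, j) \<in> K" by (auto simp: K_def)
        then show ?thesis
          using T_rel[OF i(2,1) j'(1,1), of v u x] that unfolding sg
          by (simp add: kill lin_0[OF T_lin] Tj lin_scale[OF T_lin])
      qed
      show ?thesis
        by (rule polyfun_eq[of "\<lambda>u. T j j u ?y" "\<lambda>u. poly (\<Lambda> j) u *s ?y" "{v}"])
          (use generic in \<open>auto simp: T_polyfun polyfun_poly_const\<close>)
    qed
    show ?thesis using x y d i T_cyc by (auto simp: W_def)
  qed
  have "divisible hs (\<lambda>u. T (i + 1) i u \<xi>)"
  proof -
    have B_cyc: "T (i + 1) i u \<xi> \<in> cyc \<xi>" for u by (rule T_cyc[OF cyc_self i(2,1)])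
    obtain Q R where QR: "polyfun Q" "vpoly (length hs) R" "\<And>u. R u \<in> cyc \<xi>"
        "\<And>u. T (i + 1) i u \<xi> = root_poly hs u *s Q u + R u"
      using division_with_remainder[OF T_polyfun subspace_cyc B_cyc, of hs] by blast
    have R0: "f (R u) = 0" if f: "lin f" and div: "divisible hs (\<lambda>u. f (T (i + 1) i u \<xi>))" for f u
    proof -
      obtain S where S: "polyfun S" "\<And>u. f (T (i + 1) i u \<xi>) = root_poly hs u *s S u"
        using div by (auto simp: divisible_def)
      have "f (R u) = root_poly hs u *s (S u - f (Q u))" for u
        using S(2)[of u] QR(4)[of u] by (simp add: lin_add[OF f] lin_scale[OF f] scale_right_diff_distrib eq_diff_eq add.commute)
      then show ?thesis
        by (rule root_poly_factor_eq_0[OF vpoly_lin[OF QR(2) f] polyfun_diff[OF S(1) polyfun_lin[OF QR(1) f]]]) simp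
    qed
    have RK: "T a b w (R u) = 0" if "(a, b) \<in> K" for a b w u
    proof (rule R0[OF T_lin])
      have "T a b w (T (i + 1) i u \<xi>) = 0" for u using BW[OF \<xi>W] that by (auto simp: W_def)
      then show "divisible hs (\<lambda>u. T a b w (T (i + 1) i u \<xi>))" by (simp add: divisible_0)
    qed
    \<comment> \<open>The factor \<open>w - u\<close> is cancelled for \<open>w\<close> outside \<open>hs\<close>; the other \<open>w\<close> follow by the identity theorem.\<close>
    have RC: "T i (i + 1) w (R u) = 0" for w u
    proof (rule polyfun_eq_0[OF T_polyfun infinite_Compl_finite[of "set hs"]])
      fix w assume w: "w \<in> - set hs"
      show "T i (i + 1) w (R u) = 0"
      proof (rule R0[OF T_lin])
        have D: "T i i u \<xi> = root_poly hs u *s root_poly fs u *s \<xi>"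
          "T (i + 1) (i + 1) u \<xi> = root_poly hs u *s root_poly gs u *s \<xi>" for u
          using \<xi> i \<Lambda> by (simp_all add: highest_vector_def mult.commute)
        have "(\<lambda>u. (u - w) *s T i (i + 1) w (T (i + 1) i u \<xi>))
            = (\<lambda>u. (- ((- 1) ^ s i)) *s (T (i + 1) (i + 1) u (T i i w \<xi>) - T (i + 1) (i + 1) w (T i i u \<xi>)))"
        proof
          fix u
          have "(w - u) *s T i (i + 1) w (T (i + 1) i u \<xi>)
            = (- 1) ^ s i *s (T (i + 1) (i + 1) u (T i i w \<xi>) - T (i + 1) (i + 1) w (T i i u \<xi>))"
            using G.CB[of w u \<xi>] i by (simp add: raise lin_0[OF T_lin])
          then have "- ((w - u) *s T i (i + 1) w (T (i + 1) i u \<xi>))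
            = - ((- 1) ^ s i *s (T (i + 1) (i + 1) u (T i i w \<xi>) - T (i + 1) (i + 1) w (T i i u \<xi>)))"
            by simp
          then show "(u - w) *s T i (i + 1) w (T (i + 1) i u \<xi>)
            = (- ((- 1) ^ s i)) *s (T (i + 1) (i + 1) u (T i i w \<xi>) - T (i + 1) (i + 1) w (T i i u \<xi>))"
            unfolding scale_minus_left[symmetric] by simp
        qed
        moreover have "divisible hs \<dots>"
        proof (intro divisible_scale divisible_diff)
          show "divisible hs (\<lambda>u. T (i + 1) (i + 1) u (T i i w \<xi>))"
            by (rule divisibleI[OF root_poly_polyfun_const[of gs "(root_poly hs w * root_poly fs w) *s \<xi>"]])
              (simp only: D lin_scale[OF T_lin] scale_scale mult.commute mult.left_commute)
          show "divisible hs (\<lambda>u. T (i + 1) (i + 1) w (T i i u \<xi>))"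
            by (rule divisibleI[OF root_poly_polyfun_const[of fs "(root_poly hs w * root_poly gs w) *s \<xi>"]])
              (simp only: D lin_scale[OF T_lin] scale_scale mult.commute mult.left_commute)
        qed
        ultimately show "divisible hs (\<lambda>u. T i (i + 1) w (T (i + 1) i u \<xi>))"
          using divisible_cancel_linear[OF polyfun_lin[OF T_polyfun T_lin], of hs w] w by simp
      qed
    qed simp
    have "R u = 0" for u
    proof (rule ccontr)
      assume "R u \<noteq> 0"
      obtain e where e: "E \<xi> = e *s \<xi>" using highest_vector_E[OF \<xi> deg] by blast
      have "lin (\<lambda>x. E x - (e + 1) *s x)"
        by (rule linI) (simp_all add: lin_add[OF E_lin] lin_scale[OF E_lin] algebra_simps)
      then have "E (R u) - (e + 1) *s R u = 0"
      proof (rule R0)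
        have "E (T (i + 1) i u \<xi>) - (e + 1) *s T (i + 1) i u \<xi> = 0" for u
        proof -
          have "E (t (i + 1) i r \<xi>) = (e + 1) *s t (i + 1) i r \<xi>" for r
            unfolding E_t[OF i(2,1)] e t_scale by (simp add: scale_left_distrib)
          then show ?thesis
            by (simp add: T_def lin_sum[OF E_lin] lin_scale[OF E_lin] scale_sum_right mult.commute)
        qed
        then show "divisible hs (\<lambda>u. E (T (i + 1) i u \<xi>) - (e + 1) *s T (i + 1) i u \<xi>)"
          by (simp add: divisible_0)
      qed
      moreover have "singular (R u)"
        unfolding singular_def
      proof (intro allI impI)
        fix a b r assume ab: "a \<in> {1..N}" "b \<in> {1..N}" "a < b"
        have "\<forall>w. T a b w (R u) = 0"
        proof (cases "(a, b) = (i, i + 1)")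
          case True
          then show ?thesis using RC by simp
        next
          case False
          with ab have "(a, b) \<in> K" by (auto simp: K_def)
          then show ?thesis using RK by blast
        qed
        then show "t a b r (R u) = 0" using T_eq_0_iff[OF ab(1,2)] by blast
      qed
      ultimately have "cyc (R u) \<subseteq> higher_part E e" by (intro cyc_singular_in_higher_part) simp_all
      with irr[OF QR(3) \<open>R u \<noteq> 0\<close>] lowest_eigenvector_notin_higher_part[OF E_lin e \<open>\<xi> \<noteq> 0\<close>]
      show False by blast
    qed
    then show ?thesis using divisibleI[OF QR(1)] QR(4) by simp
  qed
  from G.gl11_lowest_vector_common_factor[OF \<open>\<xi> \<noteq> 0\<close> W \<xi>W BW _ _ _ this _ coprime]
  obtain \<eta> where \<eta>: "\<eta> \<in> W" "\<eta> \<noteq> 0"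
    "\<forall>u. T i i u \<eta> = (root_poly fs (u - (- 1) ^ s i) * root_poly hs u) *s \<eta>"
    "\<forall>u. T (i + 1) (i + 1) u \<eta> = (root_poly gs (u - (- 1) ^ s i) * root_poly hs u) *s \<eta>"
    "\<forall>u. T (i + 1) i u \<eta> = 0"
    using T_vpoly_offdiagonal[of "i + 1" i] raise \<xi> i \<Lambda> len by (auto simp: highest_vector_def)
  show thesis
    by (rule that[of \<eta>]) (use \<eta> in \<open>auto simp: W_def K_def J_def\<close>)
qed

end

section \<open>Modules presented by the free algebra\<close>

abbreviation free_carrier :: "nat \<Rightarrow> gen free_alg set"
  where "free_carrier N \<equiv> carrier (free_algebra (gens N))"

lemma free_algebra_sel [simp]:
  "mult (free_algebra X) = (*)" "one (free_algebra X) = 1" "zero (free_algebra X) = 0" "add (free_algebra X) = (+)"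
  by (simp_all add: free_algebra_def)

lemma free_carrier_0: "0 \<in> free_carrier N"
  by (simp add: free_algebra_def)

lemma free_carrier_add: "a \<in> free_carrier N \<Longrightarrow> b \<in> free_carrier N \<Longrightarrow> a + b \<in> free_carrier N"
  using ring.ring_simprules(1)[OF free_algebra_ring, of a "gens N" b] by simp

lemma scalar_closed: "scalar c \<in> free_carrier N"
  by (auto simp: scalar_def free_algebra_def zero_word_def)

lemmas free_carrier_closed = free_carrier_0 free_carrier_add scalar_closed free_algebra_one_closed
  free_algebra_uminus_closed free_algebra_mult_closed free_algebra_diff_closed

definition left_ideal :: "nat \<Rightarrow> gen free_alg set \<Rightarrow> bool"
  where "left_ideal N H \<longleftrightarrow> H \<subseteq> free_carrier N \<and> 0 \<in> H \<and> (\<forall>a\<in>H. \<forall>b\<in>H. a + b \<in> H)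
    \<and> (\<forall>a\<in>free_carrier N. \<forall>b\<in>H. a * b \<in> H)"

lemma left_idealI:
  assumes "H \<subseteq> free_carrier N" "0 \<in> H" "\<And>a b. a \<in> H \<Longrightarrow> b \<in> H \<Longrightarrow> a + b \<in> H"
    "\<And>a b. a \<in> free_carrier N \<Longrightarrow> b \<in> H \<Longrightarrow> a * b \<in> H"
  shows "left_ideal N H"
  using assms by (simp add: left_ideal_def)

lemma left_idealD:
  assumes "left_ideal N H"
  shows "H \<subseteq> free_carrier N" "0 \<in> H" "a \<in> H \<Longrightarrow> b \<in> H \<Longrightarrow> a + b \<in> H"
    "c \<in> free_carrier N \<Longrightarrow> b \<in> H \<Longrightarrow> c * b \<in> H"
  using assms by (auto simp: left_ideal_def)

lemma left_ideal_uminus: "left_ideal N H \<Longrightarrow> a \<in> H \<Longrightarrow> - a \<in> H"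
  using left_idealD(4)[of N H "- 1" a] by (simp add: free_carrier_closed)

lemma left_ideal_diff: "left_ideal N H \<Longrightarrow> a \<in> H \<Longrightarrow> b \<in> H \<Longrightarrow> a - b \<in> H"
  using left_idealD(3)[of N H a "- b"] by (simp add: left_ideal_uminus)

lemma left_ideal_eq_carrier_iff:
  assumes "left_ideal N H"
  shows "H = free_carrier N \<longleftrightarrow> 1 \<in> H"
  using left_idealD(1)[OF assms] left_idealD(4)[OF assms, of _ 1] by (auto simp: free_carrier_closed)

lemma left_ideal_carrier: "left_ideal N (free_carrier N)"
  by (rule left_idealI) (auto simp: free_carrier_closed)

lemma level_class_hom: "level_class N s p \<in> ring_hom (free_algebra (gens N)) (yangian_level N s p)"
proof -
  have 1: "yangian_class N s \<in> ring_hom (free_algebra (gens N)) (yangian N s)"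
    unfolding yangian_class_def yangian_def by (rule ideal.rcos_ring_hom[OF yangian_ideal])
  have 2: "(+>\<^bsub>yangian N s\<^esub>) (level_ideal N s p) \<in> ring_hom (yangian N s) (yangian_level N s p)"
    unfolding yangian_level_def by (rule ideal.rcos_ring_hom[OF level_ideal])
  have "level_class N s p = (+>\<^bsub>yangian N s\<^esub>) (level_ideal N s p) \<circ> yangian_class N s"
    by (auto simp: level_class_def)
  then show ?thesis using ring_hom_trans[OF 1 2] by simp
qed

lemma level_class_image: "level_class N s p ` free_carrier N = carrier (yangian_level N s p)"
proof -
  have "yangian_class N s ` free_carrier N = carrier (yangian N s)"
    by (auto simp: yangian_class_def yangian_def FactRing_def A_RCOSETS_def')
  moreover have "(\<lambda>x. level_ideal N s p +>\<^bsub>yangian N s\<^esub> x) ` carrier (yangian N s) = carrier (yangian_level N s p)"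
    by (auto simp: yangian_level_def FactRing_def A_RCOSETS_def')
  ultimately show ?thesis by (metis (no_types, lifting) image_cong image_image level_class_def)
qed

lemma level_class_closed: "a \<in> free_carrier N \<Longrightarrow> level_class N s p a \<in> carrier (yangian_level N s p)"
  using level_class_image by blast

lemma level_class_add: "a \<in> free_carrier N \<Longrightarrow> b \<in> free_carrier N \<Longrightarrow>
    level_class N s p (a + b) = level_class N s p a \<oplus>\<^bsub>yangian_level N s p\<^esub> level_class N s p b"
  using ring_hom_add[OF level_class_hom, of a N b] by simp

lemma level_class_mult: "a \<in> free_carrier N \<Longrightarrow> b \<in> free_carrier N \<Longrightarrow>
    level_class N s p (a * b) = level_class N s p a \<otimes>\<^bsub>yangian_level N s p\<^esub> level_class N s p b"
  using ring_hom_mult[OF level_class_hom, of a N b] by simp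

text \<open>
  The map \<open>c\<close> makes \<open>M\<close> a quotient of the free algebra as a left module over it.  Submodules of \<open>M\<close>
  correspond to left ideals that contain the kernel of \<open>c\<close> (\<open>submodule_image\<close>, \<open>left_ideal_preimage\<close>), so
  that elements of the free algebra can be used in place of iterated cosets.
\<close>

definition presents :: "nat \<Rightarrow> (nat \<Rightarrow> nat) \<Rightarrow> nat \<Rightarrow> (level_elem, 'm) module \<Rightarrow> (gen free_alg \<Rightarrow> 'm) \<Rightarrow> bool"
  where "presents N s p M c \<longleftrightarrow> abelian_group M \<and> c ` free_carrier N = carrier M
    \<and> (\<forall>a\<in>free_carrier N. \<forall>b\<in>free_carrier N. c (a + b) = c a \<oplus>\<^bsub>M\<^esub> c b
         \<and> c (a * b) = level_class N s p a \<odot>\<^bsub>M\<^esub> c b)"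

context
  fixes N s p and M :: "(level_elem, 'm) module" and c :: "gen free_alg \<Rightarrow> 'm"
  assumes pres: "presents N s p M c"
begin

lemma presents_abelian_group: "abelian_group M"
  and presents_image: "c ` free_carrier N = carrier M"
  and presents_add: "a \<in> free_carrier N \<Longrightarrow> b \<in> free_carrier N \<Longrightarrow> c (a + b) = c a \<oplus>\<^bsub>M\<^esub> c b"
  and presents_mult: "a \<in> free_carrier N \<Longrightarrow> b \<in> free_carrier N \<Longrightarrow> c (a * b) = level_class N s p a \<odot>\<^bsub>M\<^esub> c b"
  using pres by (auto simp: presents_def)

lemma presents_closed: "a \<in> free_carrier N \<Longrightarrow> c a \<in> carrier M"
  using presents_image by blast

lemma presents_0: "c 0 = \<zero>\<^bsub>M\<^esub>"
proof -
  interpret abelian_group M by (rule presents_abelian_group)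
  have "c 0 \<oplus>\<^bsub>M\<^esub> c 0 = c 0 \<oplus>\<^bsub>M\<^esub> \<zero>\<^bsub>M\<^esub>"
    using presents_add[of 0 0] presents_closed[of 0] by (simp add: free_carrier_closed)
  then show ?thesis using presents_closed[of 0] by (simp add: free_carrier_closed)
qed

lemma presents_uminus: "a \<in> free_carrier N \<Longrightarrow> c (- a) = \<ominus>\<^bsub>M\<^esub> c a"
proof -
  interpret abelian_group M by (rule presents_abelian_group)
  assume a: "a \<in> free_carrier N"
  then have "c (- a) \<oplus>\<^bsub>M\<^esub> c a = \<zero>\<^bsub>M\<^esub>"
    using presents_add[of "- a" a] by (simp add: free_carrier_closed presents_0)
  then show ?thesis
    using a presents_closed minus_equality by (metis free_algebra_uminus_closed)
qed

lemma presents_eq_iff: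
  assumes "a \<in> free_carrier N" "b \<in> free_carrier N"
  shows "c a = c b \<longleftrightarrow> c (a - b) = \<zero>\<^bsub>M\<^esub>"
proof -
  interpret abelian_group M by (rule presents_abelian_group)
  have ab: "a - b \<in> free_carrier N" using assms by (simp add: free_carrier_closed)
  have "c (a - b) \<oplus>\<^bsub>M\<^esub> c b = c a" using presents_add[OF ab assms(2)] by simp
  moreover have "c (a - b) \<oplus>\<^bsub>M\<^esub> c b = \<zero>\<^bsub>M\<^esub> \<oplus>\<^bsub>M\<^esub> c b \<longleftrightarrow> c (a - b) = \<zero>\<^bsub>M\<^esub>"
    using add.right_cancel[of "c b" "c (a - b)" "\<zero>\<^bsub>M\<^esub>"] presents_closed ab assms(2) by simp
  ultimately show ?thesis using presents_closed[OF assms(2)] by auto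
qed

lemma submodule_image:
  assumes P: "left_ideal N P"
  shows "submodule (c ` P) (yangian_level N s p) M"
proof (intro submodule.intro submodule_axioms.intro)
  interpret abelian_group M by (rule presents_abelian_group)
  note PD = left_idealD[OF P]
  have sub: "a \<in> free_carrier N" if "a \<in> P" for a using PD(1) that by blast
  show "subgroup (c ` P) (add_monoid M)"
  proof (rule group.subgroupI[OF a_group])
    show "c ` P \<subseteq> carrier (add_monoid M)" using sub presents_closed by auto
    show "c ` P \<noteq> {}" using PD(2) by blast
    show "inv\<^bsub>add_monoid M\<^esub> x \<in> c ` P" if "x \<in> c ` P" for x
    proof -
      obtain a where a: "a \<in> P" "x = c a" using \<open>x \<in> c ` P\<close> by blast
      then have "inv\<^bsub>add_monoid M\<^esub> x = c (- a)" using presents_uminus[OF sub] by (simp add: a_inv_def)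
      with left_ideal_uminus[OF P a(1)] show ?thesis by simp
    qed
    show "x \<otimes>\<^bsub>add_monoid M\<^esub> y \<in> c ` P" if "x \<in> c ` P" "y \<in> c ` P" for x y
    proof -
      obtain a b where ab: "a \<in> P" "x = c a" "b \<in> P" "y = c b" using \<open>x \<in> c ` P\<close> \<open>y \<in> c ` P\<close> by blast
      then have "x \<otimes>\<^bsub>add_monoid M\<^esub> y = c (a + b)" using presents_add[OF sub sub] by simp
      with PD(3)[OF ab(1,3)] show ?thesis by simp
    qed
  qed
  show "a \<odot>\<^bsub>M\<^esub> x \<in> c ` P" if "a \<in> carrier (yangian_level N s p)" "x \<in> c ` P" for a x
  proof -
    have "a \<in> level_class N s p ` free_carrier N" using \<open>a \<in> carrier _\<close> by (simp add: level_class_image)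
    then obtain a' where a': "a' \<in> free_carrier N" "a = level_class N s p a'" by blast
    obtain x' where x': "x' \<in> P" "x = c x'" using \<open>x \<in> c ` P\<close> by blast
    have "a \<odot>\<^bsub>M\<^esub> x = c (a' * x')" using presents_mult[OF a'(1) sub[OF x'(1)]] a'(2) x'(2) by simp
    with PD(4)[OF a'(1) x'(1)] show ?thesis by simp
  qed
qed

lemma submodule_carrier: "submodule (carrier M) (yangian_level N s p) M"
  using submodule_image[OF left_ideal_carrier] by (simp add: presents_image)

lemma left_ideal_preimage:
  assumes H: "submodule H (yangian_level N s p) M"
  shows "left_ideal N {a \<in> free_carrier N. c a \<in> H}"
proof -
  interpret abelian_group M by (rule presents_abelian_group)
  interpret H: submodule H "yangian_level N s p" M by (rule H)
  show ?thesis
  proof (rule left_idealI)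
    show "0 \<in> {a \<in> free_carrier N. c a \<in> H}"
      using H.one_closed by (simp add: presents_0 free_carrier_closed)
    show "a + b \<in> {a \<in> free_carrier N. c a \<in> H}"
      if "a \<in> {a \<in> free_carrier N. c a \<in> H}" "b \<in> {a \<in> free_carrier N. c a \<in> H}" for a b
      using that H.m_closed by (simp add: presents_add free_carrier_closed)
    show "a * b \<in> {a \<in> free_carrier N. c a \<in> H}"
      if "a \<in> free_carrier N" "b \<in> {a \<in> free_carrier N. c a \<in> H}" for a b
      using that H.smult_closed level_class_closed by (simp add: presents_mult free_carrier_closed)
  qed auto
qed

lemma submodule_gen_submodule:
  assumes "S \<subseteq> carrier M"
  shows "submodule (gen_submodule (yangian_level N s p) M S) (yangian_level N s p) M"
proof -
  interpret abelian_group M by (rule presents_abelian_group)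
  let ?C = "{H. submodule H (yangian_level N s p) M \<and> S \<subseteq> H}"
  have C: "carrier M \<in> ?C" using submodule_carrier assms by simp
  have "subgroup (\<Inter>?C) (add_monoid M)"
    by (rule add.subgroups_Inter) (use C in \<open>auto dest: submodule.axioms(1)\<close>)
  moreover have "a \<odot>\<^bsub>M\<^esub> x \<in> \<Inter>?C" if "a \<in> carrier (yangian_level N s p)" "x \<in> \<Inter>?C" for a x
    using that submodule.smult_closed by fastforce
  ultimately show ?thesis
    unfolding gen_submodule_def by (intro submodule.intro submodule_axioms.intro)
qed

lemma gen_submodule_superset: "S \<subseteq> gen_submodule (yangian_level N s p) M S"
  by (auto simp: gen_submodule_def)

text \<open>
  Elements of the free algebra with the same image differ by an element of the kernel, so \<open>P\<close> is the
  full preimage of its image.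
\<close>

lemma gen_submodule_preimage_minimal:
  assumes P: "left_ideal N P" and ker: "{a \<in> free_carrier N. c a = \<zero>\<^bsub>M\<^esub>} \<subseteq> P" and S: "S \<subseteq> c ` P"
  shows "{a \<in> free_carrier N. c a \<in> gen_submodule (yangian_level N s p) M S} \<subseteq> P"
proof clarify
  fix a assume a: "a \<in> free_carrier N" "c a \<in> gen_submodule (yangian_level N s p) M S"
  then have "c a \<in> c ` P" using submodule_image[OF P] S by (auto simp: gen_submodule_def)
  then obtain b where b: "b \<in> P" "c a = c b" by blast
  then have "b \<in> free_carrier N" using left_idealD(1)[OF P] by blast
  with a b have "a - b \<in> P" using presents_eq_iff ker by (auto simp: free_carrier_closed)
  then show "a \<in> P" using left_idealD(3)[OF P, of "a - b" b] b by simp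
qed

lemma presents_quot_module:
  assumes H: "submodule H (yangian_level N s p) M"
  shows "presents N s p (quot_module M H) (\<lambda>a. H +>\<^bsub>M\<^esub> c a)"
    and "a \<in> free_carrier N \<Longrightarrow> H +>\<^bsub>M\<^esub> c a = \<zero>\<^bsub>quot_module M H\<^esub> \<longleftrightarrow> c a \<in> H"
proof -
  interpret abelian_group M by (rule presents_abelian_group)
  interpret H: submodule H "yangian_level N s p" M by (rule H)
  interpret A: abelian_subgroup H M
    by (rule abelian_subgroupI3[OF additive_subgroup.intro abelian_group_axioms]) (rule H.subgroup_axioms)
  let ?Q = "quot_module M H"
  have cos: "x \<in> carrier M \<Longrightarrow> y \<in> carrier M \<Longrightarrow> (H +>\<^bsub>M\<^esub> x) \<oplus>\<^bsub>?Q\<^esub> (H +>\<^bsub>M\<^esub> y) = H +>\<^bsub>M\<^esub> (x \<oplus>\<^bsub>M\<^esub> y)" for x y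
    by (simp add: quot_module_def A.a_rcos_sum)
  have zero: "\<zero>\<^bsub>?Q\<^esub> = H +>\<^bsub>M\<^esub> \<zero>\<^bsub>M\<^esub>" 
    using a_coset_add_zero[OF A.a_subset] by (simp add: quot_module_def)
  have carr: "carrier ?Q = (\<lambda>x. H +>\<^bsub>M\<^esub> x) ` carrier M"
    by (auto simp: quot_module_def A_RCOSETS_def')
  have ab: "abelian_group ?Q"
  proof (rule abelian_groupI)
    fix x assume "x \<in> carrier ?Q"
    then obtain x' where x': "x' \<in> carrier M" "x = H +>\<^bsub>M\<^esub> x'" unfolding carr by blast
    then show "\<exists>y\<in>carrier ?Q. y \<oplus>\<^bsub>?Q\<^esub> x = \<zero>\<^bsub>?Q\<^esub>"
      unfolding carr zero by (intro bexI[of _ "H +>\<^bsub>M\<^esub> (\<ominus>\<^bsub>M\<^esub> x')"]) (auto simp: cos l_neg)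
  qed (auto simp: carr cos zero a_ac)
  have smult: "level_class N s p a \<odot>\<^bsub>?Q\<^esub> (H +>\<^bsub>M\<^esub> c b) = H +>\<^bsub>M\<^esub> c (a * b)"
    if a: "a \<in> free_carrier N" and b: "b \<in> free_carrier N" for a b
  proof -
    have "H +>\<^bsub>M\<^esub> (level_class N s p a \<odot>\<^bsub>M\<^esub> x) = H +>\<^bsub>M\<^esub> c (a * b)" if "x \<in> H +>\<^bsub>M\<^esub> c b" for x
    proof -
      obtain h where h: "h \<in> H" "x = h \<oplus>\<^bsub>M\<^esub> c b" using \<open>x \<in> H +>\<^bsub>M\<^esub> c b\<close> by (auto simp: a_r_coset_def')
      then have "h \<in> c ` free_carrier N" using H.subset presents_image by auto
      then obtain h' where h': "h' \<in> free_carrier N" "h = c h'" by blast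
      have "level_class N s p a \<odot>\<^bsub>M\<^esub> x = c (a * (h' + b))"
        using h h' a b by (simp add: presents_add presents_mult free_carrier_closed)
      also have "\<dots> = level_class N s p a \<odot>\<^bsub>M\<^esub> h \<oplus>\<^bsub>M\<^esub> c (a * b)"
        using h' a b by (simp add: distrib_left presents_add presents_mult free_carrier_closed)
      finally have "level_class N s p a \<odot>\<^bsub>M\<^esub> x \<in> H +>\<^bsub>M\<^esub> c (a * b)"
        using H.smult_closed[OF level_class_closed[OF a] h(1)] by (auto simp: a_r_coset_def')
      then show ?thesis
        using a_repr_independence[OF _ _ H.subgroup_axioms, of _ "c (a * b)"] presents_closed[of "a * b"] a b
        by (simp add: free_carrier_closed)
    qed
    moreover have "c b \<in> H +>\<^bsub>M\<^esub> c b" using A.a_rcos_self presents_closed b by blast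
    ultimately show ?thesis unfolding quot_module_def by auto
  qed
  have "(\<lambda>a. H +>\<^bsub>M\<^esub> c a) ` free_carrier N = carrier ?Q"
    unfolding carr presents_image[symmetric] by (simp add: image_image)
  with ab smult show "presents N s p (quot_module M H) (\<lambda>a. H +>\<^bsub>M\<^esub> c a)"
    by (simp add: presents_def cos presents_add presents_closed)
  show "H +>\<^bsub>M\<^esub> c a = \<zero>\<^bsub>?Q\<^esub> \<longleftrightarrow> c a \<in> H" if "a \<in> free_carrier N"
    using A.a_rcos_self[OF presents_closed[OF that]] A.a_rcos_const by (auto simp: quot_module_def)
qed

end

lemma presents_regular_module:
  "presents N s p (regular_module (yangian_level N s p)) (level_class N s p)"
proof -
  interpret ring "yangian_level N s p" by (rule yangian_level_ring)
  have "abelian_group (regular_module (yangian_level N s p))"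
    by (rule abelian_groupI) (auto simp: regular_module_def a_ac intro: l_neg)
  then show ?thesis
    by (simp add: presents_def regular_module_def level_class_image level_class_add level_class_mult)
qed

text \<open>
  The left ideals of the free algebra that define the algebra of level \<open>p\<close> itself, the Verma module and
  its irreducible quotient (\<open>level_kernel\<close>, \<open>verma_kernel\<close> and \<open>L_kernel\<close>).
\<close>

definition level_kernel :: "nat \<Rightarrow> (nat \<Rightarrow> nat) \<Rightarrow> nat \<Rightarrow> gen free_alg set"
  where "level_kernel N s p = {a \<in> free_carrier N. level_class N s p a = \<zero>\<^bsub>yangian_level N s p\<^esub>}"

definition verma_kernel :: "nat \<Rightarrow> (nat \<Rightarrow> nat) \<Rightarrow> nat \<Rightarrow> (nat \<Rightarrow> complex poly) \<Rightarrow> gen free_alg set"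
  where "verma_kernel N s p \<Lambda> = {a \<in> free_carrier N. level_class N s p a \<in> verma_left_ideal N s p \<Lambda>}"

definition verma_map :: "nat \<Rightarrow> (nat \<Rightarrow> nat) \<Rightarrow> nat \<Rightarrow> (nat \<Rightarrow> complex poly) \<Rightarrow> gen free_alg \<Rightarrow> level_elem set"
  where "verma_map N s p \<Lambda> a = verma_left_ideal N s p \<Lambda> +>\<^bsub>regular_module (yangian_level N s p)\<^esub> level_class N s p a"

abbreviation proper_submodules :: "nat \<Rightarrow> (nat \<Rightarrow> nat) \<Rightarrow> nat \<Rightarrow> (nat \<Rightarrow> complex poly) \<Rightarrow> level_elem set set set"
  where "proper_submodules N s p \<Lambda> \<equiv>
    {H. submodule H (yangian_level N s p) (verma_module N s p \<Lambda>) \<and> H \<noteq> carrier (verma_module N s p \<Lambda>)}"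

definition maximal_submodule :: "nat \<Rightarrow> (nat \<Rightarrow> nat) \<Rightarrow> nat \<Rightarrow> (nat \<Rightarrow> complex poly) \<Rightarrow> level_elem set set"
  where "maximal_submodule N s p \<Lambda> = gen_submodule (yangian_level N s p) (verma_module N s p \<Lambda>)
    (\<Union>(proper_submodules N s p \<Lambda>))"

definition L_kernel :: "nat \<Rightarrow> (nat \<Rightarrow> nat) \<Rightarrow> nat \<Rightarrow> (nat \<Rightarrow> complex poly) \<Rightarrow> gen free_alg set"
  where "L_kernel N s p \<Lambda> = {a \<in> free_carrier N. verma_map N s p \<Lambda> a \<in> maximal_submodule N s p \<Lambda>}"

definition L_map :: "nat \<Rightarrow> (nat \<Rightarrow> nat) \<Rightarrow> nat \<Rightarrow> (nat \<Rightarrow> complex poly) \<Rightarrow> gen free_alg \<Rightarrow> level_elem set set"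
  where "L_map N s p \<Lambda> a = maximal_submodule N s p \<Lambda> +>\<^bsub>verma_module N s p \<Lambda>\<^esub> verma_map N s p \<Lambda> a"

lemma regular_module_sel [simp]:
  "carrier (regular_module R) = carrier R" "zero (regular_module R) = zero R"
  "add (regular_module R) = add R" "smult (regular_module R) = mult R"
  by (simp_all add: regular_module_def)

lemma T_coeff_eq: "d \<le> p \<Longrightarrow> T_coeff N s p a b d = level_class N s p (tgen a b (p - d))"
  by (simp add: T_coeff_def)

text \<open>
  The generators of the left ideal of the Verma module, lifted to the free algebra.  Powers \<open>u\<^sup>d\<close> with
  \<open>d > p\<close> contribute only zeros, because \<open>\<Lambda> j\<close> has degree at most \<open>p\<close>.
\<close>

definition verma_generators :: "nat \<Rightarrow> nat \<Rightarrow> (nat \<Rightarrow> complex poly) \<Rightarrow> gen free_alg set"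
  where "verma_generators N p \<Lambda> = {tgen a b r | a b r. {a, b} \<subseteq> {1..N} \<and> a < b \<and> r \<le> p}
    \<union> {tgen j j (p - d) - scalar (coeff (\<Lambda> j) d) | j d. j \<in> {1..N} \<and> d \<le> p}"

lemma level_class_0: "level_class N s p 0 = \<zero>\<^bsub>yangian_level N s p\<^esub>"
  using presents_0[OF presents_regular_module] by simp

lemma level_class_diff:
  assumes "a \<in> free_carrier N" "b \<in> free_carrier N"
  shows "level_class N s p (a - b) = level_class N s p a \<ominus>\<^bsub>yangian_level N s p\<^esub> level_class N s p b"
proof -
  interpret R: ring "yangian_level N s p" by (rule yangian_level_ring)
  have b: "- b \<in> free_carrier N" using assms(2) by (simp add: free_carrier_closed)
  have "level_class N s p (- b) \<oplus>\<^bsub>yangian_level N s p\<^esub> level_class N s p b = \<zero>\<^bsub>yangian_level N s p\<^esub>"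
    using level_class_add[OF b assms(2), of s p] by (simp add: level_class_0)
  then have "level_class N s p (- b) = \<ominus>\<^bsub>yangian_level N s p\<^esub> level_class N s p b"
    using R.minus_equality[of "level_class N s p (- b)" "level_class N s p b"] level_class_closed b assms(2)
    by simp
  then show ?thesis using level_class_add[OF assms(1) b, of s p] by (simp add: a_minus_def)
qed

lemma verma_generators_closed: "verma_generators N p \<Lambda> \<subseteq> free_carrier N"
  by (auto simp: verma_generators_def intro!: free_carrier_closed tgen_closed)

lemma verma_left_ideal_eq:
  assumes deg: "\<forall>j\<in>{1..N}. degree (\<Lambda> j) \<le> p"
  shows "verma_left_ideal N s p \<Lambda> = gen_submodule (yangian_level N s p) (regular_module (yangian_level N s p))
    (level_class N s p ` verma_generators N p \<Lambda> \<union> {\<zero>\<^bsub>yangian_level N s p\<^esub>})"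
proof -
  interpret R: ring "yangian_level N s p" by (rule yangian_level_ring)
  let ?A = "{T_coeff N s p a b d | a b d. {a, b} \<subseteq> {1..N} \<and> a < b} \<union>
       {T_coeff N s p j j d \<ominus>\<^bsub>yangian_level N s p\<^esub> level_class N s p (scalar (coeff (\<Lambda> j) d))
        | j d. j \<in> {1..N}}"
  let ?B = "level_class N s p ` verma_generators N p \<Lambda> \<union> {\<zero>\<^bsub>yangian_level N s p\<^esub>}"
  have diag: "level_class N s p (tgen j j (p - d) - scalar (coeff (\<Lambda> j) d))
      = T_coeff N s p j j d \<ominus>\<^bsub>yangian_level N s p\<^esub> level_class N s p (scalar (coeff (\<Lambda> j) d))"
    if "j \<in> {1..N}" "d \<le> p" for j d
    using that by (simp add: T_coeff_eq level_class_diff tgen_closed scalar_closed)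
  have A_in: "x \<in> ?B" if "x \<in> ?A" for x
    using that
  proof
    assume "x \<in> {T_coeff N s p a b d | a b d. {a, b} \<subseteq> {1..N} \<and> a < b}"
    then obtain a b d where abd: "{a, b} \<subseteq> {1..N}" "a < b" "x = T_coeff N s p a b d" by blast
    show ?thesis
    proof (cases "d \<le> p")
      case True
      have "tgen a b (p - d) \<in> verma_generators N p \<Lambda>"
        unfolding verma_generators_def using abd(1,2) by (intro UnI1 CollectI exI[of _ a] exI[of _ b] exI[of _ "p - d"]) simp
      then show ?thesis using abd(3) True by (simp add: T_coeff_eq)
    qed (use abd(3) in \<open>simp add: T_coeff_def\<close>)
  next
    assume "x \<in> {T_coeff N s p j j d \<ominus>\<^bsub>yangian_level N s p\<^esub> level_class N s p (scalar (coeff (\<Lambda> j) d)) | j d. j \<in> {1..N}}"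
    then obtain j d where jd: "j \<in> {1..N}"
      "x = T_coeff N s p j j d \<ominus>\<^bsub>yangian_level N s p\<^esub> level_class N s p (scalar (coeff (\<Lambda> j) d))" by blast
    show ?thesis
    proof (cases "d \<le> p")
      case True
      have "tgen j j (p - d) - scalar (coeff (\<Lambda> j) d) \<in> verma_generators N p \<Lambda>"
        unfolding verma_generators_def using jd(1) True by (intro UnI2 CollectI exI[of _ j] exI[of _ d]) simp
      then show ?thesis unfolding jd(2) diag[OF jd(1) True, symmetric] by blast
    next
      case False
      then have "coeff (\<Lambda> j) d = 0" using bspec[OF deg jd(1)] by (simp add: coeff_eq_0)
      then have "x = \<zero>\<^bsub>yangian_level N s p\<^esub>"
        using False jd(2) by (simp add: T_coeff_def scalar_def level_class_0 a_minus_def)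
      then show ?thesis by blast
    qed
  qed
  have B_in: "x \<in> ?A \<union> {\<zero>\<^bsub>yangian_level N s p\<^esub>}" if "x \<in> ?B" for x
    using that
  proof
    assume "x \<in> level_class N s p ` verma_generators N p \<Lambda>"
    then obtain g where g: "g \<in> verma_generators N p \<Lambda>" "x = level_class N s p g" by blast
    from g(1) consider a b r where "{a, b} \<subseteq> {1..N}" "a < b" "r \<le> p" "g = tgen a b r"
      | j d where "j \<in> {1..N}" "d \<le> p" "g = tgen j j (p - d) - scalar (coeff (\<Lambda> j) d)"
      unfolding verma_generators_def by blast
    then show ?thesis
    proof cases
      case 1
      then have "x = T_coeff N s p a b (p - r)" using g(2) by (simp add: T_coeff_eq)
      with 1(1,2) show ?thesis
        by (intro UnI1 CollectI exI[of _ a] exI[of _ b] exI[of _ "p - r"] conjI)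
    next
      case 2
      have "x = T_coeff N s p j j d \<ominus>\<^bsub>yangian_level N s p\<^esub> level_class N s p (scalar (coeff (\<Lambda> j) d))"
        unfolding g(2) 2(3) by (rule diag[OF 2(1,2)])
      with 2(1) show ?thesis
        by (intro UnI1[OF UnI2] CollectI exI[of _ j] exI[of _ d] conjI)
    qed
  qed auto
  have AB: "?A \<subseteq> ?B" "?B \<subseteq> ?A \<union> {\<zero>\<^bsub>yangian_level N s p\<^esub>}"
    by (rule subsetI, erule A_in) (rule subsetI, erule B_in)
  have iff: "?A \<subseteq> H \<longleftrightarrow> ?B \<subseteq> H"
    if "submodule H (yangian_level N s p) (regular_module (yangian_level N s p))" for H
  proof
    have "\<zero>\<^bsub>yangian_level N s p\<^esub> \<in> H"
      using subgroup.one_closed[OF submodule.axioms(1)[OF that]] by simp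
    then have "?A \<subseteq> H \<Longrightarrow> ?A \<union> {\<zero>\<^bsub>yangian_level N s p\<^esub>} \<subseteq> H" by simp
    then show "?A \<subseteq> H \<Longrightarrow> ?B \<subseteq> H" using AB(2) by (rule subset_trans[rotated])
    show "?B \<subseteq> H \<Longrightarrow> ?A \<subseteq> H" using AB(1) by (rule subset_trans)
  qed
  have "{H. submodule H (yangian_level N s p) (regular_module (yangian_level N s p)) \<and> ?A \<subseteq> H}
     = {H. submodule H (yangian_level N s p) (regular_module (yangian_level N s p)) \<and> ?B \<subseteq> H}"
    by (rule Collect_cong, rule conj_cong[OF refl], rule iff)
  then show ?thesis unfolding verma_left_ideal_def gen_submodule_def by (simp only:)
qed

context
  fixes N :: nat and s :: "nat \<Rightarrow> nat" and p :: nat and \<Lambda> :: "nat \<Rightarrow> complex poly"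
  assumes deg: "\<forall>j\<in>{1..N}. degree (\<Lambda> j) \<le> p"
begin

lemma verma_left_ideal_gen:
  "verma_left_ideal N s p \<Lambda> = gen_submodule (yangian_level N s p) (regular_module (yangian_level N s p))
    (level_class N s p ` verma_generators N p \<Lambda> \<union> {\<zero>\<^bsub>yangian_level N s p\<^esub>})"
  by (rule verma_left_ideal_eq[OF deg])

lemma verma_gens_subset:
  "level_class N s p ` verma_generators N p \<Lambda> \<union> {\<zero>\<^bsub>yangian_level N s p\<^esub>} \<subseteq> carrier (regular_module (yangian_level N s p))"
proof (rule Un_least)
  have "level_class N s p ` verma_generators N p \<Lambda> \<subseteq> level_class N s p ` free_carrier N"
    by (rule image_mono[OF verma_generators_closed])
  then show "level_class N s p ` verma_generators N p \<Lambda> \<subseteq> carrier (regular_module (yangian_level N s p))"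
    by (simp add: level_class_image)
  show "{\<zero>\<^bsub>yangian_level N s p\<^esub>} \<subseteq> carrier (regular_module (yangian_level N s p))"
    using ring.ring_simprules(2)[OF yangian_level_ring, of N s p] by simp
qed

lemma verma_left_ideal_submodule:
  "submodule (verma_left_ideal N s p \<Lambda>) (yangian_level N s p) (regular_module (yangian_level N s p))"
  unfolding verma_left_ideal_gen
  by (rule submodule_gen_submodule[OF presents_regular_module verma_gens_subset])

lemma left_ideal_verma_kernel: "left_ideal N (verma_kernel N s p \<Lambda>)"
  unfolding verma_kernel_def by (rule left_ideal_preimage[OF presents_regular_module verma_left_ideal_submodule])

lemma verma_generators_in_kernel: "verma_generators N p \<Lambda> \<subseteq> verma_kernel N s p \<Lambda>"
  unfolding verma_kernel_def verma_left_ideal_gen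
proof
  fix g assume g: "g \<in> verma_generators N p \<Lambda>"
  then have "level_class N s p g \<in> level_class N s p ` verma_generators N p \<Lambda> \<union> {\<zero>\<^bsub>yangian_level N s p\<^esub>}"
    by blast
  with g show "g \<in> {a \<in> free_carrier N. level_class N s p a \<in> gen_submodule (yangian_level N s p)
      (regular_module (yangian_level N s p))
      (level_class N s p ` verma_generators N p \<Lambda> \<union> {\<zero>\<^bsub>yangian_level N s p\<^esub>})}"
    using subsetD[OF verma_generators_closed] subsetD[OF gen_submodule_superset[OF presents_regular_module]] by simp
qed

lemma level_kernel_subset_verma_kernel: "level_kernel N s p \<subseteq> verma_kernel N s p \<Lambda>"
proof -
  have "\<zero>\<^bsub>yangian_level N s p\<^esub> \<in> verma_left_ideal N s p \<Lambda>"
    using subgroup.one_closed[OF submodule.axioms(1)[OF verma_left_ideal_submodule]] by simp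
  then show ?thesis by (auto simp: level_kernel_def verma_kernel_def)
qed

lemma verma_kernel_minimal:
  assumes "left_ideal N P" "level_kernel N s p \<subseteq> P" "verma_generators N p \<Lambda> \<subseteq> P"
  shows "verma_kernel N s p \<Lambda> \<subseteq> P"
  unfolding verma_kernel_def verma_left_ideal_gen
proof (rule gen_submodule_preimage_minimal[OF presents_regular_module assms(1)])
  show "{a \<in> free_carrier N. level_class N s p a = \<zero>\<^bsub>regular_module (yangian_level N s p)\<^esub>} \<subseteq> P"
    using assms(2) by (simp add: level_kernel_def)
  show "level_class N s p ` verma_generators N p \<Lambda> \<union> {\<zero>\<^bsub>yangian_level N s p\<^esub>} \<subseteq> level_class N s p ` P"
  proof (rule Un_least[OF image_mono[OF assms(3)]])
    show "{\<zero>\<^bsub>yangian_level N s p\<^esub>} \<subseteq> level_class N s p ` P"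
      using imageI[OF left_idealD(2)[OF assms(1)], of "level_class N s p"] by (simp add: level_class_0)
  qed
qed

lemma presents_verma: "presents N s p (verma_module N s p \<Lambda>) (verma_map N s p \<Lambda>)"
  unfolding verma_module_def verma_map_def[abs_def]
  by (rule presents_quot_module(1)[OF presents_regular_module verma_left_ideal_submodule])

lemma verma_map_eq_0_iff:
  "a \<in> free_carrier N \<Longrightarrow> verma_map N s p \<Lambda> a = \<zero>\<^bsub>verma_module N s p \<Lambda>\<^esub> \<longleftrightarrow> a \<in> verma_kernel N s p \<Lambda>"
  unfolding verma_module_def verma_map_def verma_kernel_def
  by (simp add: presents_quot_module(2)[OF presents_regular_module verma_left_ideal_submodule])

lemma maximal_submodule_submodule:
  "submodule (maximal_submodule N s p \<Lambda>) (yangian_level N s p) (verma_module N s p \<Lambda>)"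
  unfolding maximal_submodule_def
proof (rule submodule_gen_submodule[OF presents_verma])
  show "\<Union>(proper_submodules N s p \<Lambda>)
    \<subseteq> carrier (verma_module N s p \<Lambda>)"
  proof (rule Union_least)
    fix H
    assume "H \<in> proper_submodules N s p \<Lambda>"
    then have "submodule H (yangian_level N s p) (verma_module N s p \<Lambda>)" by simp
    from subgroup.subset[OF submodule.axioms(1)[OF this]] show "H \<subseteq> carrier (verma_module N s p \<Lambda>)" by simp
  qed
qed

lemma presents_L: "presents N s p (L_module N s p \<Lambda>) (L_map N s p \<Lambda>)"
  unfolding L_module_def irreducible_quotient_def L_map_def[abs_def] maximal_submodule_def[symmetric]
  by (rule presents_quot_module(1)[OF presents_verma maximal_submodule_submodule])

lemma L_map_eq_0_iff:
  "a \<in> free_carrier N \<Longrightarrow> L_map N s p \<Lambda> a = \<zero>\<^bsub>L_module N s p \<Lambda>\<^esub> \<longleftrightarrow> a \<in> L_kernel N s p \<Lambda>"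
  unfolding L_module_def irreducible_quotient_def L_map_def maximal_submodule_def[symmetric] L_kernel_def
  by (simp add: presents_quot_module(2)[OF presents_verma maximal_submodule_submodule])

lemma L_map_eq_iff:
  "a \<in> free_carrier N \<Longrightarrow> b \<in> free_carrier N \<Longrightarrow> L_map N s p \<Lambda> a = L_map N s p \<Lambda> b \<longleftrightarrow> a - b \<in> L_kernel N s p \<Lambda>"
  by (simp add: presents_eq_iff[OF presents_L] L_map_eq_0_iff free_carrier_closed)

lemma left_ideal_L_kernel: "left_ideal N (L_kernel N s p \<Lambda>)"
  unfolding L_kernel_def by (rule left_ideal_preimage[OF presents_verma maximal_submodule_submodule])

lemma verma_kernel_subset_L_kernel: "verma_kernel N s p \<Lambda> \<subseteq> L_kernel N s p \<Lambda>"
proof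
  fix a assume a: "a \<in> verma_kernel N s p \<Lambda>"
  then have "a \<in> free_carrier N" by (simp add: verma_kernel_def)
  moreover from this a have "verma_map N s p \<Lambda> a = \<zero>\<^bsub>verma_module N s p \<Lambda>\<^esub>" by (simp add: verma_map_eq_0_iff)
  moreover have "\<zero>\<^bsub>verma_module N s p \<Lambda>\<^esub> \<in> maximal_submodule N s p \<Lambda>"
    using subgroup.one_closed[OF submodule.axioms(1)[OF maximal_submodule_submodule]] by simp
  ultimately show "a \<in> L_kernel N s p \<Lambda>" by (simp add: L_kernel_def)
qed

text \<open>
  If the image of \<open>H\<close> contained the generator, then \<open>H\<close>, which contains the kernel, would contain 1.
\<close>

lemma proper_left_ideal_subset_L_kernel:
  assumes H: "left_ideal N H" "verma_kernel N s p \<Lambda> \<subseteq> H" "H \<noteq> free_carrier N"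
  shows "H \<subseteq> L_kernel N s p \<Lambda>"
proof -
  note pres = presents_verma
  have 1: "1 \<notin> H" using left_ideal_eq_carrier_iff[OF H(1)] H(3) by simp
  have H_carrier: "h \<in> free_carrier N" if "h \<in> H" for h
    by (rule subsetD[OF left_idealD(1)[OF H(1)] that])
  have "verma_map N s p \<Lambda> 1 \<notin> verma_map N s p \<Lambda> ` H"
  proof
    assume "verma_map N s p \<Lambda> 1 \<in> verma_map N s p \<Lambda> ` H"
    then obtain h where h: "verma_map N s p \<Lambda> 1 = verma_map N s p \<Lambda> h" "h \<in> H" by (rule imageE)
    have closed: "1 \<in> free_carrier N" "1 - h \<in> free_carrier N"
      using H_carrier[OF h(2)] by (simp_all add: free_carrier_closed)
    have "verma_map N s p \<Lambda> (1 - h) = \<zero>\<^bsub>verma_module N s p \<Lambda>\<^esub>"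
      using presents_eq_iff[OF pres closed(1) H_carrier[OF h(2)]] h(1) by blast
    then have "1 - h \<in> verma_kernel N s p \<Lambda>"
      using verma_map_eq_0_iff[OF closed(2)] by blast
    from left_idealD(3)[OF H(1) subsetD[OF H(2) this] h(2)] show False using 1 by simp
  qed
  then have ne: "verma_map N s p \<Lambda> ` H \<noteq> carrier (verma_module N s p \<Lambda>)"
  proof (rule contrapos_nn)
    assume "verma_map N s p \<Lambda> ` H = carrier (verma_module N s p \<Lambda>)"
    with presents_closed[OF pres free_algebra_one_closed] show "verma_map N s p \<Lambda> 1 \<in> verma_map N s p \<Lambda> ` H"
      by (simp only:)
  qed
  have "verma_map N s p \<Lambda> ` H \<subseteq> \<Union>(proper_submodules N s p \<Lambda>)"
    by (rule Union_upper, rule CollectI, rule conjI[OF submodule_image[OF pres H(1)] ne])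
  then have sub: "verma_map N s p \<Lambda> ` H \<subseteq> maximal_submodule N s p \<Lambda>"
    unfolding maximal_submodule_def by (rule subset_trans[OF _ gen_submodule_superset[OF pres]])
  show ?thesis
  proof
    fix a assume "a \<in> H"
    with H_carrier subsetD[OF sub imageI] show "a \<in> L_kernel N s p \<Lambda>" by (simp add: L_kernel_def)
  qed
qed

lemma L_kernel_minimal:
  assumes P: "left_ideal N P" "verma_kernel N s p \<Lambda> \<subseteq> P"
    and proper: "\<And>H. left_ideal N H \<Longrightarrow> verma_kernel N s p \<Lambda> \<subseteq> H \<Longrightarrow> H \<noteq> free_carrier N \<Longrightarrow> H \<subseteq> P"
  shows "L_kernel N s p \<Lambda> \<subseteq> P"
proof -
  note pres = presents_verma
  have "verma_kernel N s p \<Lambda> \<subseteq> free_carrier N" by (auto simp: verma_kernel_def)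
  then have ker: "{a \<in> free_carrier N. verma_map N s p \<Lambda> a = \<zero>\<^bsub>verma_module N s p \<Lambda>\<^esub>} = verma_kernel N s p \<Lambda>"
  proof (intro subset_antisym subsetI)
    fix a assume "a \<in> {a \<in> free_carrier N. verma_map N s p \<Lambda> a = \<zero>\<^bsub>verma_module N s p \<Lambda>\<^esub>}"
    then have "a \<in> free_carrier N" "verma_map N s p \<Lambda> a = \<zero>\<^bsub>verma_module N s p \<Lambda>\<^esub>" by simp_all
    then show "a \<in> verma_kernel N s p \<Lambda>" using verma_map_eq_0_iff[of a] by (simp only:)
  next
    fix a assume a: "a \<in> verma_kernel N s p \<Lambda>"
    with \<open>verma_kernel N s p \<Lambda> \<subseteq> free_carrier N\<close> have "a \<in> free_carrier N" by (rule subsetD)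
    with a show "a \<in> {a \<in> free_carrier N. verma_map N s p \<Lambda> a = \<zero>\<^bsub>verma_module N s p \<Lambda>\<^esub>}"
      using verma_map_eq_0_iff[of a] by simp
  qed
  have "H \<subseteq> verma_map N s p \<Lambda> ` P"
    if H: "submodule H (yangian_level N s p) (verma_module N s p \<Lambda>)" "H \<noteq> carrier (verma_module N s p \<Lambda>)" for H
  proof -
    let ?H = "{a \<in> free_carrier N. verma_map N s p \<Lambda> a \<in> H}"
    have sub: "H \<subseteq> carrier (verma_module N s p \<Lambda>)" using subgroup.subset[OF submodule.axioms(1)[OF H(1)]] by simp
    have image: "H = verma_map N s p \<Lambda> ` ?H"
    proof (intro subset_antisym subsetI)
      fix x assume x: "x \<in> H"
      with sub have "x \<in> verma_map N s p \<Lambda> ` free_carrier N"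
        unfolding presents_image[OF pres] by (rule subsetD)
      then obtain a where "x = verma_map N s p \<Lambda> a" "a \<in> free_carrier N" by (rule imageE)
      with x show "x \<in> verma_map N s p \<Lambda> ` ?H" by simp
    next
      fix x assume "x \<in> verma_map N s p \<Lambda> ` ?H"
      then obtain a where "x = verma_map N s p \<Lambda> a" "a \<in> ?H" by (rule imageE)
      then show "x \<in> H" by simp
    qed
    have zero: "\<zero>\<^bsub>verma_module N s p \<Lambda>\<^esub> \<in> H"
      using subgroup.one_closed[OF submodule.axioms(1)[OF H(1)]] by simp
    have "verma_kernel N s p \<Lambda> \<subseteq> ?H"
      unfolding ker[symmetric]
    proof
      fix a assume "a \<in> {a \<in> free_carrier N. verma_map N s p \<Lambda> a = \<zero>\<^bsub>verma_module N s p \<Lambda>\<^esub>}"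
      with zero show "a \<in> ?H" by simp
    qed
    moreover have "?H \<noteq> free_carrier N"
    proof
      assume "?H = free_carrier N"
      with image have "H = verma_map N s p \<Lambda> ` free_carrier N" by (simp only:)
      with H(2) presents_image[OF pres] show False by (simp only:)
    qed
    ultimately have "?H \<subseteq> P" by (rule proper[OF left_ideal_preimage[OF pres H(1)]])
    then have "verma_map N s p \<Lambda> ` ?H \<subseteq> verma_map N s p \<Lambda> ` P" by (rule image_mono)
    then show ?thesis unfolding image[symmetric] .
  qed
  then have union: "\<Union>(proper_submodules N s p \<Lambda>) \<subseteq> verma_map N s p \<Lambda> ` P"
    by (intro Union_least) (elim CollectE conjE)
  show ?thesis
    unfolding L_kernel_def maximal_submodule_def
    by (rule gen_submodule_preimage_minimal[OF pres P(1) _ union]) (simp only: ker P(2))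
qed

end

section \<open>Quotients of the free algebra as representations\<close>

definition fscale :: "complex \<Rightarrow> gen free_alg \<Rightarrow> gen free_alg"
  where "fscale c x = scalar c * x"

lemma scalar_simps:
  "scalar (a + b) = scalar a + scalar b" "scalar (a * b) = scalar a * scalar b"
  "scalar 1 = 1" "scalar 0 = 0" "scalar (- a) = - scalar a"
  by (simp_all add: scalar_def single_add mult_single single_uminus)

lemma scalar_minus_one_power: "scalar ((- 1) ^ n) = (- 1) ^ n"
  by (induction n) (simp_all add: scalar_simps)

lemma scalar_central: "x * scalar c = scalar c * x"
proof -
  have "(\<Sum>w\<in>Poly_Mapping.keys x. Poly_Mapping.single w (Poly_Mapping.lookup x w)) * scalar c
    = scalar c * (\<Sum>w\<in>Poly_Mapping.keys x. Poly_Mapping.single w (Poly_Mapping.lookup x w))"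
    by (simp add: scalar_def sum_distrib_left sum_distrib_right mult_single mult.commute)
  then show ?thesis by (simp add: sum_keys_single)
qed

lemma mult_fscale: "a * fscale c x = fscale c (a * x)"
  by (metis fscale_def mult.assoc scalar_central)

lemma fscale_mult: "fscale c x * b = fscale c (x * b)"
  by (simp add: fscale_def mult.assoc)

interpretation F: complex_vector_space fscale
  by unfold_locales (simp_all add: fscale_def scalar_simps algebra_simps)

text \<open>
  Combinations of words with at least one letter outside \<open>gens N\<close>.  They form a complement of the free
  algebra on \<open>gens N\<close> within the type, and they are closed under multiplication from the left.
\<close>

definition foreign_words :: "nat \<Rightarrow> gen free_alg set"
  where "foreign_words N = {f. \<forall>w\<in>Poly_Mapping.keys f. \<not> set (letters w) \<subseteq> gens N}"

lemma foreign_words_add: "x \<in> foreign_words N \<Longrightarrow> y \<in> foreign_words N \<Longrightarrow> x + y \<in> foreign_words N"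
  using keys_add[of x y] by (auto simp: foreign_words_def)

lemma foreign_words_mult: "x \<in> foreign_words N \<Longrightarrow> a * x \<in> foreign_words N"
proof -
  assume x: "x \<in> foreign_words N"
  have "\<not> set (letters w) \<subseteq> gens N" if w: "w \<in> Poly_Mapping.keys (a * x)" for w
  proof -
    obtain u v where "w = u + v" "v \<in> Poly_Mapping.keys x" using keys_mult[of a x] w by blast
    then show ?thesis using x by (auto simp: foreign_words_def plus_word_def)
  qed
  then show ?thesis by (simp add: foreign_words_def)
qed

lemma foreign_words_Int_carrier: "x \<in> foreign_words N \<Longrightarrow> x \<in> free_carrier N \<Longrightarrow> x = 0"
  by (auto simp: foreign_words_def free_algebra_def simp flip: keys_eq_empty)

lemma free_carrier_sum: "(\<And>i. i \<in> I \<Longrightarrow> f i \<in> free_carrier N) \<Longrightarrow> sum f I \<in> free_carrier N"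
  by (induction I rule: infinite_finite_induct) (simp_all add: free_carrier_closed)

lemma foreign_words_sum: "(\<And>i. i \<in> I \<Longrightarrow> f i \<in> foreign_words N) \<Longrightarrow> sum f I \<in> foreign_words N"
proof (induction I rule: infinite_finite_induct)
  case (insert i I)
  then show ?case by (simp add: foreign_words_add)
qed (simp_all add: foreign_words_def)

lemma free_carrier_decomposition: "\<exists>g\<in>free_carrier N. \<exists>b\<in>foreign_words N. f = g + b"
proof -
  let ?K = "Poly_Mapping.keys f" and ?s = "\<lambda>w. Poly_Mapping.single w (Poly_Mapping.lookup f w)"
  let ?G = "{w. set (letters w) \<subseteq> gens N}"
  have "f = sum ?s ?K" by (simp add: sum_keys_single)
  also have "\<dots> = sum ?s (?K \<inter> ?G) + sum ?s (?K - ?G)" by (rule sum.Int_Diff) simp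
  finally have "f = sum ?s (?K \<inter> ?G) + sum ?s (?K - ?G)" .
  moreover have "sum ?s (?K \<inter> ?G) \<in> free_carrier N"
    by (rule free_carrier_sum) (auto simp: free_algebra_def)
  moreover have "sum ?s (?K - ?G) \<in> foreign_words N"
    by (rule foreign_words_sum) (auto simp: foreign_words_def)
  ultimately show ?thesis by blast
qed

lemma level_kernel_mult:
  assumes a: "a \<in> level_kernel N s p" and b: "b \<in> free_carrier N"
  shows "a * b \<in> level_kernel N s p" "b * a \<in> level_kernel N s p"
proof -
  interpret R: ring "yangian_level N s p" by (rule yangian_level_ring)
  show "a * b \<in> level_kernel N s p" "b * a \<in> level_kernel N s p"
    using a b level_class_closed[OF b] by (simp_all add: level_kernel_def level_class_mult free_carrier_closed)
qed

lemma yangian_class_zero: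
  assumes "x \<in> yangian_ideal N s"
  shows "yangian_class N s x = \<zero>\<^bsub>yangian N s\<^esub>"
proof -
  interpret ideal "yangian_ideal N s" "free_algebra (gens N)" by (rule yangian_ideal)
  show ?thesis
    using a_rcos_const[OF assms] by (simp add: yangian_class_def yangian_def FactRing_def)
qed

lemma level_class_zero:
  assumes "yangian_class N s x \<in> level_ideal N s p"
  shows "level_class N s p x = \<zero>\<^bsub>yangian_level N s p\<^esub>"
proof -
  interpret ideal "level_ideal N s p" "yangian N s" by (rule level_ideal)
  show ?thesis
    using a_rcos_const[OF assms] by (simp add: level_class_def yangian_level_def FactRing_def)
qed

lemma yangian_rels_in_level_kernel:
  assumes "x \<in> yangian_rels N s"
  shows "x \<in> level_kernel N s p"
proof -
  have "x \<in> yangian_ideal N s"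
    unfolding yangian_ideal_def by (rule subsetD[OF ring.genideal_self[OF free_algebra_ring yangian_rels_closed] assms])
  then have "yangian_class N s x \<in> level_ideal N s p"
    using additive_subgroup.zero_closed[OF ideal.axioms(1)[OF level_ideal]] by (simp add: yangian_class_zero)
  then show ?thesis
    using subsetD[OF yangian_rels_closed assms] by (simp add: level_kernel_def level_class_zero)
qed

lemma tgen_in_level_kernel:
  assumes "a \<in> {1..N}" "b \<in> {1..N}" "p < r"
  shows "tgen a b r \<in> level_kernel N s p"
proof -
  let ?S = "{yangian_class N s (tgen i j r) | i j r. {i, j} \<subseteq> {1..N} \<and> r > p}"
  have "?S \<subseteq> level_ideal N s p"
    unfolding level_ideal_def by (rule ring.genideal_self[OF yangian_ring])
      (auto intro!: yangian_class_closed tgen_closed)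
  moreover have "yangian_class N s (tgen a b r) \<in> ?S"
    by (intro CollectI exI[of _ a] exI[of _ b] exI[of _ r] conjI refl) (use assms in auto)
  ultimately have "yangian_class N s (tgen a b r) \<in> level_ideal N s p" by (rule subsetD)
  then show ?thesis using assms by (simp add: level_kernel_def level_class_zero tgen_closed)
qed

text \<open>
  The quotient of the free algebra by \<open>H\<close> is realized inside the type of the free algebra, as the image of
  an idempotent linear map whose kernel is \<open>H\<close> together with the foreign words.
\<close>

locale cyclic_quotient =
  fixes N :: nat and s :: "nat \<Rightarrow> nat" and p :: nat and H :: "gen free_alg set"
  assumes H: "left_ideal N H" and level_kernel_subset: "level_kernel N s p \<subseteq> H"
begin

definition kernel :: "gen free_alg set"
  where "kernel = {x + y | x y. x \<in> H \<and> y \<in> foreign_words N}"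

lemma kernel_carrier: "a \<in> free_carrier N \<Longrightarrow> a \<in> kernel \<longleftrightarrow> a \<in> H"
proof
  assume a: "a \<in> free_carrier N" "a \<in> kernel"
  then obtain x y where xy: "a = x + y" "x \<in> H" "y \<in> foreign_words N" by (auto simp: kernel_def)
  then have "y = a - x" "x \<in> free_carrier N" using left_idealD(1)[OF H] by auto
  then have "y \<in> free_carrier N" using a(1) by (simp add: free_carrier_closed)
  then have "y = 0" using xy(3) by (rule foreign_words_Int_carrier[rotated])
  then show "a \<in> H" using xy by simp
next
  assume "a \<in> H"
  moreover have "0 \<in> foreign_words N" by (simp add: foreign_words_def)
  ultimately have "a + 0 \<in> kernel" unfolding kernel_def by blast
  then show "a \<in> kernel" by simp
qed

lemma kernel_mult:
  assumes "a \<in> free_carrier N" "x \<in> kernel"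
  shows "a * x \<in> kernel"
proof -
  obtain h y where "x = h + y" "h \<in> H" "y \<in> foreign_words N" using assms(2) by (auto simp: kernel_def)
  then have "a * x = a * h + a * y" "a * h \<in> H" "a * y \<in> foreign_words N"
    using left_idealD(4)[OF H assms(1)] by (simp_all add: distrib_left foreign_words_mult)
  then show ?thesis unfolding kernel_def by blast
qed

lemma subspace_kernel: "F.subspace kernel"
proof (rule F.subspaceI)
  show "0 \<in> kernel" using left_idealD(2)[OF H] by (simp add: kernel_carrier free_carrier_closed)
  show "x + y \<in> kernel" if xy: "x \<in> kernel" "y \<in> kernel" for x y
  proof -
    obtain a b where "x = a + b" "a \<in> H" "b \<in> foreign_words N" using xy(1) by (auto simp: kernel_def)
    moreover obtain c d where "y = c + d" "c \<in> H" "d \<in> foreign_words N" using xy(2) by (auto simp: kernel_def)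
    ultimately have "x + y = (a + c) + (b + d)" "a + c \<in> H" "b + d \<in> foreign_words N"
      using left_idealD(3)[OF H] by (auto simp: foreign_words_add algebra_simps)
    then show ?thesis unfolding kernel_def by blast
  qed
  show "fscale c x \<in> kernel" if "x \<in> kernel" for c x
    unfolding fscale_def by (rule kernel_mult[OF scalar_closed that])
qed

definition proj :: "gen free_alg \<Rightarrow> gen free_alg"
  where "proj = (SOME \<pi>. F.lin \<pi> \<and> (\<forall>x. \<pi> x = 0 \<longleftrightarrow> x \<in> kernel) \<and> (\<forall>x. \<pi> (\<pi> x) = \<pi> x))"

lemma proj: shows proj_lin: "F.lin proj" and proj_eq_0_kernel: "proj x = 0 \<longleftrightarrow> x \<in> kernel" and proj_proj: "proj (proj x) = proj x"
proof -
  obtain g where g: "F.lin g" "\<And>x. g x \<in> kernel" "\<And>x. x \<in> kernel \<Longrightarrow> g x = x"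
    using F.linear_projection_exists[OF subspace_kernel] by blast
  have "F.lin (\<lambda>x. x - g x) \<and> (\<forall>x. x - g x = 0 \<longleftrightarrow> x \<in> kernel) \<and> (\<forall>x. (x - g x) - g (x - g x) = x - g x)"
  proof (intro conjI allI)
    show "F.lin (\<lambda>x. x - g x)"
      by (rule F.linI) (simp_all add: F.lin_add[OF g(1)] F.lin_scale[OF g(1)] F.scale_right_diff_distrib)
    show "x - g x = 0 \<longleftrightarrow> x \<in> kernel" for x using g(2)[of x] g(3)[of x] by auto
    show "(x - g x) - g (x - g x) = x - g x" for x using g by (simp add: F.lin_diff[OF g(1)])
  qed
  then have "F.lin proj \<and> (\<forall>x. proj x = 0 \<longleftrightarrow> x \<in> kernel) \<and> (\<forall>x. proj (proj x) = proj x)"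
    unfolding proj_def by (intro someI_ex[where P = "\<lambda>\<pi>. F.lin \<pi> \<and> (\<forall>x. \<pi> x = 0 \<longleftrightarrow> x \<in> kernel) \<and> (\<forall>x. \<pi> (\<pi> x) = \<pi> x)"] exI)
  then show "F.lin proj" "proj x = 0 \<longleftrightarrow> x \<in> kernel" "proj (proj x) = proj x" by auto
qed

lemmas proj_add = F.lin_add[OF proj_lin] and proj_diff = F.lin_diff[OF proj_lin]
  and proj_scale = F.lin_scale[OF proj_lin] and proj_0 = F.lin_0[OF proj_lin]

lemma proj_eq_0_iff: "a \<in> free_carrier N \<Longrightarrow> proj a = 0 \<longleftrightarrow> a \<in> H"
  by (simp add: proj_eq_0_kernel kernel_carrier)

lemma proj_eq_iff: "a \<in> free_carrier N \<Longrightarrow> b \<in> free_carrier N \<Longrightarrow> proj a = proj b \<longleftrightarrow> a - b \<in> H"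
  using proj_eq_0_iff[of "a - b"] by (simp add: proj_diff free_carrier_closed)

lemma proj_mult_proj: "a \<in> free_carrier N \<Longrightarrow> proj (a * proj x) = proj (a * x)"
proof -
  assume a: "a \<in> free_carrier N"
  have "x - proj x \<in> kernel" by (simp add: proj_eq_0_kernel[symmetric] proj_diff proj_proj)
  from kernel_mult[OF a this] have "proj (a * (x - proj x)) = 0" by (simp add: proj_eq_0_kernel)
  then show ?thesis by (simp add: right_diff_distrib proj_diff)
qed

lemma proj_level_kernel: "a \<in> level_kernel N s p \<Longrightarrow> proj (a * x) = 0"
proof -
  assume a: "a \<in> level_kernel N s p"
  obtain g b where "g \<in> free_carrier N" "b \<in> foreign_words N" "x = g + b"
    using free_carrier_decomposition by blast
  then have "a * x = a * g + a * b" "a * g \<in> H" "a * b \<in> foreign_words N"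
    using level_kernel_mult(1)[OF a] level_kernel_subset foreign_words_mult by (auto simp: distrib_left)
  then show ?thesis unfolding proj_eq_0_kernel kernel_def by blast
qed

text \<open>
  For \<open>r = 0\<close> the operator is not composed with \<open>proj\<close>, so that \<open>t\<^sub>a\<^sub>a\<^sup>(\<^sup>0\<^sup>)\<close> is the identity on the whole type.
  All other generators annihilate the kernel of \<open>proj\<close>.
\<close>

definition op :: "nat \<Rightarrow> nat \<Rightarrow> nat \<Rightarrow> gen free_alg \<Rightarrow> gen free_alg"
  where "op a b r x = (if r = 0 then if a = b then x else 0 else proj (tgen a b r * x))"

lemma op_lin: "F.lin (op a b r)"
  by (rule F.linI) (simp_all add: op_def distrib_left proj_add mult_fscale proj_scale)

lemma proj_op: "proj (op a b r x) = proj (tgen a b r * x)"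
  by (simp add: op_def tgen_def proj_proj proj_0)

lemma proj_op_op:
  assumes "a \<in> {1..N}" "b \<in> {1..N}"
  shows "proj (op a b r (op c d q x)) = proj (tgen a b r * tgen c d q * x)"
proof -
  have a: "tgen a b r \<in> free_carrier N" using assms by (simp add: tgen_closed)
  have "proj (op a b r (op c d q x)) = proj (tgen a b r * proj (op c d q x))"
    by (simp only: proj_op[of a b r "op c d q x"] proj_mult_proj[OF a])
  also have "\<dots> = proj (tgen a b r * proj (tgen c d q * x))" by (simp only: proj_op)
  finally show ?thesis by (simp only: proj_mult_proj[OF a] mult.assoc)
qed

lemma op_op_proj: "r \<noteq> 0 \<or> q \<noteq> 0 \<Longrightarrow> proj (op a b r (op c d q x)) = op a b r (op c d q x)"
  by (auto simp: op_def proj_proj proj_0)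

sublocale level_representation fscale N s p op
proof (intro level_representation.intro F.complex_vector_space_axioms level_representation_axioms.intro op_lin)
  show "op a b 0 x = (if a = b then x else 0)" for a b x by (simp add: op_def)
  show "op a b r x = 0" if "a \<in> {1..N}" "b \<in> {1..N}" "p < r" for a b r x
    using proj_level_kernel[OF tgen_in_level_kernel[OF that]] that(3) by (simp add: op_def)
  fix i j k l r q x
  assume ijkl: "i \<in> {1..N}" "j \<in> {1..N}" "k \<in> {1..N}" "l \<in> {1..N}"
  let ?sg = "(s i + s j) * (s k + s l)" and ?ep = "s i * s j + s i * s k + s j * s k"
  let ?L = "(op i j (r + 1) (op k l q x) - fscale ((- 1) ^ ?sg) (op k l q (op i j (r + 1) x)))
      - (op i j r (op k l (q + 1) x) - fscale ((- 1) ^ ?sg) (op k l (q + 1) (op i j r x)))"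
  let ?R = "fscale ((- 1) ^ ?ep) (op k j r (op i l q x) - op k j q (op i l r x))"
  let ?X = "scomm s (i, j, r + 1) (k, l, q) - scomm s (i, j, r) (k, l, q + 1)
       - (-1) ^ ?ep * (tgen k j r * tgen i l q - tgen k j q * tgen i l r)"
  have "?X \<in> yangian_rels N s"
    unfolding yangian_rels_def by (intro CollectI exI conjI refl) (use ijkl in auto)
  then have X: "proj (?X * x) = 0" by (intro proj_level_kernel yangian_rels_in_level_kernel)
  have L: "proj ?L = ?L" by (simp add: proj_diff proj_scale op_op_proj)
  \<comment> \<open>For \<open>r = q = 0\<close> the operators on the right are not composed with \<open>proj\<close>, but the right-hand side is 0.\<close>
  have R: "proj ?R = ?R"
  proof (cases "r = 0 \<and> q = 0")
    case True
    then show ?thesis by (simp add: proj_0)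
  next
    case False
    then show ?thesis using op_op_proj[of r q k j i l x] op_op_proj[of q r k j i l x]
      by (auto simp: proj_diff proj_scale)
  qed
  have "?X * x = (tgen i j (r + 1) * tgen k l q * x - fscale ((- 1) ^ ?sg) (tgen k l q * tgen i j (r + 1) * x))
      - (tgen i j r * tgen k l (q + 1) * x - fscale ((- 1) ^ ?sg) (tgen k l (q + 1) * tgen i j r * x))
      - fscale ((- 1) ^ ?ep) (tgen k j r * tgen i l q * x - tgen k j q * tgen i l r * x)"
    by (simp add: scomm_def fscale_def scalar_minus_one_power left_diff_distrib right_diff_distrib mult.assoc)
  then have "proj (?X * x) = proj ?L - proj ?R"
    by (simp only: proj_diff proj_scale proj_op_op[OF ijkl(1,2)] proj_op_op[OF ijkl(3,4)]
        proj_op_op[OF ijkl(3,2)])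
  with X L R show "?L = ?R" by (simp only: right_minus_eq)
qed

lemma op_proj:
  assumes "a \<in> {1..N}" "b \<in> {1..N}"
  shows "op a b r (proj c) = proj (tgen a b r * c)"
proof (cases "r = 0")
  case True
  then show ?thesis by (simp add: op_def tgen_def proj_0)
next
  case False
  then show ?thesis using assms by (simp add: op_def proj_mult_proj tgen_closed)
qed

lemma act_proj:
  assumes "set w \<subseteq> gens N"
  shows "act w (proj b) = proj (Poly_Mapping.single (Word w) 1 * b)"
  using assms
proof (induction w)
  case Nil
  have "Poly_Mapping.single (Word []) 1 = (1 :: gen free_alg)" by (simp flip: zero_word_def)
  then show ?case by simp
next
  case (Cons g w)
  obtain a c r where g: "g = (a, c, r)" by (cases g)
  with Cons.prems have r: "a \<in> {1..N}" "c \<in> {1..N}" "r \<noteq> 0" by (auto simp: gens_def)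
  have "tgen a c r * Poly_Mapping.single (Word w) 1 = Poly_Mapping.single (Word (g # w)) 1"
    using r(3) g by (simp add: tgen_def mult_single plus_word_def)
  moreover have "act (g # w) (proj b) = op a c r (proj (Poly_Mapping.single (Word w) 1 * b))"
    using Cons g by simp
  ultimately show ?case using r by (simp add: op_proj mult.assoc[symmetric])
qed

lemma cyc_proj: "cyc (proj b) = {proj (a * b) | a. a \<in> free_carrier N}"
proof (intro equalityI subsetI)
  let ?S = "{proj (a * b) | a. a \<in> free_carrier N}"
  have "F.subspace ?S"
  proof (rule F.subspaceI)
    show "0 \<in> ?S" by (intro CollectI exI[of _ 0]) (simp add: proj_0 free_carrier_closed)
    show "x + y \<in> ?S" if xy: "x \<in> ?S" "y \<in> ?S" for x y
    proof -
      obtain a where "x = proj (a * b)" "a \<in> free_carrier N" using xy(1) by blast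
      moreover obtain c where "y = proj (c * b)" "c \<in> free_carrier N" using xy(2) by blast
      ultimately show ?thesis
        by (intro CollectI exI[of _ "a + c"]) (simp add: proj_add distrib_right free_carrier_closed)
    qed
    show "fscale c x \<in> ?S" if x: "x \<in> ?S" for c x
    proof -
      obtain a where "x = proj (a * b)" "a \<in> free_carrier N" using x by blast
      then show ?thesis
        by (intro CollectI exI[of _ "fscale c a"])
          (simp add: proj_scale fscale_mult, simp add: fscale_def free_carrier_closed)
    qed
  qed
  moreover have "act w (proj b) \<in> ?S" if "set w \<subseteq> gens N" for w
    using act_proj[OF that, of b] that
    by (intro CollectI exI[of _ "Poly_Mapping.single (Word w) 1"]) (simp add: free_algebra_def)
  ultimately have "cyc (proj b) \<subseteq> ?S"
    unfolding cyc_def by (intro F.span_minimal) blast+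
  then show "x \<in> ?S" if "x \<in> cyc (proj b)" for x using that by blast
  show "x \<in> cyc (proj b)" if x: "x \<in> ?S" for x
  proof -
    obtain a where a: "x = proj (a * b)" "a \<in> free_carrier N" using x by blast
    have "a * b = (\<Sum>w\<in>Poly_Mapping.keys a. Poly_Mapping.single w (Poly_Mapping.lookup a w)) * b"
      by (simp add: sum_keys_single)
    also have "\<dots> = (\<Sum>w\<in>Poly_Mapping.keys a. fscale (Poly_Mapping.lookup a w) (Poly_Mapping.single w 1 * b))"
      by (simp add: sum_distrib_right fscale_def scalar_def mult_single mult.assoc[symmetric])
    finally have "x = (\<Sum>w\<in>Poly_Mapping.keys a. fscale (Poly_Mapping.lookup a w) (act (letters w) (proj b)))"
      using a act_proj[of "letters _" b]
      by (simp add: F.lin_sum[OF proj_lin] proj_scale free_algebra_def)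
    also have "\<dots> \<in> cyc (proj b)"
      unfolding cyc_def
    proof (intro F.span_sum F.span_scale F.span_base)
      fix w assume "w \<in> Poly_Mapping.keys a"
      then have "set (letters w) \<subseteq> gens N" using a(2) by (simp add: free_algebra_def)
      then show "act (letters w) (proj b) \<in> {act w (proj b) | w. set w \<subseteq> gens N}" by blast
    qed
    finally show ?thesis .
  qed
qed

lemma cyc_one: "cyc (proj 1) = {proj a | a. a \<in> free_carrier N}"
  using cyc_proj[of 1] by simp

lemma highest_vector_one:
  assumes gens: "verma_generators N p \<Lambda> \<subseteq> H"
    and deg: "\<forall>j\<in>{1..N}. degree (\<Lambda> j) \<le> p"
  shows "highest_vector \<Lambda> (proj 1)"
proof -
  have "singular (proj 1)"
    unfolding singular_def
  proof (intro allI impI)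
    fix a b r assume ab: "a \<in> {1..N}" "b \<in> {1..N}" "a < b"
    show "op a b r (proj 1) = 0"
    proof (cases "r \<le> p")
      case True
      with ab have "tgen a b r \<in> verma_generators N p \<Lambda>" by (auto simp: verma_generators_def)
      with gens ab show ?thesis by (auto simp: op_proj proj_eq_0_iff tgen_closed)
    next
      case False
      with ab t_level show ?thesis by auto
    qed
  qed
  moreover have "T j j u (proj 1) = fscale (poly (\<Lambda> j) u) (proj 1)" if j: "j \<in> {1..N}" for j u
  proof -
    have c: "op j j (p - d) (proj 1) = fscale (coeff (\<Lambda> j) d) (proj 1)" if "d \<le> p" for d
    proof -
      have "tgen j j (p - d) - scalar (coeff (\<Lambda> j) d) \<in> verma_generators N p \<Lambda>"
        unfolding verma_generators_def by (intro UnI2 CollectI exI[of _ j] exI[of _ d] conjI refl j that)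
      with gens have "tgen j j (p - d) - scalar (coeff (\<Lambda> j) d) \<in> H" by (rule subsetD)
      then have "proj (tgen j j (p - d)) = proj (scalar (coeff (\<Lambda> j) d))"
        using j by (simp add: proj_eq_iff tgen_closed scalar_closed)
      also have "\<dots> = fscale (coeff (\<Lambda> j) d) (proj 1)"
        using proj_scale[of _ 1] by (simp add: fscale_def)
      finally show ?thesis using j by (simp add: op_proj)
    qed
    have "poly (\<Lambda> j) u = (\<Sum>d\<le>p. u ^ d * coeff (\<Lambda> j) d)"
      unfolding poly_altdef
      by (rule sum.mono_neutral_cong_left) (use bspec[OF deg j] in \<open>auto simp: coeff_eq_0 mult.commute\<close>)
    then show ?thesis by (simp add: T_def c F.scale_sum_left)
  qed
  ultimately show ?thesis by (simp add: highest_vector_def)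
qed

end

text \<open>
  By \<open>cyc_highest_vector\<close> a left ideal \<open>H\<close> that contains the kernel of the Verma module and whose image
  is not contained in the higher part contains 1.  So all proper ones lie in \<open>P\<close>, the largest
  left ideal that is mapped into the higher part, and 1 does not belong to \<open>P\<close>.
\<close>

lemma L_kernel_proper:
  assumes deg: "\<forall>j\<in>{1..N}. degree (\<Lambda> j) \<le> p"
    and ne: "verma_kernel N s p \<Lambda> \<noteq> free_carrier N"
  shows "L_kernel N s p \<Lambda> \<noteq> free_carrier N"
proof -
  let ?J = "verma_kernel N s p \<Lambda>"
  have J: "left_ideal N ?J" by (rule left_ideal_verma_kernel[OF deg])
  interpret Q: cyclic_quotient N s p ?J
    by (rule cyclic_quotient.intro[OF J]) (rule level_kernel_subset_verma_kernel[OF deg])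
  let ?\<xi> = "Q.proj 1"
  have hv: "Q.highest_vector \<Lambda> ?\<xi>" by (rule Q.highest_vector_one[OF verma_generators_in_kernel[OF deg] deg])
  have sing: "Q.singular ?\<xi>" using hv by (simp add: Q.highest_vector_def)
  obtain e where e: "Q.E ?\<xi> = fscale e ?\<xi>" using Q.highest_vector_E[OF hv deg] by blast
  have "1 \<notin> ?J" using left_ideal_eq_carrier_iff[OF J] ne by blast
  then have \<xi>0: "?\<xi> \<noteq> 0" by (simp add: Q.proj_eq_0_iff free_carrier_closed)
  let ?P = "{a \<in> free_carrier N. \<forall>b\<in>free_carrier N. Q.proj (b * a) \<in> F.higher_part Q.E e}"
  note sub = F.subspace_higher_part[OF Q.E_lin, of e]
  have P: "left_ideal N ?P"
  proof (rule left_idealI)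
    show "0 \<in> ?P" by (simp add: free_carrier_closed Q.proj_0 F.subspace_0[OF sub])
    show "a + b \<in> ?P" if "a \<in> ?P" "b \<in> ?P" for a b
      using that by (simp add: free_carrier_closed distrib_left Q.proj_add F.subspace_add[OF sub])
    show "a * b \<in> ?P" if "a \<in> free_carrier N" "b \<in> ?P" for a b
      using that by (simp add: free_carrier_closed mult.assoc[symmetric])
  qed auto
  have J_P: "?J \<subseteq> ?P"
  proof
    fix a assume a: "a \<in> ?J"
    have "Q.proj (b * a) = 0" if "b \<in> free_carrier N" for b
      using left_idealD(4)[OF J that a] left_idealD(1)[OF J] by (simp add: Q.proj_eq_0_iff subset_iff)
    then show "a \<in> ?P" using a left_idealD(1)[OF J] F.subspace_0[OF sub] by auto
  qed
  have H_P: "H \<subseteq> ?P" if H: "left_ideal N H" "?J \<subseteq> H" "H \<noteq> free_carrier N" for H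
  proof -
    have H1: "1 \<notin> H" using left_ideal_eq_carrier_iff[OF H(1)] H(3) by blast
    have Hc: "h \<in> free_carrier N" if "h \<in> H" for h using left_idealD(1)[OF H(1)] that by blast
    have higher: "Q.proj h \<in> F.higher_part Q.E e" if h: "h \<in> H" for h
    proof -
      have "Q.proj h \<in> Q.cyc ?\<xi>" using Hc[OF h] by (auto simp: Q.cyc_one)
      from Q.cyc_highest_vector[OF sing e Q.highest_vector_diagonal[OF hv _ bspec[OF deg]] this]
      obtain c y where cy: "Q.proj h = fscale c ?\<xi> + y" "y \<in> F.higher_part Q.E e" by blast
      let ?W = "Q.proj ` H"
      have W: "F.subspace ?W"
      proof (rule F.subspaceI)
        show "0 \<in> ?W" using imageI[OF left_idealD(2)[OF H(1)], of Q.proj] by (simp add: Q.proj_0)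
        show "x + y \<in> ?W" if "x \<in> ?W" "y \<in> ?W" for x y
          using that left_idealD(3)[OF H(1)] by (auto simp: Q.proj_add[symmetric])
        show "fscale c x \<in> ?W" if "x \<in> ?W" for c x
        proof -
          obtain h where "x = Q.proj h" "h \<in> H" using \<open>x \<in> ?W\<close> by (rule imageE)
          then have "fscale c x = Q.proj (scalar c * h)" "scalar c * h \<in> H"
            using left_idealD(4)[OF H(1) scalar_closed] Q.proj_scale[of c h] by (simp_all add: fscale_def)
          then show ?thesis by simp
        qed
      qed
      have WE: "Q.E x \<in> ?W" if x: "x \<in> ?W" for x
      proof -
        obtain h where h: "h \<in> H" "x = Q.proj h" using x by blast
        have "Q.op j j 1 x \<in> ?W" if j: "j \<in> {1..N}" for j
          using left_idealD(4)[OF H(1) tgen_closed h(1), of j j 1] j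
          unfolding h(2) Q.op_proj[OF j j] by simp
        then show ?thesis unfolding Q.E_def by (intro F.subspace_sum[OF W] F.subspace_scale[OF W])
      qed
      have "c = 0"
      proof (rule ccontr)
        assume "c \<noteq> 0"
        have "fscale c ?\<xi> + y \<in> ?W" using h cy(1) by (metis imageI)
        from F.subspace_contains_lowest_eigenvector[OF Q.E_lin W WE e cy(2) this \<open>c \<noteq> 0\<close>]
        obtain h' where h': "h' \<in> H" "Q.proj 1 = Q.proj h'" by blast
        then have "1 - h' \<in> ?J" using Hc[OF h'(1)] by (simp add: Q.proj_eq_iff free_carrier_closed)
        then have "1 - h' + h' \<in> H" using left_idealD(3)[OF H(1) _ h'(1)] H(2) by blast
        with H1 show False by simp
      qed
      with cy show ?thesis by simp
    qed
    show ?thesis using higher left_idealD(4)[OF H(1)] Hc by blast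
  qed
  have "L_kernel N s p \<Lambda> \<subseteq> ?P" by (rule L_kernel_minimal[OF deg P J_P H_P])
  moreover have "1 \<notin> ?P"
  proof
    assume "1 \<in> ?P"
    then have "Q.proj (1 * 1) \<in> F.higher_part Q.E e" using free_algebra_one_closed by blast
    then show False using F.lowest_eigenvector_notin_higher_part[OF Q.E_lin e \<xi>0] by simp
  qed
  ultimately show ?thesis using free_algebra_one_closed by blast
qed

section \<open>The isomorphism of irreducible modules\<close>

text \<open>
  A left ideal that is larger than the kernel contains 1, because all proper left ideals above the
  kernel of the Verma module are contained in the kernel.
\<close>

lemma L_kernel_maximal:
  assumes deg: "\<forall>j\<in>{1..N}. degree (\<Lambda> j) \<le> p"
    and a: "a \<in> free_carrier N" "a \<notin> L_kernel N s p \<Lambda>"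
  shows "\<exists>b\<in>free_carrier N. b * a - 1 \<in> L_kernel N s p \<Lambda>"
proof -
  let ?K = "L_kernel N s p \<Lambda>"
  have K: "left_ideal N ?K" by (rule left_ideal_L_kernel[OF deg])
  let ?H = "{k + b * a | k b. k \<in> ?K \<and> b \<in> free_carrier N}"
  have Kc: "k \<in> free_carrier N" if "k \<in> ?K" for k using left_idealD(1)[OF K] that by blast
  have HI: "k + b * a \<in> ?H" if "k \<in> ?K" "b \<in> free_carrier N" for k b using that by blast
  have H: "left_ideal N ?H"
  proof (rule left_idealI)
    show "?H \<subseteq> free_carrier N" using Kc a(1) by (auto intro: free_carrier_closed)
    show "0 \<in> ?H" using HI[OF left_idealD(2)[OF K] free_carrier_0] by simp
    show "x + y \<in> ?H" if xy: "x \<in> ?H" "y \<in> ?H" for x y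
    proof -
      obtain k b where x: "x = k + b * a" "k \<in> ?K" "b \<in> free_carrier N" using xy(1) by blast
      obtain k' b' where y: "y = k' + b' * a" "k' \<in> ?K" "b' \<in> free_carrier N" using xy(2) by blast
      have "x + y = (k + k') + (b + b') * a" by (simp add: x y algebra_simps)
      then show ?thesis using HI[OF left_idealD(3)[OF K x(2) y(2)] free_carrier_add[OF x(3) y(3)]] by simp
    qed
    show "c * x \<in> ?H" if c: "c \<in> free_carrier N" and "x \<in> ?H" for c x
    proof -
      obtain k b where x: "x = k + b * a" "k \<in> ?K" "b \<in> free_carrier N" using \<open>x \<in> ?H\<close> by blast
      have "c * x = c * k + (c * b) * a" by (simp add: x algebra_simps)
      then show ?thesis using HI[OF left_idealD(4)[OF K c x(2)] free_algebra_mult_closed[OF c x(3)]] by simp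
    qed
  qed
  have "?K \<subseteq> ?H" using HI[OF _ free_carrier_0] by auto
  then have "verma_kernel N s p \<Lambda> \<subseteq> ?H" using verma_kernel_subset_L_kernel[OF deg] by blast
  moreover have "a \<in> ?H" using HI[OF left_idealD(2)[OF K] free_algebra_one_closed] by simp
  ultimately have "?H = free_carrier N"
    using proper_left_ideal_subset_L_kernel[OF deg H] a(2) by blast
  then have "1 \<in> ?H" by (simp add: free_algebra_one_closed)
  then obtain k b where kb: "1 = k + b * a" "k \<in> ?K" "b \<in> free_carrier N" by blast
  then have "b * a - 1 = - k" by (simp add: algebra_simps)
  with kb left_ideal_uminus[OF K kb(2)] show ?thesis by (intro bexI[of _ b]) simp_all
qed

lemma L_module_zero:
  assumes deg: "\<forall>j\<in>{1..N}. degree (\<Lambda> j) \<le> p"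
    and "verma_kernel N s p \<Lambda> = free_carrier N"
  shows "carrier (L_module N s p \<Lambda>) = {\<zero>\<^bsub>L_module N s p \<Lambda>\<^esub>}"
proof -
  have "L_map N s p \<Lambda> a = \<zero>\<^bsub>L_module N s p \<Lambda>\<^esub>" if "a \<in> free_carrier N" for a
  proof -
    have "a \<in> L_kernel N s p \<Lambda>"
      using subsetD[OF verma_kernel_subset_L_kernel[OF deg]] that assms(2) by simp
    then show ?thesis using L_map_eq_0_iff[OF deg that] by simp
  qed
  then have "L_map N s p \<Lambda> ` free_carrier N = {\<zero>\<^bsub>L_module N s p \<Lambda>\<^esub>}"
    using free_carrier_0 by (intro subset_antisym subsetI) (auto intro: image_eqI)
  then show ?thesis using presents_image[OF presents_L[OF deg]] by simp
qed

lemma L_module_nonzero: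
  assumes deg: "\<forall>j\<in>{1..N}. degree (\<Lambda> j) \<le> p"
    and "verma_kernel N s p \<Lambda> \<noteq> free_carrier N"
  shows "carrier (L_module N s p \<Lambda>) \<noteq> {x}"
proof
  assume x: "carrier (L_module N s p \<Lambda>) = {x}"
  note pres = presents_L[OF deg, of s]
  have "L_map N s p \<Lambda> 1 = x" "L_map N s p \<Lambda> 0 = x"
    using presents_closed[OF pres free_algebra_one_closed] presents_closed[OF pres free_carrier_0] x by simp_all
  then have "L_map N s p \<Lambda> 1 = \<zero>\<^bsub>L_module N s p \<Lambda>\<^esub>" using presents_0[OF pres] by simp
  then have "1 \<in> L_kernel N s p \<Lambda>" using L_map_eq_0_iff[OF deg free_algebra_one_closed] by simp
  then show False
    using L_kernel_proper[OF deg assms(2)] left_ideal_eq_carrier_iff[OF left_ideal_L_kernel[OF deg]] by simp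
qed

text \<open>
  Let \<open>y\<close> represent the reflected vector.  The left ideal \<open>H\<close> of all \<open>a\<close> whose re-labelling annihilates this
  vector contains the generators for \<open>\<Lambda>'\<close>, and it is maximal, because \<open>L_module N s p \<Lambda>\<close> is irreducible.  Hence
  it coincides with the kernel of \<open>L_map\<close> for \<open>\<Lambda>'\<close>, and \<open>a \<mapsto> \<rho> a * y\<close> induces the isomorphism.
\<close>

theorem reflection_isomorphism:
  fixes \<Lambda> \<Lambda>' :: "nat \<Rightarrow> complex poly" and i :: nat
  defines "\<sigma> \<equiv> transpose i (i + 1)"
  assumes i: "i \<in> {1..N}" "i + 1 \<in> {1..N}" and par: "s i + s (i + 1) = 1"
    and deg: "\<forall>j\<in>{1..N}. degree (\<Lambda> j) \<le> p" and deg': "\<forall>j\<in>{1..N}. degree (\<Lambda>' j) \<le> p"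
    and \<Lambda>: "\<And>u. poly (\<Lambda> i) u = root_poly fs u * root_poly hs u"
      "\<And>u. poly (\<Lambda> (i + 1)) u = root_poly gs u * root_poly hs u"
    and \<Lambda>': "\<And>u. poly (\<Lambda>' i) u = root_poly gs (u - (- 1) ^ s i) * root_poly hs u"
      "\<And>u. poly (\<Lambda>' (i + 1)) u = root_poly fs (u - (- 1) ^ s i) * root_poly hs u"
      "\<And>j. j \<noteq> i \<Longrightarrow> j \<noteq> i + 1 \<Longrightarrow> \<Lambda>' j = \<Lambda> j"
    and len: "length fs + length hs = p" and coprime: "set fs \<inter> set gs = {}"
    and ne: "verma_kernel N s p \<Lambda> \<noteq> free_carrier N"
  shows "modules_isomorphic (yangian_level N (s \<circ> \<sigma>) p)
    (pullback_module (relabel_level \<sigma>) (L_module N s p \<Lambda>)) (L_module N (s \<circ> \<sigma>) p \<Lambda>')"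
proof -
  let ?s = "s \<circ> \<sigma>"
  define \<rho> where "\<rho> = relabel (relabel_gen \<sigma>)"
  define K where "K = L_kernel N s p \<Lambda>"
  have \<sigma>: "\<sigma> \<circ> \<sigma> = id" by (auto simp: \<sigma>_def)
  have \<sigma>N: "\<sigma> j \<in> {1..N}" if "j \<in> {1..N}" for j using i that by (auto simp: \<sigma>_def transpose_def)
  then have \<sigma>': "\<sigma> ` {1..N} \<subseteq> {1..N}" by blast
  have \<rho>_closed: "\<rho> a \<in> free_carrier N" if "a \<in> free_carrier N" for a
    unfolding \<rho>_def by (rule relabel_closed[OF _ that]) (use \<sigma>N in \<open>auto simp: gens_def\<close>)
  have \<rho>_\<rho>: "\<rho> (\<rho> a) = a" for a
  proof -
    have "relabel_gen \<sigma> \<circ> relabel_gen \<sigma> = id" using invol[OF \<sigma> \<sigma>'] by (auto simp: fun_eq_iff)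
    then show ?thesis by (simp add: \<rho>_def relabel_relabel relabel_id)
  qed
  have \<rho>_simps: "\<rho> (a * b) = \<rho> a * \<rho> b" "\<rho> (a + b) = \<rho> a + \<rho> b" "\<rho> (a - b) = \<rho> a - \<rho> b" "\<rho> 1 = 1" "\<rho> 0 = 0" for a b
    by (simp_all add: \<rho>_def relabel_mult relabel_add relabel_diff)
  have \<rho>_level: "relabel_level \<sigma> (level_class N ?s p a) = level_class N s p (\<rho> a)" if "a \<in> free_carrier N" for a
    unfolding \<rho>_def by (rule relabel_level_class[OF \<sigma> \<sigma>' that])

  have K: "left_ideal N K" unfolding K_def by (rule left_ideal_L_kernel[OF deg])
  have vK: "verma_kernel N s p \<Lambda> \<subseteq> K" unfolding K_def by (rule verma_kernel_subset_L_kernel[OF deg])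
  have lK: "level_kernel N s p \<subseteq> K" using level_kernel_subset_verma_kernel[OF deg] vK by blast
  have gK: "verma_generators N p \<Lambda> \<subseteq> K" using verma_generators_in_kernel[OF deg] vK by blast
  have K1: "1 \<notin> K" using L_kernel_proper[OF deg ne] left_ideal_eq_carrier_iff[OF K] unfolding K_def by blast
  note K_maximal = L_kernel_maximal[OF deg, of _ s, folded K_def]
  interpret Q: cyclic_quotient N s p K by (rule cyclic_quotient.intro[OF K lK])
  have hv: "Q.highest_vector \<Lambda> (Q.proj 1)" by (rule Q.highest_vector_one[OF gK deg])
  have \<xi>0: "Q.proj 1 \<noteq> 0" using K1 by (simp add: Q.proj_eq_0_iff free_carrier_closed)
  have irr: "Q.proj 1 \<in> Q.cyc y" if y: "y \<in> Q.cyc (Q.proj 1)" "y \<noteq> 0" for y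
  proof -
    obtain a where a: "y = Q.proj a" "a \<in> free_carrier N" using y(1) by (auto simp: Q.cyc_one)
    then have "a \<notin> K" using y(2) by (simp add: Q.proj_eq_0_iff)
    then obtain b where b: "b \<in> free_carrier N" "b * a - 1 \<in> K" using K_maximal[OF a(2)] by blast
    then have "Q.proj (b * a) = Q.proj 1" using a(2) by (simp add: Q.proj_eq_iff free_carrier_closed)
    then show ?thesis unfolding a(1) Q.cyc_proj using b(1) by (intro CollectI exI[of _ b]) simp
  qed
  obtain \<eta> where \<eta>: "\<eta> \<in> Q.cyc (Q.proj 1)" "\<eta> \<noteq> 0"
    "\<forall>a\<in>{1..N}. \<forall>b\<in>{1..N}. a < b \<and> (a, b) \<noteq> (i, i + 1) \<or> (a, b) = (i + 1, i) \<longrightarrow> (\<forall>u. Q.T a b u \<eta> = 0)"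
    "\<forall>u. Q.T i i u \<eta> = fscale (root_poly fs (u - (- 1) ^ s i) * root_poly hs u) \<eta>"
    "\<forall>u. Q.T (i + 1) (i + 1) u \<eta> = fscale (root_poly gs (u - (- 1) ^ s i) * root_poly hs u) \<eta>"
    "\<forall>j\<in>{1..N}. j \<noteq> i \<longrightarrow> j \<noteq> i + 1 \<longrightarrow> (\<forall>u. Q.T j j u \<eta> = fscale (poly (\<Lambda> j) u) \<eta>)"
    by (rule Q.reflected_vector_exists[OF i par \<xi>0 hv deg irr \<Lambda> len coprime])
  obtain y where y: "\<eta> = Q.proj y" "y \<in> free_carrier N" using \<eta>(1) by (auto simp: Q.cyc_one)
  have yK: "y \<notin> K" using \<eta>(2) y by (simp add: Q.proj_eq_0_iff)

  define H where "H = {a \<in> free_carrier N. \<rho> a * y \<in> K}"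
  have H: "left_ideal N H"
  proof (rule left_idealI)
    show "H \<subseteq> free_carrier N" by (auto simp: H_def)
    show "0 \<in> H" using left_idealD(2)[OF K] by (simp add: H_def free_carrier_closed \<rho>_simps)
    show "a + b \<in> H" if "a \<in> H" "b \<in> H" for a b
      using that left_idealD(3)[OF K] by (simp add: H_def free_carrier_closed \<rho>_simps distrib_right)
    show "a * b \<in> H" if "a \<in> free_carrier N" "b \<in> H" for a b
      using that left_idealD(4)[OF K \<rho>_closed] by (simp add: H_def free_carrier_closed \<rho>_simps mult.assoc)
  qed
  have H1: "1 \<notin> H" using yK by (simp add: H_def \<rho>_simps)
  have lH: "level_kernel N ?s p \<subseteq> H"
  proof
    fix a assume a: "a \<in> level_kernel N ?s p"
    then have ac: "a \<in> free_carrier N" "level_class N ?s p a = \<zero>\<^bsub>yangian_level N ?s p\<^esub>" by (simp_all add: level_kernel_def)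
    have "relabel_level \<sigma> \<in> ring_hom (yangian_level N ?s p) (yangian_level N s p)"
      using relabel_level_iso[OF \<sigma> \<sigma>'] by (simp add: ring_iso_def)
    then have "relabel_level \<sigma> \<zero>\<^bsub>yangian_level N ?s p\<^esub> = \<zero>\<^bsub>yangian_level N s p\<^esub>"
      by (rule ring_hom_zero[OF _ yangian_level_ring yangian_level_ring])
    then have "\<rho> a \<in> level_kernel N s p"
      using \<rho>_level[OF ac(1)] ac(2) \<rho>_closed[OF ac(1)] by (simp add: level_kernel_def)
    then have "\<rho> a * y \<in> K" using level_kernel_mult(1)[OF _ y(2)] lK by blast
    with ac show "a \<in> H" by (simp add: H_def)
  qed
  have gH: "verma_generators N p \<Lambda>' \<subseteq> H"
  proof
    fix g assume "g \<in> verma_generators N p \<Lambda>'"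
    then consider a b r where "a \<in> {1..N}" "b \<in> {1..N}" "a < b" "g = tgen a b r"
      | j d where "j \<in> {1..N}" "d \<le> p" "g = tgen j j (p - d) - scalar (coeff (\<Lambda>' j) d)"
      unfolding verma_generators_def by auto
    then show "g \<in> H"
    proof cases
      case 1
      have ab: "\<sigma> a \<in> {1..N}" "\<sigma> b \<in> {1..N}" using 1 \<sigma>N by blast+
      have "\<sigma> a < \<sigma> b \<and> (\<sigma> a, \<sigma> b) \<noteq> (i, i + 1) \<or> (\<sigma> a, \<sigma> b) = (i + 1, i)"
        using 1(3) by (auto simp: \<sigma>_def transpose_def)
      then have "\<forall>u. Q.T (\<sigma> a) (\<sigma> b) u \<eta> = 0" using \<eta>(3) ab by blast
      then have "Q.op (\<sigma> a) (\<sigma> b) r \<eta> = 0" using Q.T_eq_0_iff[OF ab] by blast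
      then have "Q.proj (tgen (\<sigma> a) (\<sigma> b) r * y) = 0" using Q.op_proj[OF ab] y(1) by simp
      then have "tgen (\<sigma> a) (\<sigma> b) r * y \<in> K"
        using ab y(2) by (simp add: Q.proj_eq_0_iff free_carrier_closed tgen_closed)
      moreover have "\<rho> g = tgen (\<sigma> a) (\<sigma> b) r" unfolding \<rho>_def 1(4) by (rule relabel_tgen[OF \<sigma> \<sigma>'])
      ultimately show ?thesis using 1 by (simp add: H_def tgen_closed)
    next
      case 2
      note jd = 2
      have j: "\<sigma> j \<in> {1..N}" using 2 \<sigma>N by blast
      have "Q.T (\<sigma> j) (\<sigma> j) u \<eta> = fscale (poly (\<Lambda>' j) u) \<eta>" for u
      proof -
        consider "j = i" | "j = i + 1" | "j \<noteq> i" "j \<noteq> i + 1" by blast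
        then show ?thesis
        proof cases
          case 1
          then have "\<sigma> j = i + 1" by (simp add: \<sigma>_def)
          with 1 show ?thesis using \<eta>(5) \<Lambda>'(1) by simp
        next
          case 2
          then have "\<sigma> j = i" by (simp add: \<sigma>_def)
          with 2 show ?thesis using \<eta>(4) \<Lambda>'(2) by simp
        next
          case 3
          then have "\<sigma> j = j" by (simp add: \<sigma>_def transpose_def)
          with 3 show ?thesis using \<eta>(6) jd(1) \<Lambda>'(3) by simp
        qed
      qed
      then have "Q.op (\<sigma> j) (\<sigma> j) (p - d) \<eta> = fscale (coeff (\<Lambda>' j) (p - (p - d))) \<eta>"
        by (intro Q.T_coefficients[OF Q.T_sum_coefficients[OF _ bspec[OF deg' 2(1)]]]) simp_all
      then have "Q.proj (tgen (\<sigma> j) (\<sigma> j) (p - d) * y) = Q.proj (scalar (coeff (\<Lambda>' j) d) * y)"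
        using Q.op_proj[OF j j] 2(2) y(1) Q.proj_scale[of "coeff (\<Lambda>' j) d" y] by (simp add: fscale_def)
      then have "(tgen (\<sigma> j) (\<sigma> j) (p - d) - scalar (coeff (\<Lambda>' j) d)) * y \<in> K"
        using j y(2) by (simp add: Q.proj_eq_iff free_carrier_closed tgen_closed left_diff_distrib)
      moreover have "\<rho> g = tgen (\<sigma> j) (\<sigma> j) (p - d) - scalar (coeff (\<Lambda>' j) d)"
        unfolding 2(3) \<rho>_simps by (simp add: \<rho>_def relabel_tgen[OF \<sigma> \<sigma>'] relabel_scalar)
      ultimately show ?thesis using 2 by (simp add: H_def free_carrier_closed tgen_closed)
    qed
  qed

  have vH: "verma_kernel N ?s p \<Lambda>' \<subseteq> H" by (rule verma_kernel_minimal[OF deg' H lH gH])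
  have Hne: "H \<noteq> free_carrier N" using H1 free_algebra_one_closed by blast
  have ne': "verma_kernel N ?s p \<Lambda>' \<noteq> free_carrier N" using vH H1 free_algebra_one_closed by blast
  define K' where "K' = L_kernel N ?s p \<Lambda>'"
  have K': "left_ideal N K'" unfolding K'_def by (rule left_ideal_L_kernel[OF deg'])
  have K'1: "1 \<notin> K'" using L_kernel_proper[OF deg' ne'] left_ideal_eq_carrier_iff[OF K'] unfolding K'_def by blast
  have HK': "H \<subseteq> K'" unfolding K'_def by (rule proper_left_ideal_subset_L_kernel[OF deg' H vH Hne])
  have K'H: "K' \<subseteq> H"
  proof
    fix a assume a: "a \<in> K'"
    have ac: "a \<in> free_carrier N" using left_idealD(1)[OF K'] a by blast
    show "a \<in> H"
    proof (rule ccontr)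
      assume "a \<notin> H"
      then have "\<rho> a * y \<notin> K" using ac by (simp add: H_def)
      then obtain b where b: "b \<in> free_carrier N" "b * (\<rho> a * y) - 1 \<in> K"
        using K_maximal[of "\<rho> a * y"] \<rho>_closed[OF ac] y(2) free_algebra_mult_closed by blast
      \<comment> \<open>With \<open>b * (\<rho> a * y) = 1\<close> modulo \<open>K\<close>, the product of \<open>\<rho> (y * b)\<close> and \<open>a\<close> is 1 modulo \<open>H\<close>.\<close>
      let ?b = "\<rho> (y * b)"
      have bc: "?b \<in> free_carrier N" using \<rho>_closed y(2) b(1) by (simp add: free_carrier_closed)
      have "y * (b * (\<rho> a * y) - 1) \<in> K" by (rule left_idealD(4)[OF K y(2) b(2)])
      also have "y * (b * (\<rho> a * y) - 1) = \<rho> (?b * a - 1) * y"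
        by (simp add: \<rho>_simps \<rho>_\<rho> algebra_simps)
      finally have "?b * a - 1 \<in> H" using bc ac by (simp add: H_def free_carrier_closed)
      then have "?b * a - 1 \<in> K'" using HK' by blast
      then have "?b * a - (?b * a - 1) \<in> K'"
        by (rule left_ideal_diff[OF K' left_idealD(4)[OF K' bc a]])
      with K'1 show False by simp
    qed
  qed
  have K'_iff: "a \<in> K' \<longleftrightarrow> \<rho> a * y \<in> K" if "a \<in> free_carrier N" for a
    using HK' K'H that by (auto simp: H_def)

  let ?L = "L_module N s p \<Lambda>" and ?L' = "L_module N ?s p \<Lambda>'"
  let ?c = "L_map N s p \<Lambda>" and ?c' = "L_map N ?s p \<Lambda>'"
  note pres = presents_L[OF deg, of s] and pres' = presents_L[OF deg', of ?s]
  define f where "f a = ?c (\<rho> a * y)" for a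
  have f_eq: "f a = f b \<longleftrightarrow> ?c' a = ?c' b" if a: "a \<in> free_carrier N" and b: "b \<in> free_carrier N" for a b
  proof -
    have "f a = f b \<longleftrightarrow> \<rho> a * y - \<rho> b * y \<in> K"
      unfolding f_def K_def using a b y(2) \<rho>_closed by (intro L_map_eq_iff[OF deg]) (simp_all add: free_carrier_closed)
    also have "\<rho> a * y - \<rho> b * y = \<rho> (a - b) * y" by (simp add: \<rho>_simps left_diff_distrib)
    also have "\<dots> \<in> K \<longleftrightarrow> a - b \<in> K'" using K'_iff[of "a - b"] a b by (simp add: free_carrier_closed)
    also have "\<dots> \<longleftrightarrow> ?c' a = ?c' b" unfolding K'_def using L_map_eq_iff[OF deg' a b, of ?s] by simp
    finally show ?thesis .
  qed
  have f_image: "f ` free_carrier N = carrier ?L"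
  proof (intro subset_antisym subsetI)
    fix x assume "x \<in> f ` free_carrier N"
    then obtain a where a: "x = f a" "a \<in> free_carrier N" by (rule imageE)
    then show "x \<in> carrier ?L"
      unfolding f_def using y(2) \<rho>_closed presents_closed[OF pres] by (simp add: free_carrier_closed)
  next
    fix x assume "x \<in> carrier ?L"
    then have "x \<in> ?c ` free_carrier N" by (simp add: presents_image[OF pres])
    then obtain a where a: "x = ?c a" "a \<in> free_carrier N" by (rule imageE)
    obtain b where b: "b \<in> free_carrier N" "b * y - 1 \<in> K" using K_maximal[OF y(2) yK] by blast
    have "a * (b * y - 1) \<in> K" by (rule left_idealD(4)[OF K a(2) b(2)])
    also have "a * (b * y - 1) = a * b * y - a" by (simp add: algebra_simps)
    finally have "?c (a * b * y) = ?c a"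
      unfolding K_def using a b y(2) by (subst L_map_eq_iff[OF deg]) (simp_all add: free_carrier_closed)
    then have "x = f (\<rho> (a * b))" by (simp add: f_def \<rho>_\<rho> a)
    moreover have "\<rho> (a * b) \<in> free_carrier N" using \<rho>_closed a b by (simp add: free_carrier_closed)
    ultimately show "x \<in> f ` free_carrier N" by (rule image_eqI)
  qed
  define \<phi> where "\<phi> x = ?c' (SOME a. a \<in> free_carrier N \<and> f a = x)" for x
  have \<phi>_f: "\<phi> (f a) = ?c' a" if a: "a \<in> free_carrier N" for a
  proof -
    have "(SOME b. b \<in> free_carrier N \<and> f b = f a) \<in> free_carrier N \<and> f (SOME b. b \<in> free_carrier N \<and> f b = f a) = f a"
      by (rule someI[of "\<lambda>b. b \<in> free_carrier N \<and> f b = f a" a]) (simp add: a)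
    then show ?thesis unfolding \<phi>_def using f_eq[OF _ a] by blast
  qed
  have f_exists: "\<exists>a. a \<in> free_carrier N \<and> x = f a" if "x \<in> carrier ?L" for x
    using that unfolding f_image[symmetric] by (rule imageE) (intro exI conjI)
  have \<phi>_image: "\<phi> ` carrier ?L = carrier ?L'"
  proof -
    have "\<phi> ` f ` free_carrier N = ?c' ` free_carrier N" unfolding image_image by (rule image_cong[OF refl \<phi>_f])
    then show ?thesis by (simp add: f_image presents_image[OF pres'])
  qed
  have \<phi>_inj: "inj_on \<phi> (carrier ?L)"
  proof (rule inj_onI)
    fix x z assume x: "x \<in> carrier ?L" and z: "z \<in> carrier ?L" and eq: "\<phi> x = \<phi> z"
    obtain a where a: "a \<in> free_carrier N" "x = f a" using f_exists[OF x] by (elim exE conjE)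
    obtain b where b: "b \<in> free_carrier N" "z = f b" using f_exists[OF z] by (elim exE conjE)
    have "?c' a = ?c' b" using eq unfolding a(2) b(2) \<phi>_f[OF a(1)] \<phi>_f[OF b(1)] .
    then show "x = z" unfolding a(2) b(2) f_eq[OF a(1) b(1)] .
  qed
  have \<phi>_add: "\<phi> (x \<oplus>\<^bsub>?L\<^esub> z) = \<phi> x \<oplus>\<^bsub>?L'\<^esub> \<phi> z" if x: "x \<in> carrier ?L" and z: "z \<in> carrier ?L" for x z
  proof -
    obtain a where a: "a \<in> free_carrier N" "x = f a" using f_exists[OF x] by (elim exE conjE)
    obtain b where b: "b \<in> free_carrier N" "z = f b" using f_exists[OF z] by (elim exE conjE)
    have "x \<oplus>\<^bsub>?L\<^esub> z = f (a + b)"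
      unfolding a(2) b(2) f_def \<rho>_simps distrib_right
      using presents_add[OF pres, of "\<rho> a * y" "\<rho> b * y"] a(1) b(1) y(2) \<rho>_closed by (simp add: free_carrier_closed)
    then have "\<phi> (x \<oplus>\<^bsub>?L\<^esub> z) = ?c' (a + b)" using \<phi>_f[OF free_carrier_add[OF a(1) b(1)]] by simp
    also have "\<dots> = \<phi> x \<oplus>\<^bsub>?L'\<^esub> \<phi> z"
      unfolding a(2) b(2) \<phi>_f[OF a(1)] \<phi>_f[OF b(1)] by (rule presents_add[OF pres' a(1) b(1)])
    finally show ?thesis .
  qed
  have \<phi>_smult: "\<phi> (relabel_level \<sigma> r \<odot>\<^bsub>?L\<^esub> x) = r \<odot>\<^bsub>?L'\<^esub> \<phi> x"
    if r: "r \<in> carrier (yangian_level N ?s p)" and x: "x \<in> carrier ?L" for r x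
  proof -
    have "r \<in> level_class N ?s p ` free_carrier N" using r by (simp add: level_class_image)
    then obtain b where b: "r = level_class N ?s p b" "b \<in> free_carrier N" by (rule imageE)
    obtain a where a: "a \<in> free_carrier N" "x = f a" using f_exists[OF x] by (elim exE conjE)
    have "relabel_level \<sigma> r \<odot>\<^bsub>?L\<^esub> x = f (b * a)"
      unfolding a(2) f_def b(1) \<rho>_level[OF b(2)] \<rho>_simps mult.assoc
      using presents_mult[OF pres \<rho>_closed[OF b(2)], of "\<rho> a * y"] a(1) y(2) \<rho>_closed by (simp add: free_carrier_closed)
    then have "\<phi> (relabel_level \<sigma> r \<odot>\<^bsub>?L\<^esub> x) = ?c' (b * a)" using \<phi>_f[OF free_algebra_mult_closed[OF b(2) a(1)]] by simp
    also have "\<dots> = r \<odot>\<^bsub>?L'\<^esub> \<phi> x"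
      unfolding a(2) \<phi>_f[OF a(1)] b(1) by (rule presents_mult[OF pres' b(2) a(1)])
    finally show ?thesis .
  qed
  show ?thesis
    unfolding modules_isomorphic_def
    by (rule exI[of _ \<phi>]) (simp add: pullback_module_def bij_betw_def \<phi>_inj \<phi>_image \<phi>_add \<phi>_smult)
qed

lemma poly_prod_linear:
  "poly (\<Prod>r = a..b. [:f r, 1:]) u = root_poly (map (\<lambda>r. - f r) [a..<Suc b]) u"
proof -
  have "poly (\<Prod>r = a..b. [:f r, 1:]) u = (\<Prod>r\<in>set [a..<Suc b]. u + f r)"
    by (simp only: poly_prod set_upt atLeastLessThanSuc_atLeastAtMost) (simp add: add.commute)
  also have "\<dots> = (\<Prod>r\<leftarrow>[a..<Suc b]. u + f r)"
    by (rule prod.distinct_set_conv_list) simp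
  finally show ?thesis by (simp only: root_poly_def map_map o_def diff_minus_eq_add)
qed

lemma degree_prod_linear: "degree (\<Prod>r = a..b. [:f r, 1 :: complex:]) = Suc b - a"
  by (subst degree_prod_eq_sum_degree) simp_all

lemma degree_highest_weight: "degree (highest_weight p l j) \<le> p"
  by (simp add: highest_weight_def degree_prod_linear)

lemma degree_reflected_weight: "k \<le> p \<Longrightarrow> degree (reflected_weight c p i k l j) \<le> p"
  by (auto simp: reflected_weight_def degree_highest_weight degree_prod_linear intro!: degree_mult_le[THEN order_trans])

lemma highest_weight_split:
  assumes "k \<le> p"
  shows "highest_weight p l j = (\<Prod>r = 1..k. [:l j r, 1:]) * (\<Prod>r = k + 1..p. [:l j r, 1:])"
  using prod.ub_add_nat[of 1 k "\<lambda>r. [:l j r, 1:]" "p - k"] assms by (simp add: highest_weight_def)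

lemma odd_reflection_nonzero:
  fixes l :: "nat \<Rightarrow> nat \<Rightarrow> complex" and i :: nat
  defines "\<sigma> \<equiv> transpose i (i + 1)"
  assumes i: "1 \<le> i" "i + 1 \<le> N" and par: "s i + s (i + 1) = 1" and k: "k \<le> p"
    and common: "\<forall>r \<in> {k + 1..p}. l i r = l (i + 1) r"
    and coprime: "\<forall>r \<in> {1..k}. \<forall>q \<in> {1..k}. l i r \<noteq> l (i + 1) q"
    and ne: "verma_kernel N s p (highest_weight p l) \<noteq> free_carrier N"
  shows "modules_isomorphic (yangian_level N (s \<circ> \<sigma>) p)
    (pullback_module (relabel_level \<sigma>) (L_module N s p (highest_weight p l)))
    (L_module N (s \<circ> \<sigma>) p (reflected_weight (- ((- 1) ^ s i)) p i k l))"
proof -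
  define e :: complex where "e = (- 1) ^ s i"
  let ?fs = "map (\<lambda>r. - l i r) [1..<Suc k]" and ?gs = "map (\<lambda>r. - l (i + 1) r) [1..<Suc k]"
    and ?hs = "map (\<lambda>r. - l i r) [k + 1..<Suc p]"
  have hs: "(\<Prod>r = k + 1..p. [:l (i + 1) r, 1:]) = (\<Prod>r = k + 1..p. [:l i r, 1:])"
    by (rule prod.cong) (use common in auto)
  have shift: "poly (\<Prod>r = 1..k. [:l j r - e, 1:]) u = root_poly (map (\<lambda>r. - l j r) [1..<Suc k]) (u - e)" for j u
    unfolding poly_prod_linear root_poly_shift[symmetric] by (simp add: o_def)
  show ?thesis
    unfolding \<sigma>_def
  proof (rule reflection_isomorphism[where fs = ?fs and gs = ?gs and hs = ?hs])
    show "poly (highest_weight p l i) u = root_poly ?fs u * root_poly ?hs u" for u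
      by (simp only: highest_weight_split[OF k] poly_mult poly_prod_linear)
    show "poly (highest_weight p l (i + 1)) u = root_poly ?gs u * root_poly ?hs u" for u
      by (simp only: highest_weight_split[OF k] hs poly_mult poly_prod_linear)
    show "poly (reflected_weight (- ((- 1) ^ s i)) p i k l i) u = root_poly ?gs (u - (- 1) ^ s i) * root_poly ?hs u" for u
      using shift[of "i + 1" u] unfolding e_def[symmetric]
      by (simp only: reflected_weight_def if_True refl hs poly_mult poly_prod_linear[of _ "k + 1" p] diff_conv_add_uminus)
    show "poly (reflected_weight (- ((- 1) ^ s i)) p i k l (i + 1)) u = root_poly ?fs (u - (- 1) ^ s i) * root_poly ?hs u" for u
    proof -
      have "reflected_weight (- e) p i k l (i + 1) = (\<Prod>r = 1..k. [:l i r - e, 1:]) * (\<Prod>r = k + 1..p. [:l i r, 1:])"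
        by (simp add: reflected_weight_def)
      then show ?thesis
        using shift[of i u] unfolding e_def[symmetric] by (simp only: poly_mult poly_prod_linear[of _ "k + 1" p])
    qed
    show "length ?fs + length ?hs = p"
      by (simp only: length_map length_upt) (use k in arith)
    show "set ?fs \<inter> set ?gs = {}" using coprime by auto
  qed (use i par k ne degree_highest_weight degree_reflected_weight in \<open>auto simp: reflected_weight_def\<close>)
qed

text \<open>
  If the Verma module of the original weight is zero, then so is that of the reflected weight: otherwise
  \<open>odd_reflection_nonzero\<close>, applied to the reflected data, would give an isomorphism of a
  nonzero module with a zero module.
\<close>

theorem odd_reflection:
  fixes l :: "nat \<Rightarrow> nat \<Rightarrow> complex" and i :: nat
  defines "\<sigma> \<equiv> transpose i (i + 1)"
  assumes i: "1 \<le> i" "i + 1 \<le> N" and par: "s i + s (i + 1) = 1" and k: "k \<le> p"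
    and common: "\<forall>r \<in> {k + 1..p}. l i r = l (i + 1) r"
    and coprime: "\<forall>r \<in> {1..k}. \<forall>q \<in> {1..k}. l i r \<noteq> l (i + 1) q"
  shows "modules_isomorphic (yangian_level N (s \<circ> \<sigma>) p)
    (pullback_module (relabel_level \<sigma>) (L_module N s p (highest_weight p l)))
    (L_module N (s \<circ> \<sigma>) p (reflected_weight (- ((- 1) ^ s i)) p i k l))"
proof (cases "verma_kernel N s p (highest_weight p l) = free_carrier N")
  case False
  then show ?thesis unfolding \<sigma>_def by (rule odd_reflection_nonzero[OF i par k common coprime])
next
  case True
  let ?s = "s \<circ> \<sigma>"
  define c :: complex where "c = - ((- 1) ^ s i)"
  let ?\<Lambda> = "highest_weight p l" and ?\<Lambda>' = "reflected_weight c p i k l"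
  let ?L = "L_module N s p ?\<Lambda>" and ?L' = "L_module N ?s p ?\<Lambda>'"
  have deg: "\<forall>j\<in>{1..N}. degree (?\<Lambda> j) \<le> p" and deg': "\<forall>j\<in>{1..N}. degree (?\<Lambda>' j) \<le> p"
    by (simp_all add: degree_highest_weight degree_reflected_weight k)
  have L: "carrier ?L = {\<zero>\<^bsub>?L\<^esub>}" by (rule L_module_zero[OF deg True])
  have "verma_kernel N ?s p ?\<Lambda>' = free_carrier N"
  proof (rule ccontr)
    assume ne: "verma_kernel N ?s p ?\<Lambda>' \<noteq> free_carrier N"
    \<comment> \<open>The numbers \<open>l'\<close> define the reflected weight, with the same numbering of the roots.\<close>
    define l' where "l' j r = (if j = i then (if r \<le> k then l (i + 1) r + c else l (i + 1) r)
      else if j = i + 1 then (if r \<le> k then l i r + c else l i r) else l j r)" for j r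
    have hw: "highest_weight p l' = ?\<Lambda>'"
    proof
      fix j
      show "highest_weight p l' j = ?\<Lambda>' j"
        unfolding reflected_weight_def
        using highest_weight_split[OF k, of l' j]
        by (auto simp: l'_def highest_weight_def intro!: arg_cong2[of _ _ _ _ "(*)"] prod.cong)
    qed
    have rw: "reflected_weight (- c) p i k l' = ?\<Lambda>"
    proof
      fix j
      show "reflected_weight (- c) p i k l' j = ?\<Lambda> j"
        unfolding reflected_weight_def
        using highest_weight_split[OF k, of l j]
        by (auto simp: l'_def highest_weight_def intro!: arg_cong2[of _ _ _ _ "(*)"] prod.cong)
    qed
    have si: "?s i = s (i + 1)" "?s (i + 1) = s i" by (simp_all add: \<sigma>_def)
    have "s i = 0 \<and> s (i + 1) = 1 \<or> s i = 1 \<and> s (i + 1) = 0" using par by auto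
    then have c': "- ((- 1) ^ ?s i) = - c" unfolding si by (auto simp: c_def)
    have "modules_isomorphic (yangian_level N (?s \<circ> \<sigma>) p)
      (pullback_module (relabel_level \<sigma>) (L_module N ?s p (highest_weight p l')))
      (L_module N (?s \<circ> \<sigma>) p (reflected_weight (- ((- 1) ^ ?s i)) p i k l'))"
      unfolding \<sigma>_def
    proof (rule odd_reflection_nonzero[OF i _ k])
      show "(s \<circ> transpose i (i + 1)) i + (s \<circ> transpose i (i + 1)) (i + 1) = 1"
        using si par by (simp add: \<sigma>_def)
      show "\<forall>r\<in>{k + 1..p}. l' i r = l' (i + 1) r" using common by (simp add: l'_def)
      show "\<forall>r\<in>{1..k}. \<forall>q\<in>{1..k}. l' i r \<noteq> l' (i + 1) q" using coprime by (fastforce simp: l'_def)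
      show "verma_kernel N (s \<circ> transpose i (i + 1)) p (highest_weight p l') \<noteq> free_carrier N"
        using ne unfolding hw \<sigma>_def .
    qed
    moreover have "?s \<circ> \<sigma> = s" by (auto simp: \<sigma>_def fun_eq_iff)
    ultimately have "modules_isomorphic (yangian_level N s p) (pullback_module (relabel_level \<sigma>) ?L') ?L"
      by (simp only: hw c' rw)
    then obtain \<phi> where "bij_betw \<phi> (carrier ?L') (carrier ?L)"
      unfolding modules_isomorphic_def by (auto simp: pullback_module_def)
    then have "card (carrier ?L') = 1" using bij_betw_same_card[of \<phi> "carrier ?L'" "carrier ?L"] L by simp
    then obtain x where x: "carrier ?L' = {x}" by (rule card_1_singletonE)
    show False by (rule notE[OF L_module_nonzero[OF deg' ne] x])
  qed
  then have L': "carrier ?L' = {\<zero>\<^bsub>?L'\<^esub>}" by (rule L_module_zero[OF deg'])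
  note pres' = presents_L[of N ?\<Lambda>' p ?s, OF deg']
  have add: "\<zero>\<^bsub>?L'\<^esub> \<oplus>\<^bsub>?L'\<^esub> \<zero>\<^bsub>?L'\<^esub> = \<zero>\<^bsub>?L'\<^esub>"
    using presents_add[OF pres' free_carrier_0 free_carrier_0] presents_0[OF pres'] by simp
  have smult: "r \<odot>\<^bsub>?L'\<^esub> \<zero>\<^bsub>?L'\<^esub> = \<zero>\<^bsub>?L'\<^esub>" if "r \<in> carrier (yangian_level N ?s p)" for r
  proof -
    have "r \<in> level_class N ?s p ` free_carrier N" using that by (simp add: level_class_image)
    then obtain b where "r = level_class N ?s p b" "b \<in> free_carrier N" by (rule imageE)
    then show ?thesis using presents_mult[OF pres' _ free_carrier_0] presents_0[OF pres'] by simp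
  qed
  show ?thesis
    unfolding modules_isomorphic_def c_def[symmetric]
    by (rule exI[of _ "\<lambda>_. \<zero>\<^bsub>?L'\<^esub>"]) (simp add: pullback_module_def bij_betw_def L L' add smult)
qed

theorem theorem4p4:
  fixes m n p i k :: nat
    and s :: "nat \<Rightarrow> nat"
    and l :: "nat \<Rightarrow> nat \<Rightarrow> complex"
  assumes "parity_sequence m n s"
    and "1 \<le> i" and "i + 1 \<le> m + n"
    and "k \<le> p"
    and "\<forall>r \<in> {k + 1..p}. l i r = l (i + 1) r"
    and "\<forall>r \<in> {1..k}. \<forall>q \<in> {1..k}. l i r \<noteq> l (i + 1) q"
  shows "(s i = 0 \<and> s (i + 1) = 1 \<longrightarrow>
           (let s' = s(i := 1, i + 1 := 0) in
            modules_isomorphic (yangian_level (m + n) s' p)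
              (pullback_module (relabel_level (transpose i (i + 1)))
                (L_module (m + n) s p (highest_weight p l)))
              (L_module (m + n) s' p (reflected_weight (-1) p i k l))))
       \<and> (s i = 1 \<and> s (i + 1) = 0 \<longrightarrow>
           (let s' = s(i := 0, i + 1 := 1) in
            modules_isomorphic (yangian_level (m + n) s' p)
              (pullback_module (relabel_level (transpose i (i + 1)))
                (L_module (m + n) s p (highest_weight p l)))
              (L_module (m + n) s' p (reflected_weight 1 p i k l))))"
proof -
  note reflection = odd_reflection[of i "m + n" s k p l, OF assms(2,3) _ assms(4-6)]
  have swap: "s \<circ> transpose i (i + 1) = s(i := s (i + 1), i + 1 := s i)"
    by (auto simp: fun_eq_iff transpose_def)
  show ?thesis
  proof (intro conjI impI)
    assume "s i = 0 \<and> s (i + 1) = 1"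
    then show "let s' = s(i := 1, i + 1 := 0) in
            modules_isomorphic (yangian_level (m + n) s' p)
              (pullback_module (relabel_level (transpose i (i + 1)))
                (L_module (m + n) s p (highest_weight p l)))
              (L_module (m + n) s' p (reflected_weight (-1) p i k l))"
      using reflection unfolding swap Let_def by simp
  next
    assume "s i = 1 \<and> s (i + 1) = 0"
    then show "let s' = s(i := 0, i + 1 := 1) in
            modules_isomorphic (yangian_level (m + n) s' p)
              (pullback_module (relabel_level (transpose i (i + 1)))
                (L_module (m + n) s p (highest_weight p l)))
              (L_module (m + n) s' p (reflected_weight 1 p i k l))"
      using reflection unfolding swap Let_def by simp
  qed
qed

end
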